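(* Let $n\ge3$, $0<\lambda\le\Lambda$, and $\widetilde N_-=\frac{\Lambda}{\lambda}(n-1)+1$. Let $g:[0,\infty)\to[0,\infty)$ be continuous, put $G(t)=\int_0^t g(\tau)\,d\tau$ and $\varphi_g(s)=\int_0^s e^{G(t)}\,dt$, and for $p>1$ consider the equation $$(\mathcal{L}^-_g)\qquad \mathcal{M}^{-}_{\lambda,\Lambda}\big(D^2u+g(u)\nabla u\otimes\nabla u\big)+\varphi_g(u)^{p}e^{-G(u)}=0,\quad u\ge0\quad\text{in }\mathbb{R}^n .$$ Set $p^s_-=\frac{\widetilde N_-}{\widetilde N_--2}$, $p^o_-=\frac{\widetilde N_-+2}{\widetilde N_--2}$ and $p^p_-:=p^*_n=\frac{n+2}{n-2}$. Then there exists a critical exponent $p^*_-$ with $1<p^s_-<p^*_-<p^p_-$ and $p^o_-<p^*_-<p^p_-$ such that: (i) if $1<p<p^*_-$, then $(\mathcal{L}^-_g)$ does not admit non-trivial radial solutions; (ii) if $p=p^*_-$, then $(\mathcal{L}^-_g)$ has a unique $g$-fast decaying radial solution; (iii) if $p^*_-<p\le p^p_-$, then $(\mathcal{L}^-_g)$ has a unique radial solution, which is a $g$-slow decaying or a $g$-pseudo-slow decaying solution; (iv) if $p>p^p_-$, then $(\mathcal{L}^-_g)$ has a unique $g$-slow decaying radial solution. In (ii), (iii) and (iv) the uniqueness is understood up to scaling.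
   Context: For a symmetric $n\times n$ matrix $M$ with eigenvalues $e_1,\dots,e_n$, $\mathcal{M}^{-}_{\lambda,\Lambda}(M)=\lambda\sum_{e_i>0}e_i+\Lambda\sum_{e_i<0}e_i$. $D^2u$ is the Hessian matrix of $u$, and $\xi\otimes\xi$ is the matrix $(\xi_i\xi_j)$. Solutions are classical ($C^2$, nonnegative); the trivial solution is $u\equiv0$, which is disregarded in the uniqueness assertions; radial means $u=u(r)$, $r=|x|$. Let $\alpha=2/(p-1)$. A radial solution $u=u(r)$ is called: $g$-pseudo-slow decaying if there are constants $0<C_1<C_2$ with $C_1=\liminf_{r\to\infty}r^{\alpha}\varphi_g(u(r))<\limsup_{r\to\infty}r^\alpha\varphi_g(u(r))=C_2$; $g$-slow decaying if there is $c_*>0$ with $\lim_{r\to\infty}r^\alpha\varphi_g(u(r))=c_*$; $g$-fast decaying if there is $C>0$ with $\lim_{r\to\infty}r^{\widetilde N_--2}\varphi_g(u(r))=C$. Scaling: if $u$ is a radial solution and $c>0$, then $u_c(r)=\varphi_g^{-1}\big(c\,\varphi_g(u(c^{1/\alpha}r))\big)$ is again a radial solution (here $\varphi_g$ is a $C^2$ diffeomorphism of $[0,\infty)$ onto itself); uniqueness up to scaling means any two solutions of the stated type are related by $u\mapsto u_c$ for some $c>0$.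
   Formalization: The strict inequalities p^o_- < p^*_- < p^p_- are asserted only for λ < Λ; for λ = Λ one has p^o_- = p^p_-, so the printed chain is impossible and is replaced by p^o_- ≤ p^*_- ≤ p^p_-. Everything else, including 1 < p^s_- < p^*_- and (i)–(iv), is kept for all λ ≤ Λ. *)

theory Defs
  imports "HOL-Analysis.Analysis" "HOL-Computational_Algebra.Polynomial"
begin

definition charpoly :: "real^'n^'n \<Rightarrow> real poly" where
  "charpoly M = det (mat [:0, 1:] - map_matrix (\<lambda>a. [:a:]) M)"

text \<open>The multiset of real eigenvalues, counted with algebraic multiplicity; for symmetric
  matrices it has exactly n elements.\<close>
definition eigenvalues :: "real^'n^'n \<Rightarrow> real multiset" where
  "eigenvalues M = proots (charpoly M)"

definition pucci_minus :: "real \<Rightarrow> real \<Rightarrow> real^'n^'n \<Rightarrow> real" where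
  "pucci_minus lam Lam M =
     lam * sum_mset (filter_mset (\<lambda>e. e > 0) (eigenvalues M)) +
     Lam * sum_mset (filter_mset (\<lambda>e. e < 0) (eigenvalues M))"

definition gradient :: "(real^'n \<Rightarrow> real) \<Rightarrow> real^'n \<Rightarrow> real^'n" where
  "gradient u x = (\<chi> i. frechet_derivative u (at x) (axis i 1))"

definition hessian :: "(real^'n \<Rightarrow> real) \<Rightarrow> real^'n \<Rightarrow> real^'n^'n" where
  "hessian u x = jacobian (gradient u) (at x)"

definition C2 :: "(real^'n \<Rightarrow> real) \<Rightarrow> bool" where
  "C2 u \<longleftrightarrow> (\<forall>x. u differentiable at x) \<and> (\<forall>x. gradient u differentiable at x) \<and>
     continuous_on UNIV (hessian u)"

definition tensor_square :: "real^'n \<Rightarrow> real^'n^'n" where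
  "tensor_square \<xi> = (\<chi> i j. \<xi> $ i * \<xi> $ j)"

definition G_of :: "(real \<Rightarrow> real) \<Rightarrow> real \<Rightarrow> real" where
  "G_of g t = integral {0..t} g"

definition phi :: "(real \<Rightarrow> real) \<Rightarrow> real \<Rightarrow> real" where
  "phi g s = integral {0..s} (\<lambda>t. exp (G_of g t))"

definition classical_solution ::
  "real \<Rightarrow> real \<Rightarrow> (real \<Rightarrow> real) \<Rightarrow> real \<Rightarrow> (real^'n \<Rightarrow> real) \<Rightarrow> bool" where
  "classical_solution lam Lam g p u \<longleftrightarrow>
     C2 u \<and> (\<forall>x. u x \<ge> 0) \<and>
     (\<forall>x. pucci_minus lam Lam (hessian u x + g (u x) *\<^sub>R tensor_square (gradient u x))
           + phi g (u x) powr p * exp (- G_of g (u x)) = 0)"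

text \<open>Radial solutions are represented by their profile \<open>U\<close>, i.e. \<open>u x = U (norm x)\<close>; only the
  values of \<open>U\<close> on \<open>{0..}\<close> matter.  The type argument supplies the dimension.\<close>
definition nontrivial_radial_solution ::
  "'n::finite itself \<Rightarrow> real \<Rightarrow> real \<Rightarrow> (real \<Rightarrow> real) \<Rightarrow> real \<Rightarrow> (real \<Rightarrow> real) \<Rightarrow> bool" where
  "nontrivial_radial_solution _ lam Lam g p U \<longleftrightarrow>
     classical_solution lam Lam g p (\<lambda>x::real^'n. U (norm x)) \<and> (\<exists>x::real^'n. U (norm x) \<noteq> 0)"

definition alpha_of :: "real \<Rightarrow> real" where
  "alpha_of p = 2 / (p - 1)"

definition pseudo_slow_decaying :: "(real \<Rightarrow> real) \<Rightarrow> real \<Rightarrow> (real \<Rightarrow> real) \<Rightarrow> bool" where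
  "pseudo_slow_decaying g p U \<longleftrightarrow>
     (\<exists>C1 C2::real. 0 < C1 \<and> C1 < C2 \<and>
        Liminf at_top (\<lambda>r::real. ereal (r powr alpha_of p * phi g (U r))) = ereal C1 \<and>
        Limsup at_top (\<lambda>r::real. ereal (r powr alpha_of p * phi g (U r))) = ereal C2)"

definition slow_decaying :: "(real \<Rightarrow> real) \<Rightarrow> real \<Rightarrow> (real \<Rightarrow> real) \<Rightarrow> bool" where
  "slow_decaying g p U \<longleftrightarrow>
     (\<exists>c>0. ((\<lambda>r. r powr alpha_of p * phi g (U r)) \<longlongrightarrow> c) at_top)"

definition fast_decaying :: "real \<Rightarrow> (real \<Rightarrow> real) \<Rightarrow> (real \<Rightarrow> real) \<Rightarrow> bool" where
  "fast_decaying N g U \<longleftrightarrow>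
     (\<exists>C>0. ((\<lambda>r. r powr (N - 2) * phi g (U r)) \<longlongrightarrow> C) at_top)"

definition scaled :: "(real \<Rightarrow> real) \<Rightarrow> real \<Rightarrow> real \<Rightarrow> (real \<Rightarrow> real) \<Rightarrow> real \<Rightarrow> real" where
  "scaled g p c U r = inv_into {0..} (phi g) (c * phi g (U (c powr (1 / alpha_of p) * r)))"

definition unique_up_to_scaling ::
  "(real \<Rightarrow> real) \<Rightarrow> real \<Rightarrow> ((real \<Rightarrow> real) \<Rightarrow> bool) \<Rightarrow> bool" where
  "unique_up_to_scaling g p P \<longleftrightarrow>
     (\<exists>U. P U) \<and> (\<forall>U V. P U \<and> P V \<longrightarrow> (\<exists>c>0. \<forall>r\<ge>0. V r = scaled g p c U r))"

end

theory Submission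
  imports Defs
begin

text \<open>
Put \<open>v = \<phi>\<^sub>g(u)\<close>: the equation becomes \<open>M\<^sup>-(D\<^sup>2v) + v\<^sup>p = 0\<close>, and a radial solution \<open>v\<close> is a
rescaling of the solution of an ordinary initial value problem with \<open>v(0) = 1\<close>. With \<open>t = ln r\<close>,
\<open>x = - r v'/v\<close> and \<open>z = - r v\<^sup>p/v'\<close> that problem turns into an autonomous planar system whose
\<open>x\<close>-equation does not contain \<open>p\<close>, while \<open>z'\<close> decreases with \<open>p\<close>. Written as graphs of \<open>z\<close> over \<open>x\<close>,
the orbits are therefore ordered by \<open>p\<close>, both near \<open>r = 0\<close> and afterwards; the slope at which
a fast decaying orbit enters the point \<open>(N - 2, 0)\<close> is ordered in the opposite way. Hence the
exponents whose orbit crosses \<open>x = N - 2\<close> monotonically (\<open>v\<close> vanishes at a finite radius) form an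
open interval, its supremum \<open>p\<^sup>*\<close> is the only exponent with a fast decaying orbit, and beyond it \<open>x\<close>
stays away from \<open>N - 2\<close>, which bounds \<open>r\<^sup>\<alpha> v\<close> from both sides. The Pohozaev energy \<open>E\<close> of the
dimension \<open>N\<close> Lane--Emden equation locates \<open>p\<^sup>*\<close> and forces convergence for \<open>p > p\<^sup>p\<close>.
\<close>

section \<open>Real functions of one variable\<close>


text \<open>The obstacle is the corner of \<open>k\<close> at \<open>z = n - 1\<close>. With
  \<open>w = r^al v\<close> and \<open>t = ln r\<close>, \<open>E\<close> is the Emden-Fowler energy
  \<open>w_t^2 - al (N - 2 - al) w^2 + 2 kap w^(p+1) / (p + 1)\<close>. Below the corner its
  derivative is \<open>- 2 (N - 2 - 2 al) w_t^2\<close>, so it can be used for every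
  \<open>p \<ge> po\<close>; above the corner an extra term of variable sign appears. There only the
  starting slope helps: the tangent at the start is a barrier whose side changes at
  \<open>pp\<close>, and for \<open>p \<ge> pp\<close> it confines the orbit to where the extra term
  is harmless. Below \<open>pp\<close> this is lost, and at \<open>pp\<close> the dissipation
  \<open>rate\<close> is 0, so for \<open>pst < p \<le> pp\<close> only two-sided bounds remain;
  hence the alternative of slow and pseudo-slow decay. If \<open>al < N - 2\<close>, the only
  stationary point with \<open>x, z > 0\<close> has \<open>x = al\<close> and \<open>E < 0\<close>,
  so a bound \<open>E \<ge> 0\<close> keeps limits of orbits away from it. If \<lambda> = \<Lambda>,
  then \<open>N = n\<close> and \<open>po\<close>, \<open>pst\<close>, \<open>pp\<close> coincide;
  this case needs its own arguments, since \<open>E\<close> is identically 0 on the critical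
  orbit.\<close>

lemma first_zero:
  fixes f :: "real \<Rightarrow> real"
  assumes "a \<le> b" and cont: "continuous_on {a..b} f" and pos: "f a > 0"
    and zero: "\<And>t. a < t \<Longrightarrow> t \<le> b \<Longrightarrow> f t = 0 \<Longrightarrow> (\<And>s. a \<le> s \<Longrightarrow> s < t \<Longrightarrow> f s > 0) \<Longrightarrow>
      \<exists>D>0. (f has_real_derivative D) (at t)"
  shows "f b > 0"
proof (rule ccontr)
  assume "\<not> f b > 0"
  define S where "S = {a..b} \<inter> f -` {..0}"
  have "closed S" unfolding S_def
    by (intro continuous_closed_preimage cont) auto
  moreover have bS: "b \<in> S" using \<open>\<not> f b > 0\<close> \<open>a \<le> b\<close> by (auto simp: S_def)
  moreover have bdd: "bdd_below S" by (auto simp: S_def)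
  ultimately have iS: "Inf S \<in> S" by (intro closed_contains_Inf) auto
  define t where "t = Inf S"
  have t: "a \<le> t" "t \<le> b" "f t \<le> 0" using iS by (auto simp: S_def t_def)
  have at: "a < t" using t pos by (cases "a = t") auto
  have bef: "f s > 0" if "a \<le> s" "s < t" for s
  proof (rule ccontr)
    assume "\<not> f s > 0"
    then have "s \<in> S" using that t by (auto simp: S_def)
    then show False using cInf_lower[OF _ bdd] that by (force simp: t_def)
  qed
  have "f t \<ge> 0"
  proof (rule tendsto_lowerbound[where F = "at_left t" and f = f])
    have "continuous_on {a..t} f" using continuous_on_subset[OF cont] t by auto
    then show "(f \<longlongrightarrow> f t) (at_left t)"
      using at by (simp add: continuous_on_Icc_at_leftD)
    show "\<forall>\<^sub>F s in at_left t. 0 \<le> f s"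
      using at by (auto simp: eventually_at_left intro!: exI[of _ a] less_imp_le[OF bef])
  qed auto
  then have "f t = 0" using t by simp
  \<comment> \<open>At a first zero \<open>f\<close> comes down from positive values, so a positive
    derivative there is impossible.\<close>
  then obtain D where D: "D > 0" "(f has_real_derivative D) (at t)" using zero[OF at t(2)] bef by blast
  obtain d where d: "d > 0" "\<And>h. h > 0 \<Longrightarrow> h < d \<Longrightarrow> f (t - h) < f t"
    using DERIV_pos_inc_left[OF D(2,1)] by blast
  define h where "h = min (d/2) (t - a)"
  have "h > 0" "h < d" "a \<le> t - h" "t - h < t" using d at by (auto simp: h_def min_def)
  then show False using d(2)[of h] bef[of "t - h"] \<open>f t = 0\<close> by auto
qed

text \<open>At the last time with \<open>u \<ge> d\<close> the bound holds by \<open>hi\<close>, and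
  from then on \<open>G\<close> can only grow. This avoids following \<open>u\<close> through its
  repeated crossings of the level \<open>d\<close>.\<close>

lemma last_time:
  fixes G u :: "real \<Rightarrow> real"
  assumes ab: "a \<le> b" and contu: "continuous_on {a..b} u" and contG: "continuous_on {a..b} G"
    and start: "u a \<ge> d"
    and hi: "\<And>t. a \<le> t \<Longrightarrow> t \<le> b \<Longrightarrow> u t \<ge> d \<Longrightarrow> G t \<ge> m"
    and lo: "\<And>t. a < t \<Longrightarrow> t < b \<Longrightarrow> u t < d \<Longrightarrow> \<exists>D\<ge>0. (G has_real_derivative D) (at t)"
  shows "G b \<ge> m"
proof -
  define S where "S = {a..b} \<inter> u -` {d..}"
  have "closed S" unfolding S_def
    by (intro continuous_closed_preimage contu) auto
  moreover have aS: "a \<in> S" using ab start by (auto simp: S_def)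
  moreover have bdd: "bdd_above S" by (auto simp: S_def)
  ultimately have "Sup S \<in> S" by (intro closed_contains_Sup) auto
  then have s: "a \<le> Sup S" "Sup S \<le> b" "u (Sup S) \<ge> d" by (auto simp: S_def)
  have aft: "u t < d" if "Sup S < t" "t \<le> b" for t
  proof (rule ccontr)
    assume "\<not> u t < d"
    then have "t \<in> S" using that s by (auto simp: S_def)
    then show False using cSup_upper[OF _ bdd] that by force
  qed
  have "G (Sup S) \<le> G b"
  proof (rule DERIV_nonneg_imp_increasing_open[OF s(2)])
    show "continuous_on {Sup S..b} G" using continuous_on_subset[OF contG] s by auto
    show "\<exists>y. (G has_real_derivative y) (at t) \<and> 0 \<le> y" if "Sup S < t" "t < b" for t
      using lo[of t] aft[of t] that s by auto
  qed
  with hi[OF s] show ?thesis by simp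
qed

lemma deriv_ge_linear:
  fixes f :: "real \<Rightarrow> real"
  assumes "a \<le> b" "\<And>t. a \<le> t \<Longrightarrow> t \<le> b \<Longrightarrow> \<exists>D\<ge>c. (f has_real_derivative D) (at t)"
  shows "f b \<ge> f a + c * (b - a)"
proof -
  have "f a - c * a \<le> f b - c * b"
  proof (rule DERIV_nonneg_imp_nondecreasing[OF assms(1)])
    fix t assume "a \<le> t" "t \<le> b"
    then obtain D where "D \<ge> c" "(f has_real_derivative D) (at t)" using assms(2) by blast
    then show "\<exists>y. ((\<lambda>t. f t - c * t) has_real_derivative y) (at t) \<and> 0 \<le> y"
      by (intro exI[of _ "D - c"]) (auto intro!: derivative_eq_intros)
  qed
  then show ?thesis by (simp add: algebra_simps)
qed

lemma deriv_ge_unbounded: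
  fixes f :: "real \<Rightarrow> real"
  assumes "c > 0" "\<And>t. a \<le> t \<Longrightarrow> \<exists>D\<ge>c. (f has_real_derivative D) (at t)"
  shows "\<exists>t\<ge>a. f t > B"
proof -
  define b where "b = a + (\<bar>B - f a\<bar> + 1) / c"
  have "a \<le> b" using assms by (auto simp: b_def)
  then have "f b \<ge> f a + c * (b - a)" using assms by (intro deriv_ge_linear) auto
  moreover have "c * (b - a) = \<bar>B - f a\<bar> + 1" using assms by (simp add: b_def)
  ultimately show ?thesis using \<open>a \<le> b\<close> by (intro exI[of _ b]) auto
qed

text \<open>If \<open>\<phi>\<close> reached \<open>e\<close> at a late time, it would stay above
  \<open>e / 2\<close> for the fixed time \<open>e / (2 L)\<close>, and \<open>F\<close> would grow
  by a fixed amount, contrary to convergence. \<open>\<phi>\<close> is only a lower bound for the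
  derivative because for the energy just an inequality is known.\<close>

lemma barbalat_upper:
  fixes F \<phi> :: "real \<Rightarrow> real"
  assumes lim: "(F \<longlongrightarrow> l) at_top"
    and der: "\<And>t. t \<ge> T \<Longrightarrow> \<exists>D\<ge>\<phi> t. (F has_real_derivative D) (at t)"
    and lip: "\<And>s t. s \<ge> T \<Longrightarrow> t \<ge> s \<Longrightarrow> \<bar>\<phi> t - \<phi> s\<bar> \<le> L * (t - s)" and "L > 0" and e: "e > 0"
  shows "\<forall>\<^sub>F t in at_top. \<phi> t < e"
proof -
  define d where "d = e / (2 * L)"
  have d: "d > 0" using e \<open>L > 0\<close> by (simp add: d_def)
  have "\<forall>\<^sub>F t in at_top. dist (F t) l < e * d / 8" using lim e d by (intro tendstoD) auto
  then obtain S where S: "\<And>t. t \<ge> S \<Longrightarrow> dist (F t) l < e * d / 8"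
    by (auto simp: eventually_at_top_linorder)
  have "\<phi> t < e" if t: "t \<ge> max S T" for t
  proof (rule ccontr)
    assume 1: "\<not> \<phi> t < e"
    have "F (t + d) \<ge> F t + e / 2 * (t + d - t)"
    proof (rule deriv_ge_linear)
      fix s assume s: "t \<le> s" "s \<le> t + d"
      have "L * (s - t) \<le> L * d" using s \<open>L > 0\<close> by auto
      also have "L * d = e / 2" using \<open>L > 0\<close> by (simp add: d_def)
      finally have "\<bar>\<phi> s - \<phi> t\<bar> \<le> e / 2" using lip[of t s] s t by auto
      then have "e / 2 \<le> \<phi> s" using 1 unfolding abs_le_iff by linarith
      moreover obtain D where "D \<ge> \<phi> s" "(F has_real_derivative D) (at s)" using der[of s] s t by auto
      ultimately show "\<exists>D\<ge>e/2. (F has_real_derivative D) (at s)" by (intro exI[of _ D]) auto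
    qed (use d in auto)
    then have "F (t + d) - F t \<ge> e / 2 * d" by simp
    moreover have "dist (F (t + d)) l < e * d / 8" "dist (F t) l < e * d / 8" using S[of t] S[of "t+d"] t d by auto
    ultimately show False using e d unfolding dist_real_def by (auto simp: abs_if split: if_splits)
  qed
  then show ?thesis unfolding eventually_at_top_linorder by blast
qed

lemma barbalat:
  fixes F \<phi> :: "real \<Rightarrow> real"
  assumes lim: "(F \<longlongrightarrow> l) at_top"
    and der: "\<And>t. t \<ge> T \<Longrightarrow> (F has_real_derivative \<phi> t) (at t)"
    and lip: "\<And>s t. s \<ge> T \<Longrightarrow> t \<ge> s \<Longrightarrow> \<bar>\<phi> t - \<phi> s\<bar> \<le> L * (t - s)" and L: "L > 0"
  shows "(\<phi> \<longlongrightarrow> 0) at_top"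
proof (rule tendstoI)
  fix e :: real assume e: "e > 0"
  have "\<forall>\<^sub>F t in at_top. \<phi> t < e"
    by (rule barbalat_upper[OF lim _ lip L e]) (use der in auto)
  moreover have "\<forall>\<^sub>F t in at_top. - \<phi> t < e"
  proof (rule barbalat_upper[OF tendsto_minus[OF lim] _ _ L e, of T])
    show "\<exists>D\<ge>- \<phi> t. ((\<lambda>t. - F t) has_real_derivative D) (at t)" if "T \<le> t" for t
      using DERIV_minus[OF der[OF that]] by auto
    show "\<bar>- \<phi> t - - \<phi> s\<bar> \<le> L * (t - s)" if "T \<le> s" "s \<le> t" for s t
      using lip[OF that] by (simp add: abs_minus_commute)
  qed
  ultimately show "\<forall>\<^sub>F t in at_top. dist (\<phi> t) 0 < e"
    by eventually_elim (auto simp: dist_real_def abs_less_iff)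
qed

lemma lipschitz_of_deriv:
  fixes f :: "real \<Rightarrow> real"
  assumes "\<And>t. t \<ge> T \<Longrightarrow> \<exists>D. (f has_real_derivative D) (at t) \<and> \<bar>D\<bar> \<le> B" "T \<le> s" "s \<le> t"
  shows "\<bar>f t - f s\<bar> \<le> B * (t - s)"
proof -
  have "f t \<ge> f s + (- B) * (t - s)"
  proof (rule deriv_ge_linear)
    fix r assume r: "s \<le> r" "r \<le> t"
    then obtain D where "(f has_real_derivative D) (at r)" "\<bar>D\<bar> \<le> B" using assms(1)[of r] order_trans[OF assms(2), of r] by auto
    then show "\<exists>D\<ge>- B. (f has_real_derivative D) (at r)" by (intro exI[of _ D]) auto
  qed (use assms in auto)
  moreover have "- f t \<ge> - f s + (- B) * (t - s)"
  proof (rule deriv_ge_linear[where f = "\<lambda>t. - f t"])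
    fix r assume r: "s \<le> r" "r \<le> t"
    then obtain D where "(f has_real_derivative D) (at r)" "\<bar>D\<bar> \<le> B" using assms(1)[of r] order_trans[OF assms(2), of r] by auto
    then show "\<exists>D\<ge>- B. ((\<lambda>t. - f t) has_real_derivative D) (at r)"
      by (intro exI[of _ "- D"]) (auto intro: DERIV_minus)
  qed (use assms in auto)
  ultimately show ?thesis by (simp add: abs_le_iff)
qed

lemma mono_bounded_tendsto:
  fixes f :: "real \<Rightarrow> real"
  assumes mono: "\<And>s t. T \<le> s \<Longrightarrow> s \<le> t \<Longrightarrow> f s \<le> f t" and bdd: "\<And>t. T \<le> t \<Longrightarrow> f t \<le> B"
  obtains l where "(f \<longlongrightarrow> l) at_top" "\<And>t. T \<le> t \<Longrightarrow> f t \<le> l" "l \<le> B"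
proof
  define l where "l = Sup (f ` {T..})"
  have bd: "bdd_above (f ` {T..})" using bdd by (auto simp: bdd_above_def)
  show le: "f t \<le> l" if "T \<le> t" for t using that unfolding l_def by (intro cSup_upper bd) auto
  show "l \<le> B" unfolding l_def using bdd by (intro cSup_least) auto
  show "(f \<longlongrightarrow> l) at_top"
  proof (rule order_tendstoI)
    fix a assume "a < l"
    then obtain s where s: "s \<ge> T" "a < f s" unfolding l_def using less_cSup_iff[OF _ bd] by auto
    then show "\<forall>\<^sub>F t in at_top. a < f t"
      unfolding eventually_at_top_linorder using mono[of s] by (intro exI[of _ s]) (auto intro: less_le_trans)
  next
    fix a assume "l < a"
    then show "\<forall>\<^sub>F t in at_top. f t < a"
      unfolding eventually_at_top_linorder using le by (intro exI[of _ T]) (auto intro: le_less_trans)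
  qed
qed

lemma exp_decay_tendsto_0: "c > 0 \<Longrightarrow> ((\<lambda>t::real. C * exp (- c * t)) \<longlongrightarrow> 0) at_top"
  by (intro tendsto_mult_right_zero filterlim_compose[OF exp_at_bot]
      filterlim_tendsto_neg_mult_at_bot[OF tendsto_const _ filterlim_ident]) simp


section \<open>The autonomous system\<close>


text \<open>Gronwall for the negative part: with a bound \<open>C\<close> for \<open>|c|\<close>,
  \<open>q exp (- C t)\<close> does not decrease while \<open>q < 0\<close>. No structure of
  \<open>c\<close> is used, so \<open>c\<close> may itself contain the unknown.\<close>

lemma comparison_nonneg:
  fixes q :: "real \<Rightarrow> real"
  assumes ab: "a \<le> b" and contq: "continuous_on {a..b} q" and contc: "continuous_on {a..b} c"
    and start: "q a \<ge> 0"
    and der: "\<And>t. a < t \<Longrightarrow> t < b \<Longrightarrow> q t < 0 \<Longrightarrow> \<exists>D. (q has_real_derivative D) (at t) \<and> D \<ge> c t * q t"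
  shows "q b \<ge> 0"
proof -
  have "bounded (c ` {a..b})" using compact_continuous_image[OF contc] compact_imp_bounded by blast
  then obtain C where "\<forall>t\<in>{a..b}. \<bar>c t\<bar> \<le> C" by (auto simp: bounded_iff)
  then have C: "\<And>t. a \<le> t \<Longrightarrow> t \<le> b \<Longrightarrow> \<bar>c t\<bar> \<le> C" by auto
  have "q b * exp (- C * b) \<ge> 0"
  proof (rule last_time[OF ab contq, where d = 0 and G = "\<lambda>t. q t * exp (- C * t)"])
    show "continuous_on {a..b} (\<lambda>t. q t * exp (- C * t))" by (intro continuous_intros contq)
    show "\<exists>D\<ge>0. ((\<lambda>t. q t * exp (- C * t)) has_real_derivative D) (at t)" if t: "a < t" "t < b" "q t < 0" for t
    proof -
      obtain D where D: "(q has_real_derivative D) (at t)" "D \<ge> c t * q t" using der[OF t] by blast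
      have "c t \<le> C" using C[of t] t by auto
      then have "c t * q t \<ge> C * q t" using t by (intro mult_right_mono_neg) auto
      then have "(D - C * q t) * exp (- C * t) \<ge> 0" using D by auto
      then show ?thesis using D(1)
        by (intro exI[of _ "(D - C * q t) * exp (- C * t)"]) (auto intro!: derivative_eq_intros simp: algebra_simps)
    qed
  qed (use start in auto)
  then show ?thesis by (simp add: zero_le_mult_iff)
qed

text \<open>The initial value is replaced by the limit 0 at \<open>-\<infinity>\<close>. Where
  \<open>c \<le> 0\<close>, a negative \<open>q\<close> can only increase in time, so backwards it
  would stay below a negative constant.\<close>

lemma comparison_nonneg_at_bot:
  fixes q :: "real \<Rightarrow> real"
  assumes lim: "(q \<longlongrightarrow> 0) at_bot" and c: "\<forall>\<^sub>F t in at_bot. c t \<le> 0"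
    and contq: "continuous_on {..b} q" and contc: "continuous_on {..b} c"
    and der: "\<And>t. t < b \<Longrightarrow> q t < 0 \<Longrightarrow> \<exists>D. (q has_real_derivative D) (at t) \<and> D \<ge> c t * q t"
  shows "q b \<ge> 0"
proof -
  obtain T where T: "\<And>t. t \<le> T \<Longrightarrow> c t \<le> 0" using c by (auto simp: eventually_at_bot_linorder)
  define a where "a = min T b"
  have "q a \<ge> 0"
  proof (rule ccontr)
    assume qa: "\<not> q a \<ge> 0"
    have neg: "q s \<le> q a" if "s \<le> a" for s
    proof (rule ccontr)
      assume asm: "\<not> q s \<le> q a"
      \<comment> \<open>A negative level above \<open>q a\<close> and not above \<open>q s\<close>:
        whenever \<open>q\<close> is below it, the differential inequality applies.\<close>
      define d where "d = min (q s) (q a / 2) "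
      have d: "q a < d" "d \<le> q s" "d < 0" using asm qa by (auto simp: d_def)
      have "q a \<ge> d"
      proof (rule last_time[OF that, where u = q and G = q and d = d])
        show "continuous_on {s..a} q" "continuous_on {s..a} q"
          using continuous_on_subset[OF contq, of "{s..a}"] by (auto simp: a_def)
        fix t assume t: "s < t" "t < a" "q t < d"
        then obtain D where "(q has_real_derivative D) (at t)" "D \<ge> c t * q t"
          using der[of t] d by (auto simp: a_def)
        moreover have "c t * q t \<ge> 0" using T[of t] t d by (intro mult_nonpos_nonpos) (auto simp: a_def)
        ultimately show "\<exists>D\<ge>0. (q has_real_derivative D) (at t)" by (intro exI[of _ D]) auto
      qed (use d in auto)
      then show False using d by simp
    qed
    have "0 \<le> q a"
      by (rule tendsto_upperbound[OF lim]) (auto simp: eventually_at_bot_linorder intro!: exI[of _ a] neg)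
    then show False using qa by simp
  qed
  then show ?thesis
    by (rule comparison_nonneg[where c = c, of a, rotated 3])
      (auto simp: a_def intro!: continuous_on_subset[OF contq] continuous_on_subset[OF contc] der)
qed

text \<open>
Here \<open>kap = \<Lambda>/\<lambda>\<close>, and \<open>\<Lambda>\<close> is scaled to \<open>1\<close>. The function \<open>k\<close> has a corner at \<open>z = n - 1\<close>, which is the
line \<open>v'' = 0\<close>: the system is the one of dimension \<open>n\<close> above it and of dimension \<open>N\<close> below it.
\<close>

locale pucci_ode =
  fixes n kap :: real
  assumes n_gt: "n > 2" and kap_ge: "kap \<ge> 1"
begin

definition "N = kap * (n - 1) + 1"
definition "k z = min (kap * z) (z + (kap - 1) * (n - 1))"
text \<open>\<open>m\<close> is the logarithmic derivative of \<open>x\<close> along an orbit; the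
  orbit is a graph over \<open>x\<close> as long as \<open>m > 0\<close>.\<close>

definition "m x z = x + 2 - N + k z"
definition "pp = (n + 2) / (n - 2)"
definition "po = (N + 2) / (N - 2)"

lemma N_ge: "N \<ge> n" "N > 2"
proof -
  have "kap * (n - 1) \<ge> 1 * (n - 1)" using n_gt kap_ge by (intro mult_right_mono) auto
  then have "N \<ge> n" by (simp add: N_def)
  then show "N \<ge> n" "N > 2" using n_gt by linarith+
qed

lemma N_eq: "N - n = (kap - 1) * (n - 1)" by (simp add: N_def algebra_simps)

lemma N_gt: "kap > 1 \<Longrightarrow> N > n"
  using N_eq mult_pos_pos[of "kap - 1" "n - 1"] n_gt by linarith

lemma k_lower: "z \<le> n - 1 \<Longrightarrow> k z = kap * z"
  using mult_left_mono[of z "n - 1" "kap - 1"] kap_ge by (auto simp: k_def min_def algebra_simps)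

lemma k_upper: "z \<ge> n - 1 \<Longrightarrow> k z = z + N - n"
  using mult_left_mono[of "n - 1" z "kap - 1"] kap_ge N_eq by (auto simp: k_def min_def algebra_simps)

lemma k_le: "k z \<le> kap * z" by (simp add: k_def)

lemma k_ge: "z \<ge> 0 \<Longrightarrow> k z \<ge> z"
  using kap_ge n_gt mult_right_mono[of 1 kap z] by (auto simp: k_def)

lemma k_mono: "z \<le> z' \<Longrightarrow> k z \<le> k z'"
  using kap_ge mult_left_mono[of z z' kap] unfolding k_def by (intro min.mono) auto

lemma k_cont: "continuous_on S f \<Longrightarrow> continuous_on S (\<lambda>t. k (f t))"
  unfolding k_def by (intro continuous_intros)

lemma k_tendsto: "(f \<longlongrightarrow> l) F \<Longrightarrow> ((\<lambda>t. k (f t)) \<longlongrightarrow> k l) F"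
  unfolding k_def by (intro tendsto_intros)

lemma m_upper: "z \<ge> n - 1 \<Longrightarrow> m x z \<ge> x + 1"
  by (simp add: m_def k_upper)

lemma m_pos_right: "x \<ge> N - 2 \<Longrightarrow> z > 0 \<Longrightarrow> m x z > 0"
  using k_ge[of z] by (simp add: m_def)

end

text \<open>\<open>y_lim\<close> is the second order expansion of the profile at
  \<open>r = 0\<close>; it is what tells orbits of different \<open>p\<close> apart at their common
  start \<open>(0, n)\<close>. \<open>maximal\<close> says that an orbit can end only by
  \<open>x\<close> becoming unbounded, that is, by \<open>v\<close> reaching 0.\<close>

locale orbit = pucci_ode +
  fixes p :: real and I :: "real set" and x z :: "real \<Rightarrow> real"
  assumes p_gt: "p > 1" and I_open: "open I" and I_ne: "I \<noteq> {}"
    and I_down: "\<And>s t. t \<in> I \<Longrightarrow> s \<le> t \<Longrightarrow> s \<in> I"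
    and x_deriv: "\<And>t. t \<in> I \<Longrightarrow> (x has_real_derivative x t * m (x t) (z t)) (at t)"
    and z_deriv: "\<And>t. t \<in> I \<Longrightarrow> (z has_real_derivative z t * (N - p * x t - k (z t))) (at t)"
    and x_pos: "\<And>t. t \<in> I \<Longrightarrow> x t > 0" and z_pos: "\<And>t. t \<in> I \<Longrightarrow> z t > 0"
    and x_lim: "(x \<longlongrightarrow> 0) at_bot"
    and y_lim: "((\<lambda>t. (n - z t) / x t) \<longlongrightarrow> n * p / (n + 2)) at_bot"
    and maximal: "I = UNIV \<or> (\<forall>B. \<exists>t\<in>I. x t > B)"
begin

abbreviation "mt t \<equiv> m (x t) (z t)"
definition "zeta = n * p / (n + 2)"
text \<open>\<open>x = al\<close> corresponds to \<open>v = r^(-al)\<close>, so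
  \<open>x < al\<close> means that \<open>r^al v\<close> is increasing.\<close>

definition "al = 2 / (p - 1)"

lemma al_pos: "al > 0" and al_p: "al * (p - 1) = 2" and p_eq: "p = 1 + 2 / al"
  using p_gt by (auto simp: al_def field_simps)

lemma al_gt: "al > 1 / p"
  using p_gt by (auto simp: al_def field_simps)

lemma zeta_pos: "zeta > 0" using n_gt p_gt by (simp add: zeta_def)

lemma I_bot: "\<forall>\<^sub>F t in at_bot. t \<in> I"
proof -
  obtain t where "t \<in> I" using I_ne by auto
  then show ?thesis using I_down by (auto simp: eventually_at_bot_linorder)
qed

lemma z_lim: "(z \<longlongrightarrow> n) at_bot"
proof -
  have "((\<lambda>t. n - (n - z t) / x t * x t) \<longlongrightarrow> n - n * p / (n + 2) * 0) at_bot"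
    by (intro tendsto_intros y_lim x_lim)
  moreover have "\<forall>\<^sub>F t in at_bot. n - (n - z t) / x t * x t = z t"
    using I_bot by eventually_elim (use x_pos in force)
  ultimately show ?thesis by (simp add: tendsto_cong)
qed

lemma x_isCont: "t \<in> I \<Longrightarrow> isCont x t" using x_deriv DERIV_isCont by blast
lemma z_isCont: "t \<in> I \<Longrightarrow> isCont z t" using z_deriv DERIV_isCont by blast

lemma x_cont: "S \<subseteq> I \<Longrightarrow> continuous_on S x"
  using x_isCont continuous_at_imp_continuous_on by blast
lemma z_cont: "S \<subseteq> I \<Longrightarrow> continuous_on S z"
  using z_isCont continuous_at_imp_continuous_on by blast

lemma Icc: "b \<in> I \<Longrightarrow> {a..b} \<subseteq> I" "b \<in> I \<Longrightarrow> {..b} \<subseteq> I" using I_down by auto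

lemma eventually_bot_le:
  assumes "eventually P at_bot" shows "\<exists>a\<le>b::real. P a"
proof -
  obtain T where "\<forall>t\<le>T. P t" using assms by (auto simp: eventually_at_bot_linorder)
  then show ?thesis by (intro exI[of _ "min T b"]) auto
qed

text \<open>Near the start \<open>z < n\<close> because the slope limit is positive. Afterwards
  \<open>z = n\<close> cannot be reached, since there \<open>k z = N\<close> and
  \<open>z' = - n p x < 0\<close>.\<close>

lemma z_lt: assumes "t \<in> I" shows "z t < n"
proof -
  have "\<forall>\<^sub>F t in at_bot. (n - z t) / x t > 0"
    using y_lim by (rule order_tendstoD) (use zeta_pos zeta_def in auto)
  then have "\<forall>\<^sub>F t in at_bot. z t < n"
    using I_bot by eventually_elim (use x_pos in \<open>auto simp: zero_less_divide_iff dest: less_asym\<close>)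
  then obtain a where a: "a \<le> t" "z a < n" using eventually_bot_le by blast
  have "n - z t > 0"
  proof (rule first_zero[OF a(1), where f = "\<lambda>t. n - z t"])
    show "continuous_on {a..t} (\<lambda>t. n - z t)" by (intro continuous_intros z_cont Icc assms)
    fix s assume s: "a < s" "s \<le> t" "n - z s = 0"
    have sI: "s \<in> I" using s assms I_down by auto
    have "k (z s) = N" using s k_upper[of "z s"] by auto
    then have "((\<lambda>t. n - z t) has_real_derivative n * (p * x s)) (at s)"
      using z_deriv[OF sI] s by (auto intro!: derivative_eq_intros simp: algebra_simps)
    then show "\<exists>D>0. ((\<lambda>t. n - z t) has_real_derivative D) (at s)"
      using x_pos[OF sI] p_gt n_gt by (intro exI[of _ "n * (p * x s)"]) auto
  qed (use a in auto)
  then show ?thesis by simp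
qed

lemma x_incr:
  assumes "t \<in> I" "s \<le> t" and "\<And>r. s \<le> r \<Longrightarrow> r \<le> t \<Longrightarrow> mt r \<ge> 0"
  shows "x s \<le> x t"
proof (rule DERIV_nonneg_imp_nondecreasing[OF assms(2)])
  fix r assume r: "s \<le> r" "r \<le> t"
  then have "r \<in> I" using assms I_down by auto
  then show "\<exists>y. (x has_real_derivative y) (at r) \<and> 0 \<le> y"
    using x_deriv x_pos assms(3) r by (intro exI[of _ "x r * mt r"]) (auto simp: less_imp_le)
qed

lemma x_strict_incr:
  assumes "t \<in> I" "s < t" and "\<And>r. s \<le> r \<Longrightarrow> r \<le> t \<Longrightarrow> mt r > 0"
  shows "x s < x t"
proof (rule DERIV_pos_imp_increasing[OF assms(2)])
  fix r assume r: "s \<le> r" "r \<le> t"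
  then have "r \<in> I" using assms I_down by auto
  then show "\<exists>y. (x has_real_derivative y) (at r) \<and> 0 < y"
    using x_deriv x_pos assms(3) r by (intro exI[of _ "x r * mt r"]) auto
qed

text \<open>Since \<open>k z > 0\<close>, one has \<open>m > x - (N - 2) \<ge> x - c\<close>, so
  \<open>x\<close> cannot sink below the level \<open>c\<close>.\<close>

lemma x_ge_stays:
  assumes "x s \<ge> c" "c \<ge> N - 2" "s \<le> t" "t \<in> I"
  shows "x t \<ge> c"
proof -
  have "x t - c \<ge> 0"
  proof (rule comparison_nonneg[where q = "\<lambda>t. x t - c" and c = "x" and a = s])
    show "continuous_on {s..t} (\<lambda>t. x t - c)" "continuous_on {s..t} x"
      by (intro continuous_intros x_cont Icc assms)+
    fix u assume u: "s < u" "u < t" "x u - c < 0"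
    have uI: "u \<in> I" using u assms I_down by auto
    have "m (x u) (z u) \<ge> x u - c" using k_ge[of "z u"] z_pos[OF uI] assms by (auto simp: m_def)
    then have "x u * mt u \<ge> x u * (x u - c)" using x_pos[OF uI] by (intro mult_left_mono) auto
    then show "\<exists>D. ((\<lambda>t. x t - c) has_real_derivative D) (at u) \<and> x u * (x u - c) \<le> D"
      using x_deriv[OF uI] by (intro exI[of _ "x u * mt u"]) (auto intro!: derivative_eq_intros)
  qed (use assms in auto)
  then show ?thesis by simp
qed

lemma blowup:
  assumes "t0 \<in> I" "x t0 > N - 2"
  shows "I \<noteq> UNIV"
proof
  assume I: "I = UNIV"
  \<comment> \<open>The best constant with \<open>x - (N - 2) \<ge> e x\<close> on
    \<open>x \<ge> x t0\<close>. It gives \<open>x' \<ge> e x^2\<close>, so the negative function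
    \<open>- 1 / x\<close> would become positive in finite time.\<close>
  define e where "e = (x t0 - (N - 2)) / x t0"
  have x0: "x t0 > 0" using assms N_ge by simp
  have e: "e > 0" using assms N_ge by (simp add: e_def)
  have "\<exists>t\<ge>t0. - (1 / x t) > 0"
  proof (rule deriv_ge_unbounded[OF e])
    fix t assume t: "t \<ge> t0"
    have xt: "x t \<ge> x t0" using x_ge_stays[of "x t0" t0 t] assms t I by auto
    have "x t0 * (N - 2) \<le> x t * (N - 2)" using xt N_ge by (intro mult_right_mono) auto
    then have "e * x t \<le> x t - (N - 2)" using x0
      by (simp add: e_def field_simps)
    then have "mt t \<ge> e * x t" using k_ge[of "z t"] z_pos[of t] I by (auto simp: m_def)
    then have "mt t / x t \<ge> e" using xt x0 by (simp add: field_simps)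
    moreover have "((\<lambda>t. - (1 / x t)) has_real_derivative mt t / x t) (at t)"
      using x_deriv[of t] I xt x0 by (auto intro!: derivative_eq_intros simp: power2_eq_square)
    ultimately show "\<exists>D\<ge>e. ((\<lambda>t. - (1 / x t)) has_real_derivative D) (at t)" by auto
  qed
  then obtain t where "- (1 / x t) > 0" by auto
  moreover have "x t > 0" using x_pos I by auto
  ultimately show False by (simp add: zero_less_divide_iff)
qed

lemma I_UNIV: "(\<And>t. t \<in> I \<Longrightarrow> x t \<le> B) \<Longrightarrow> I = UNIV"
  using maximal by (meson not_less)

text \<open>
Requiring \<open>x' > 0\<close> from the start makes the orbit a graph over \<open>x\<close>; with plain crossing one would
first have to exclude that the orbit turns back before it crosses.
\<close>

definition "mcross \<longleftrightarrow> (\<exists>T\<in>I. x T > N - 2 \<and> (\<forall>t\<le>T. mt t > 0))"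

lemma mcross_m_pos:
  assumes mcross "t \<in> I" shows "mt t > 0"
proof -
  obtain T where T: "T \<in> I" "x T > N - 2" "\<And>t. t \<le> T \<Longrightarrow> mt t > 0"
    using assms by (auto simp: mcross_def)
  show ?thesis
  proof (cases "t \<le> T")
    case False
    then have "x t \<ge> N - 2" using x_ge_stays[of "N - 2" T t] T assms by auto
    then show ?thesis using m_pos_right z_pos assms by blast
  qed (use T in auto)
qed

text \<open>Monotonicity has to be checked only until the orbit passes \<open>N - 2\<close>, because
  \<open>m > 0\<close> is automatic to the right of it. The whole orbit is then increasing, and
  without crossing it is bounded, hence global.\<close>

lemma not_mcross:
  assumes nm: "\<not> mcross"
    and pos: "\<And>t. t \<in> I \<Longrightarrow> (\<And>s. s \<le> t \<Longrightarrow> x s \<le> N - 2) \<Longrightarrow> mt t > 0"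
  shows "I = UNIV" "x t < N - 2" "mt t > 0"
proof -
  have pos': "mt t > 0" if "t \<in> I" for t
  proof (cases "\<forall>s\<le>t. x s \<le> N - 2")
    case False
    then obtain s where "s \<le> t" "x s > N - 2" by auto
    then have "x t \<ge> N - 2" using x_ge_stays[of "N - 2" s t] that by auto
    then show ?thesis using m_pos_right z_pos that by blast
  qed (use pos that in auto)
  then have le: "x t \<le> N - 2" if "t \<in> I" for t
    using nm that I_down unfolding mcross_def by (meson not_less)
  then show U: "I = UNIV" by (rule I_UNIV)
  have "x t < x (t + 1)" using U pos' by (intro x_strict_incr) auto
  then show "x t < N - 2" using le[of "t + 1"] U by simp
  show "mt t > 0" using pos' U by auto
qed

end


section \<open>The tangent at the start as a barrier\<close>

context orbit begin

lemma zeta_eq: "zeta * (n + 2) = n * p" using n_gt by (simp add: zeta_def)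

text \<open>The line \<open>z + zeta x = n\<close> is tangent to the orbit at \<open>r = 0\<close>, and it is the orbit itself (the
  Aubin--Talenti bubble) when \<open>kap = 1\<close> and \<open>p = pp\<close>.\<close>

lemma barrier_deriv:
  assumes t: "t \<in> I" and k: "k (z t) = z t + N - n"
  shows "((\<lambda>t. z t + zeta * x t - n) has_real_derivative zeta * (p + 1 - 2 * zeta) * (x t)\<^sup>2 +
    (- n + (3 * zeta - p) * x t - (z t + zeta * x t - n)) * (z t + zeta * x t - n)) (at t)"
proof -
  have "zeta * (p + 1 - 2 * zeta) * (x t)\<^sup>2 +
    (- n + (3 * zeta - p) * x t - (z t + zeta * x t - n)) * (z t + zeta * x t - n)
    = z t * (n - p * x t - z t) + zeta * (x t * (x t + 2 - n + z t)) - x t * (zeta * (n + 2) - n * p)"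
    by (simp add: algebra_simps power2_eq_square)
  also have "\<dots> = z t * (N - p * x t - k (z t)) + zeta * (x t * mt t)"
    unfolding zeta_eq by (simp add: k m_def algebra_simps)
  finally show ?thesis using x_deriv[OF t] z_deriv[OF t]
    by (auto intro!: derivative_eq_intros)
qed

text \<open>\<open>p + 1 - 2 zeta = (n + 2 - p (n - 2)) / (n + 2)\<close>, so the forcing term in
  \<open>barrier_deriv\<close> changes sign exactly at \<open>pp\<close>, and with it the side of
  the tangent on which the orbit lies.\<close>

lemma zeta_sign: "p \<le> pp \<Longrightarrow> p + 1 - 2 * zeta \<ge> 0" "p \<ge> pp \<Longrightarrow> p + 1 - 2 * zeta \<le> 0"
  using n_gt by (auto simp: zeta_def pp_def field_simps)

lemma barrier_tendsto: "((\<lambda>t. z t + zeta * x t - n) \<longlongrightarrow> 0) at_bot"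
proof -
  have "((\<lambda>t. z t + zeta * x t - n) \<longlongrightarrow> n + zeta * 0 - n) at_bot"
    by (intro tendsto_intros z_lim x_lim)
  then show ?thesis by simp
qed

lemma barrier_rate: "\<forall>\<^sub>F t in at_bot. - n + (3 * zeta - p) * x t - (z t + zeta * x t - n) \<le> 0"
proof -
  have "((\<lambda>t. - n + (3 * zeta - p) * x t - (z t + zeta * x t - n)) \<longlongrightarrow> - n + (3 * zeta - p) * 0 - 0) at_bot"
    by (intro tendsto_intros x_lim barrier_tendsto)
  then have "\<forall>\<^sub>F t in at_bot. - n + (3 * zeta - p) * x t - (z t + zeta * x t - n) < 0"
    by (rule order_tendstoD) (use n_gt in auto)
  then show ?thesis by (rule eventually_mono) auto
qed

lemma barrier_ge:
  assumes t: "t \<in> I" and p: "p \<le> pp" and k: "\<And>s. s < t \<Longrightarrow> k (z s) = z s + N - n"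
  shows "z t + zeta * x t \<ge> n"
proof -
  have "z t + zeta * x t - n \<ge> 0"
  proof (rule comparison_nonneg_at_bot[OF barrier_tendsto barrier_rate])
    fix s assume s: "s < t"
    have sI: "s \<in> I" using s t I_down by auto
    have "zeta * (p + 1 - 2 * zeta) * (x s)\<^sup>2 \<ge> 0"
      using zeta_pos zeta_sign(1)[OF p] by simp
    then show "\<exists>D. ((\<lambda>t. z t + zeta * x t - n) has_real_derivative D) (at s) \<and>
        (- n + (3 * zeta - p) * x s - (z s + zeta * x s - n)) * (z s + zeta * x s - n) \<le> D"
      using barrier_deriv[OF sI k[OF s]] by (intro exI conjI) auto
  qed (intro continuous_intros x_cont z_cont Icc t)+
  then show ?thesis by simp
qed

lemma barrier_le_deriv:
  assumes s: "s \<in> I" and p: "p \<ge> pp" and k: "k (z s) = z s + N - n"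
  shows "\<exists>D. ((\<lambda>t. - (z t + zeta * x t - n)) has_real_derivative D) (at s) \<and>
        (- n + (3 * zeta - p) * x s - (z s + zeta * x s - n)) * - (z s + zeta * x s - n) \<le> D"
proof -
  have "zeta * (p + 1 - 2 * zeta) * (x s)\<^sup>2 \<le> 0"
    using zeta_pos zeta_sign(2)[OF p] by (intro mult_nonpos_nonneg mult_nonneg_nonpos) auto
  then show ?thesis
    using barrier_deriv[OF s k, THEN DERIV_minus] by (intro exI conjI) (assumption, simp add: algebra_simps)
qed

lemma barrier_le:
  assumes t: "t \<in> I" and p: "p \<ge> pp" and k: "\<And>s. s < t \<Longrightarrow> k (z s) = z s + N - n"
  shows "z t + zeta * x t \<le> n"
proof -
  have "- (z t + zeta * x t - n) \<ge> 0"
  proof (rule comparison_nonneg_at_bot[OF _ barrier_rate, where q = "\<lambda>t. - (z t + zeta * x t - n)"])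
    show "((\<lambda>t. - (z t + zeta * x t - n)) \<longlongrightarrow> 0) at_bot"
      using tendsto_minus[OF barrier_tendsto] by simp
    fix s assume s: "s < t"
    have sI: "s \<in> I" using s t I_down by auto
    show "\<exists>D. ((\<lambda>t. - (z t + zeta * x t - n)) has_real_derivative D) (at s) \<and>
        (- n + (3 * zeta - p) * x s - (z s + zeta * x s - n)) * - (z s + zeta * x s - n) \<le> D"
      by (rule barrier_le_deriv[OF sI p k[OF s]])
  qed (intro continuous_intros x_cont z_cont Icc t)+
  then show ?thesis by simp
qed

text \<open>\<open>barrier_le\<close> needs the orbit to have stayed above the corner since its
  start. After a return from below, the comparison is restarted at the last entry: entering upwards
  forces \<open>x \<le> 1 / p\<close>, and such an entry point lies below the tangent.\<close>

lemma upper_barrier: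
  assumes t: "t \<in> I" and p: "p \<ge> pp" and zt: "z t > n - 1"
  shows "z t + zeta * x t \<le> n"
proof (cases "\<forall>s<t. z s \<ge> n - 1")
  case True
  then show ?thesis using k_upper by (intro barrier_le t p) auto
next
  case False
  then obtain a where a: "a < t" "z a < n - 1" by auto
  define S where "S = {a..t} \<inter> z -` {..n - 1}"
  have cont: "continuous_on {a..t} z" by (intro z_cont Icc t)
  have "closed S" unfolding S_def
    by (intro continuous_closed_preimage cont) auto
  moreover have aS: "a \<in> S" using a by (auto simp: S_def)
  moreover have bdd: "bdd_above S" by (auto simp: S_def)
  ultimately have "Sup S \<in> S" by (intro closed_contains_Sup) auto
  then have s: "a \<le> Sup S" "Sup S \<le> t" "z (Sup S) \<le> n - 1" by (auto simp: S_def)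
  define s where "s = Sup S"
  have aft: "z r > n - 1" if "s < r" "r \<le> t" for r
  proof (rule ccontr)
    assume "\<not> z r > n - 1"
    then have "r \<in> S" using that s by (auto simp: S_def s_def)
    then show False using cSup_upper[OF _ bdd] that by (force simp: s_def)
  qed
  have sI: "s \<in> I" using s t I_down s_def by auto
  have st: "s < t" using s zt by (cases "s = t") (auto simp: s_def)
  have "z s \<ge> n - 1"
  proof (rule tendsto_lowerbound[where F = "at_right s" and f = z])
    show "(z \<longlongrightarrow> z s) (at_right s)" using z_isCont[OF sI] by (simp add: isCont_def filterlim_at_split)
    show "\<forall>\<^sub>F r in at_right s. n - 1 \<le> z r"
      using aft st less_imp_le by (auto simp: eventually_at_right intro!: exI[of _ t])
  qed auto
  then have zs: "z s = n - 1" using s s_def by simp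
  \<comment> \<open>At \<open>z = n - 1\<close> one has \<open>z' = (n - 1) (1 - p x)\<close>, so
    for \<open>x > 1 / p\<close> the orbit would leave downwards.\<close>
  have xs: "x s \<le> 1 / p"
  proof (rule ccontr)
    assume "\<not> x s \<le> 1 / p"
    then have "1 - p * x s < 0" using p_gt by (simp add: field_simps)
    moreover have "k (z s) = N - 1" using k_upper[of "z s"] zs by simp
    ultimately have neg: "z s * (N - p * x s - k (z s)) < 0" using z_pos[OF sI] by (auto intro!: mult_pos_neg)
    obtain d where d: "d > 0" "\<And>h. h > 0 \<Longrightarrow> h < d \<Longrightarrow> z (s + h) < z s"
      using DERIV_neg_dec_right[OF z_deriv[OF sI] neg] by blast
    define h where "h = min (d/2) (t - s)"
    have "h > 0" "h < d" "s < s + h" "s + h \<le> t" using d st by (auto simp: h_def min_def)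
    then show False using d(2)[of h] aft[of "s + h"] zs by auto
  qed
  have "- (z t + zeta * x t - n) \<ge> 0"
  proof (rule comparison_nonneg[where q = "\<lambda>t. - (z t + zeta * x t - n)" and a = s and c = "\<lambda>s. - n + (3 * zeta - p) * x s - (z s + zeta * x s - n)"])
    show "s \<le> t" using s s_def by simp
    have "zeta * x s \<le> zeta * (1 / p)" using xs zeta_pos by (intro mult_left_mono) auto
    also have "\<dots> = n / (n + 2)" using p_gt by (simp add: zeta_def)
    also have "\<dots> < 1" using n_gt by simp
    finally show "- (z s + zeta * x s - n) \<ge> 0" using zs by simp
    fix r assume r: "s < r" "r < t"
    have rI: "r \<in> I" using r t I_down by auto
    show "\<exists>D. ((\<lambda>t. - (z t + zeta * x t - n)) has_real_derivative D) (at r) \<and>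
        (- n + (3 * zeta - p) * x r - (z r + zeta * x r - n)) * - (z r + zeta * x r - n) \<le> D"
      using aft[of r] r k_upper[of "z r"] by (intro barrier_le_deriv[OF rI p]) auto
  qed (intro continuous_intros x_cont z_cont Icc t)+
  then show ?thesis by simp
qed

section \<open>Emden-Fowler variables and the Pohozaev energy\<close>

definition "Y t = x t * z t"
text \<open>\<open>a\<close> and \<open>rate\<close> are the friction coefficients of the
  Emden-Fowler equation in dimension \<open>N\<close> and in dimension \<open>n\<close>.\<close>

definition "a = N - 2 - 2 * al"
definition "rate = n - 2 - 2 * al"
text \<open>Since \<open>Y = (r^al v)^(p - 1)\<close> and \<open>al (p - 1) = 2\<close>, the factor
  \<open>Y powr al\<close> is \<open>(r^al v)^2\<close>, and \<open>al - x\<close> is the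
  logarithmic derivative of \<open>r^al v\<close>.\<close>

definition "E t = Y t powr al * ((x t - al)\<^sup>2 - al * (N - 2 - al) + 2 * kap * Y t / (p + 1))"

lemma Y_pos: "t \<in> I \<Longrightarrow> Y t > 0" using x_pos z_pos by (simp add: Y_def)

lemma Y_deriv:
  assumes t: "t \<in> I"
  shows "(Y has_real_derivative Y t * ((p - 1) * (al - x t))) (at t)"
proof -
  have "Y t * ((p - 1) * (al - x t)) = Y t * (2 - (p - 1) * x t)"
    using al_p by (simp add: algebra_simps)
  also have "\<dots> = x t * mt t * z t + z t * (N - p * x t - k (z t)) * x t"
    by (simp add: Y_def m_def algebra_simps)
  finally show ?thesis unfolding Y_def using DERIV_mult[OF x_deriv[OF t] z_deriv[OF t]] by simp
qed

text \<open>For the equation of dimension \<open>N\<close>, where \<open>k z = kap z\<close>, only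
  the friction term would remain. The other term measures the deviation of \<open>k\<close> from
  this line and vanishes for \<open>z \<le> n - 1\<close>.\<close>

lemma E_deriv:
  assumes t: "t \<in> I"
  shows "(E has_real_derivative 2 * Y t powr al * (- a * (x t - al)\<^sup>2 + (al - x t) * x t * (kap * z t - k (z t)))) (at t)"
proof -
  define r where "r = 2 * kap * Y t / (p + 1)"
  have r: "r * (p + 1) = 2 * kap * Y t" using p_gt by (simp add: r_def)
  have "((\<lambda>t. Y t powr al) has_real_derivative al * Y t powr (al - 1) * (Y t * ((p - 1) * (al - x t)))) (at t)"
    using DERIV_fun_powr[OF Y_deriv[OF t] Y_pos[OF t], of al] by simp
  also have "al * Y t powr (al - 1) * (Y t * ((p - 1) * (al - x t))) = (al * (p - 1)) * Y t powr al * (al - x t)"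
    using Y_pos[OF t] by (simp add: powr_diff)
  finally have d1: "((\<lambda>t. Y t powr al) has_real_derivative 2 * Y t powr al * (al - x t)) (at t)"
    by (simp add: al_p)
  have d2: "((\<lambda>t. (x t - al)\<^sup>2 - al * (N - 2 - al) + 2 * kap * Y t / (p + 1)) has_real_derivative
     2 * (x t - al) * (x t * mt t) + r * ((p - 1) * (al - x t))) (at t)"
  proof (rule DERIV_add)
    show "((\<lambda>t. (x t - al)\<^sup>2 - al * (N - 2 - al)) has_real_derivative 2 * (x t - al) * (x t * mt t)) (at t)"
      using x_deriv[OF t] by (auto intro!: derivative_eq_intros)
    show "((\<lambda>t. 2 * kap * Y t / (p + 1)) has_real_derivative r * ((p - 1) * (al - x t))) (at t)"
      using DERIV_cmult[OF Y_deriv[OF t], of "2 * kap / (p + 1)"] by (simp add: r_def mult.assoc)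
  qed
  have "2 * Y t powr al * (al - x t) * ((x t - al)\<^sup>2 - al * (N - 2 - al) + r) +
      (2 * (x t - al) * (x t * mt t) + r * ((p - 1) * (al - x t))) * Y t powr al
    = Y t powr al * (al - x t) * (2 * ((x t - al)\<^sup>2 - al * (N - 2 - al)) - 2 * (x t * mt t) + r * (p + 1))"
    by (simp add: algebra_simps)
  also have "\<dots> = 2 * Y t powr al * (- a * (x t - al)\<^sup>2 + (al - x t) * x t * (kap * z t - k (z t)))"
    unfolding r by (simp add: m_def a_def Y_def power2_eq_square algebra_simps)
  finally show ?thesis unfolding E_def[abs_def] using DERIV_mult[OF d1 d2] by (simp add: r_def)
qed

lemma E_cont: "S \<subseteq> I \<Longrightarrow> continuous_on S E"
  using E_deriv DERIV_isCont continuous_at_imp_continuous_on by blast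

lemma Y_lim: "(Y \<longlongrightarrow> 0) at_bot"
  using tendsto_mult[OF x_lim z_lim] by (simp add: Y_def[abs_def])

lemma E_lim: "(E \<longlongrightarrow> 0) at_bot"
proof -
  have "((\<lambda>t. Y t powr al) \<longlongrightarrow> 0) at_bot"
    by (rule tendsto_zero_powrI[OF Y_lim]) 
      (use al_pos I_bot Y_pos in \<open>auto elim!: eventually_mono intro: less_imp_le\<close>)
  then have "(E \<longlongrightarrow> 0 * ((0 - al)\<^sup>2 - al * (N - 2 - al) + 2 * kap * 0 / (p + 1))) at_bot"
    unfolding E_def[abs_def] using p_gt by (intro tendsto_intros x_lim Y_lim) auto
  then show ?thesis by simp
qed

text \<open>At \<open>x \<ge> N - 2\<close> the square alone dominates
  \<open>al (N - 2 - al)\<close>: an orbit that crosses does so with positive energy.\<close>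

lemma E_pos_right:
  assumes t: "t \<in> I" and x: "x t \<ge> N - 2" and al: "2 * al \<le> N - 2"
  shows "E t > 0"
proof -
  have "(x t - al)\<^sup>2 \<ge> (N - 2 - al)\<^sup>2" using x al al_pos by (intro power_mono) auto
  moreover have "(N - 2 - al)\<^sup>2 \<ge> al * (N - 2 - al)"
    unfolding power2_eq_square using al al_pos by (intro mult_right_mono) auto
  moreover have "2 * kap * Y t / (p + 1) > 0" using Y_pos[OF t] kap_ge p_gt by auto
  ultimately show ?thesis unfolding E_def using Y_pos[OF t] by (intro mult_pos_pos) auto
qed

lemma al_le: "p \<ge> po \<Longrightarrow> 2 * al \<le> N - 2" "p > po \<Longrightarrow> 2 * al < N - 2" "p = po \<Longrightarrow> 2 * al = N - 2"
  using p_gt N_ge by (auto simp: po_def al_def field_simps)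

lemma pp_ge: "p \<ge> pp \<Longrightarrow> 2 * al \<le> n - 2" "p > pp \<Longrightarrow> 2 * al < n - 2"
  using p_gt n_gt by (auto simp: pp_def al_def field_simps)

end

context pucci_ode begin
lemma po_le_pp: "po \<le> pp" and po_gt: "po > 1" 
  using n_gt N_ge by (auto simp: po_def pp_def field_simps)
end


section \<open>Sign of the energy and crossing of the line \<open>x = N - 2\<close>\<close>

context orbit begin

text \<open>Above the corner the excess over pure friction with coefficient \<open>rate\<close>
  factors, so its sign can be read off from \<open>x\<close> against \<open>al\<close> and
  \<open>x z\<close> against \<open>(n - 1) al\<close>.\<close>

lemma inner_identity:
  assumes "k (z t) = z t + (kap - 1) * (n - 1)"
  shows "- a * (x t - al)\<^sup>2 + (al - x t) * x t * (kap * z t - k (z t)) + rate * (al - x t)\<^sup>2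
      = (kap - 1) * (al - x t) * (x t * z t - (n - 1) * al)"
proof -
  have a: "a = rate + (kap - 1) * (n - 1)" using N_eq by (simp add: a_def rate_def)
  show ?thesis unfolding a assms by (simp add: power2_eq_square algebra_simps)
qed

text \<open>Below the corner the friction is \<open>a \<ge> rate\<close>. Above it the tangent
  barrier gives both \<open>x < al\<close> and \<open>x z \<le> (n - 1) al\<close>, which makes the
  excess in \<open>inner_identity\<close> nonpositive.\<close>

lemma E_deriv_le:
  assumes t: "t \<in> I" and p: "p \<ge> pp"
  shows "\<exists>D. (E has_real_derivative D) (at t) \<and> D \<le> - (2 * rate * Y t powr al * (al - x t)\<^sup>2)"
proof -
  have a: "a = rate + (kap - 1) * (n - 1)" using N_eq by (simp add: a_def rate_def)
  have "- a * (x t - al)\<^sup>2 + (al - x t) * x t * (kap * z t - k (z t)) \<le> - rate * (al - x t)\<^sup>2"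
  proof (cases "z t \<le> n - 1")
    case True
    have "a \<ge> rate" using kap_ge n_gt by (simp add: a)
    then have "a * (x t - al)\<^sup>2 \<ge> rate * (x t - al)\<^sup>2" by (intro mult_right_mono) auto
    then show ?thesis using True by (simp add: k_lower power2_commute)
  next
    case False
    then have z1: "z t > n - 1" by simp
    \<comment> \<open>Above the corner the barrier gives \<open>zeta x < 1\<close>; this inequality
      turns that into \<open>x < al\<close>.\<close>
    have zeta_al: "zeta * al > 1"
    proof -
      have "n * p * 2 - (n + 2) * (p - 1) = p * (n - 2) + n + 2" by (simp add: algebra_simps)
      also have "\<dots> > 0" using p_gt n_gt by (intro add_pos_pos) auto
      finally have "(n + 2) * (p - 1) < n * p * 2" by simp
      moreover have "(n + 2) * (p - 1) > 0" using p_gt n_gt by simp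
      ultimately have "1 < n * p * 2 / ((n + 2) * (p - 1))" by (simp only: less_divide_eq_1_pos)
      then show ?thesis by (simp add: zeta_def al_def)
    qed
    have b: "zeta * x t \<le> n - z t" using upper_barrier[OF t p z1] by simp
    then have "zeta * x t < zeta * al" using z1 zeta_al by simp
    then have x_al: "x t < al" using zeta_pos by simp
    have "zeta * (x t * z t) \<le> (n - z t) * z t" using b z_pos[OF t] by (simp add: mult.assoc[symmetric] mult_right_mono)
    \<comment> \<open>\<open>z (n - z)\<close> decreases for \<open>z \<ge> n - 1\<close>, because
      \<open>n - 1 > n / 2\<close>, so it is at most its value \<open>n - 1\<close> at the
      corner.\<close>
    also have "\<dots> = (n - 1) - (z t - 1) * (z t - (n - 1))" by (simp add: algebra_simps)
    also have "\<dots> \<le> (n - 1) * 1" using z1 n_gt by simp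
    also have "\<dots> \<le> (n - 1) * (zeta * al)" using n_gt zeta_al by (intro mult_left_mono) auto
    also have "\<dots> = zeta * ((n - 1) * al)" by simp
    finally have xz: "x t * z t \<le> (n - 1) * al" using zeta_pos by simp
    have "(kap - 1) * (al - x t) * (x t * z t - (n - 1) * al) \<le> 0"
      using kap_ge x_al xz by (intro mult_nonneg_nonpos mult_nonneg_nonneg) auto
    moreover have "k (z t) = z t + (kap - 1) * (n - 1)" using k_upper[of "z t"] z1 N_eq by simp
    then have "- a * (x t - al)\<^sup>2 + (al - x t) * x t * (kap * z t - k (z t)) + rate * (al - x t)\<^sup>2
      = (kap - 1) * (al - x t) * (x t * z t - (n - 1) * al)"
      by (rule inner_identity)
    ultimately show ?thesis by linarith
  qed
  then have "2 * Y t powr al * (- a * (x t - al)\<^sup>2 + (al - x t) * x t * (kap * z t - k (z t)))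
      \<le> 2 * Y t powr al * (- rate * (al - x t)\<^sup>2)" by (intro mult_left_mono) auto
  then show ?thesis using E_deriv[OF t] by (intro exI conjI) (assumption, simp add: algebra_simps)
qed

lemma E_decr:
  assumes t: "t \<in> I" and p: "p \<ge> pp" and st: "s \<le> t"
  shows "E t \<le> E s"
proof (rule DERIV_nonpos_imp_nonincreasing[OF st])
  fix r assume "s \<le> r" "r \<le> t"
  then have "r \<in> I" using t I_down by auto
  then obtain D where D: "(E has_real_derivative D) (at r)" "D \<le> - (2 * rate * Y r powr al * (al - x r)\<^sup>2)"
    using E_deriv_le[OF _ p] by blast
  have "0 \<le> 2 * rate * Y r powr al * (al - x r)\<^sup>2"
    using pp_ge(1)[OF p] by (intro mult_nonneg_nonneg) (auto simp: rate_def)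
  then show "\<exists>y. (E has_real_derivative y) (at r) \<and> y \<le> 0" using D by (intro exI[of _ D]) auto
qed

lemma E_le_0: assumes t: "t \<in> I" and p: "p \<ge> pp" shows "E t \<le> 0"
  by (rule tendsto_lowerbound[OF E_lim])
    (use E_decr[OF t p] in \<open>auto simp: eventually_at_bot_linorder\<close>)

text \<open>The energy starts at 0 and does not increase, whereas crossing would need
  \<open>E > 0\<close>.\<close>

lemma not_mcross_pp: "p = pp \<Longrightarrow> \<not> mcross"
  using E_le_0 E_pos_right pp_ge(1) N_ge unfolding mcross_def by (smt (verit))

text \<open>For \<open>kap > 1\<close> the excess in \<open>inner_identity\<close> is strictly
  negative near the start, where \<open>x < al\<close> and \<open>x z < (n - 1) al\<close>. This
  strictness is what separates \<open>pst\<close> from \<open>pp\<close>.\<close>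

lemma E_neg_eventually:
  assumes p: "p \<ge> pp" and kap: "kap > 1"
  shows "\<exists>t\<in>I. E t < 0"
proof -
  have "\<forall>\<^sub>F t in at_bot. z t > n - 1 \<and> x t < al \<and> Y t < (n - 1) * al \<and> t \<in> I"
    using n_gt al_pos
    by (intro eventually_conj order_tendstoD(1)[OF z_lim] order_tendstoD(2)[OF x_lim] order_tendstoD(2)[OF Y_lim] I_bot) auto
  then obtain T where T: "\<And>t. t \<le> T \<Longrightarrow> z t > n - 1 \<and> x t < al \<and> Y t < (n - 1) * al \<and> t \<in> I"
    by (auto simp: eventually_at_bot_linorder)
  have "E T < E (T - 1)"
  proof (rule DERIV_neg_imp_decreasing[where f = E and a = "T - 1" and b = T])
    fix t assume "T - 1 \<le> t" "t \<le> T"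
    then have t: "z t > n - 1" "x t < al" "x t * z t < (n - 1) * al" "t \<in> I" using T[of t] by (auto simp: Y_def)
    have "(kap - 1) * (al - x t) * (x t * z t - (n - 1) * al) < 0"
      using kap t by (intro mult_pos_neg mult_pos_pos) auto
    moreover have "rate * (al - x t)\<^sup>2 \<ge> 0" using pp_ge(1)[OF p] by (simp add: rate_def)
    moreover have a: "a = rate + (kap - 1) * (n - 1)" using N_eq by (simp add: a_def rate_def)
    moreover have "k (z t) = z t + (kap - 1) * (n - 1)" using k_upper[of "z t"] t(1) N_eq by simp
    then have "- a * (x t - al)\<^sup>2 + (al - x t) * x t * (kap * z t - k (z t)) + rate * (al - x t)\<^sup>2
      = (kap - 1) * (al - x t) * (x t * z t - (n - 1) * al)"
      by (rule inner_identity)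
    ultimately have "- a * (x t - al)\<^sup>2 + (al - x t) * x t * (kap * z t - k (z t)) < 0" by linarith
    then show "\<exists>y. (E has_real_derivative y) (at t) \<and> y < 0"
      using E_deriv[OF t(4)] Y_pos[OF t(4)] by (intro exI conjI) (assumption, auto intro!: mult_pos_neg)
  qed auto
  moreover have "E (T - 1) \<le> 0" using T[of "T - 1"] by (intro E_le_0 p) auto
  ultimately show ?thesis using T[of T] by (intro bexI[of _ T]) auto
qed

lemma x_unbounded:
  assumes I: "I = UNIV" and c: "c > 0" and m: "\<And>t. t \<ge> t0 \<Longrightarrow> mt t \<ge> c"
  shows "\<exists>t. x t > B"
proof -
  have x0: "x t0 > 0" using x_pos I by auto
  have "\<exists>t\<ge>t0. x t > B"
  proof (rule deriv_ge_unbounded)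
    show "x t0 * c > 0" using x0 c by simp
    fix t assume t: "t0 \<le> t"
    have m': "mt r \<ge> 0" if "t0 \<le> r" for r using m[of r] c that by linarith
    have "x t0 \<le> x t" using t I m' by (intro x_incr) auto
    then have "x t0 * c \<le> x t * mt t" using m[OF t] x0 c by (intro mult_mono) auto
    then show "\<exists>D\<ge>x t0 * c. (x has_real_derivative D) (at t)" using x_deriv[of t] I by auto
  qed
  then show ?thesis by auto
qed

text \<open>\<open>kap = 1\<close> removes the corner, so the lower barrier
  \<open>z \<ge> n - zeta x\<close> holds all along. It bounds \<open>m\<close> below by a linear
  function of \<open>x\<close> that is positive up to \<open>x = n - 2\<close> because
  \<open>p < po\<close>.\<close>

lemma mcross_classical:
  assumes kap: "kap = 1" and p: "p < po" shows mcross
proof (rule ccontr)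
  assume nm: "\<not> mcross"
  have N: "N = n" using N_eq kap by simp
  have k: "k z = z + N - n" for z unfolding k_def N using kap by simp
  have "p \<le> pp" using p by (simp add: po_def pp_def N)
  \<comment> \<open>The minimum of the linear bound \<open>2 - (zeta - 1) x\<close> over
    \<open>0 \<le> x \<le> n - 2\<close>, taken at an endpoint.\<close>
  define c where "c = min 2 (2 - (zeta - 1) * (n - 2))"
  have "p * (n - 2) < n + 2" using p n_gt unfolding po_def N by (simp add: field_simps)
  then have "n * (p * (n - 2)) < n * (n + 2)" using n_gt by (intro mult_strict_left_mono) auto
  then have "(zeta - 1) * (n - 2) < 2"
    using n_gt unfolding zeta_def by (simp add: field_simps)
  then have c: "c > 0" by (simp add: c_def)
  have m: "mt t \<ge> c" if t: "t \<in> I" and x: "x t \<le> n - 2" for t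
  proof -
    have "z t + zeta * x t \<ge> n" using k by (intro barrier_ge t \<open>p \<le> pp\<close>) auto
    then have "mt t \<ge> 2 - (zeta - 1) * x t" by (simp add: m_def k N algebra_simps)
    moreover have "2 - (zeta - 1) * x t \<ge> c"
    proof (cases "zeta \<le> 1")
      case True
      then have "(zeta - 1) * x t \<le> 0" using x_pos[OF t] by (intro mult_nonpos_nonneg) auto
      then show ?thesis by (simp add: c_def)
    next
      case False
      then have "(zeta - 1) * x t \<le> (zeta - 1) * (n - 2)" using x by (intro mult_left_mono) auto
      then show ?thesis by (simp add: c_def)
    qed
    ultimately show ?thesis by simp
  qed
  have pos: "mt t > 0" if "t \<in> I" "\<And>s. s \<le> t \<Longrightarrow> x s \<le> N - 2" for t
    using m[OF that(1)] that(2)[of t] c N by auto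
  note nc = not_mcross[OF nm pos]
  have "\<exists>t. x t > N - 2"
    using x_unbounded[OF nc(1) c] m nc N by (metis UNIV_I less_imp_le)
  then show False using nc(2) by (meson less_asym)
qed

lemma first_exit:
  assumes t: "t \<in> I" and z: "z t < n - 1"
  shows "\<exists>t1<t. z t1 = n - 1 \<and> (\<forall>r<t1. z r > n - 1)"
proof -
  obtain T where T: "\<And>t. t \<le> T \<Longrightarrow> z t > n - 1"
    using order_tendstoD(1)[OF z_lim, of "n - 1"] by (auto simp: eventually_at_bot_linorder)
  then have Tt: "T < t" using z T[of t] by (meson less_asym not_less)
  define S where "S = {T..t} \<inter> z -` {..n - 1}"
  have cont: "continuous_on {T..t} z" by (intro z_cont Icc t)
  have "closed S" unfolding S_def
    by (intro continuous_closed_preimage cont) auto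
  moreover have tS: "t \<in> S" using Tt z by (auto simp: S_def)
  moreover have bdd: "bdd_below S" by (auto simp: S_def)
  ultimately have "Inf S \<in> S" by (intro closed_contains_Inf) auto
  then have s: "T \<le> Inf S" "Inf S \<le> t" "z (Inf S) \<le> n - 1" by (auto simp: S_def)
  have bef: "z r > n - 1" if "r < Inf S" for r
  proof (rule ccontr)
    assume "\<not> z r > n - 1"
    then have "r \<in> S" using that s T[of r] by (cases "r \<le> T") (auto simp: S_def)
    then show False using cInf_lower[OF _ bdd] that by force
  qed
  have sI: "Inf S \<in> I" using s t I_down by auto
  have "z (Inf S) \<ge> n - 1"
  proof (rule tendsto_lowerbound[where F = "at_left (Inf S)" and f = z])
    show "(z \<longlongrightarrow> z (Inf S)) (at_left (Inf S))" using z_isCont[OF sI] by (simp add: isCont_def filterlim_at_split)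
    show "\<forall>\<^sub>F r in at_left (Inf S). n - 1 \<le> z r"
      by (auto simp: eventually_at_filter intro!: always_eventually less_imp_le bef)
  qed auto
  then have "z (Inf S) = n - 1" using s by simp
  moreover have "Inf S < t" using s z calculation by (cases "Inf S = t") auto
  ultimately show ?thesis using bef by blast
qed

text \<open>On \<open>z = n - 1\<close> with \<open>x > 1 / p\<close> the flow points downwards, and
  \<open>x\<close> stays above \<open>1 / p\<close> while \<open>m \<ge> 0\<close>. The hypothesis
  on \<open>m\<close> may assume that the orbit has been below the corner so far, so
  \<open>m \<ge> 0\<close> can be derived from facts that hold only there.\<close>

lemma stays_lower:
  assumes t: "t \<in> I" and st: "s \<le> t" and zs: "z s \<le> n - 1" and xs: "x s > 1 / p"
    and m: "\<And>r. s \<le> r \<Longrightarrow> r \<le> t \<Longrightarrow> (\<And>u. s < u \<Longrightarrow> u < r \<Longrightarrow> z u < n - 1) \<Longrightarrow> mt r \<ge> 0"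
  shows "s < t \<Longrightarrow> z t < n - 1" "mt t \<ge> 0"
proof -
  have zd: "\<exists>D>0. ((\<lambda>t. n - 1 - z t) has_real_derivative D) (at r)"
    if r: "r \<in> I" "z r = n - 1" "x r > 1 / p" for r
  proof -
    have kn: "k (n - 1) = N - 1" using k_upper[of "n - 1"] by simp
    have "- (z r * (N - p * x r - k (z r))) = (n - 1) * (p * x r - 1)"
      unfolding r(2) kn by (simp add: algebra_simps)
    then have "((\<lambda>t. n - 1 - z t) has_real_derivative (n - 1) * (p * x r - 1)) (at r)"
      using z_deriv[OF r(1)] by (auto intro!: derivative_eq_intros)
    moreover have "p * x r - 1 > 0" using r p_gt by (simp add: field_simps)
    then have "(n - 1) * (p * x r - 1) > 0" using n_gt by (intro mult_pos_pos) auto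
    ultimately show ?thesis by blast
  qed
  have main: "z t < n - 1" if st: "s < t" "t \<in> I"
    and m: "\<And>r. s \<le> r \<Longrightarrow> r \<le> t \<Longrightarrow> (\<And>u. s < u \<Longrightarrow> u < r \<Longrightarrow> z u < n - 1) \<Longrightarrow> mt r \<ge> 0" for t
  proof -
    have sI: "s \<in> I" using st I_down by auto
    \<comment> \<open>\<open>z s = n - 1\<close> is allowed, whereas \<open>first_zero\<close> needs
      a strictly positive start; so first move strictly below the corner.\<close>
    obtain s' where s': "s < s'" "s' \<le> t" "\<And>r. s < r \<Longrightarrow> r \<le> s' \<Longrightarrow> z r < n - 1"
    proof (cases "z s = n - 1")
      case True
      then obtain D where D: "D > 0" "((\<lambda>t. n - 1 - z t) has_real_derivative D) (at s)" using zd[OF sI _ xs] by blast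
      obtain d where d: "d > 0" "\<And>h. h > 0 \<Longrightarrow> h < d \<Longrightarrow> n - 1 - z s < n - 1 - z (s + h)"
        using DERIV_pos_inc_right[OF D(2,1)] by blast
      have "z r < n - 1" if "s < r" "r \<le> min (s + d / 2) t" for r
        using d(2)[of "r - s"] that True by (simp add: min_def split: if_splits)
      then show ?thesis using d st by (intro that[of "min (s + d/2) t"]) auto
    next
      case False
      then have "z s < n - 1" using zs by simp
      then have "\<forall>\<^sub>F r in at s. z r < n - 1"
        using order_tendstoD(2)[OF z_isCont[OF sI, unfolded isCont_def]] by blast
      then have "\<forall>\<^sub>F r in at_right s. z r < n - 1" by (simp add: eventually_at_split)
      then obtain b where b: "b > s" "\<And>r. s < r \<Longrightarrow> r < b \<Longrightarrow> z r < n - 1" by (auto simp: eventually_at_right_field)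
      have "z r < n - 1" if "s < r" "r \<le> min ((s + b) / 2) t" for r
        using b that by (intro b) (auto simp: min_def split: if_splits)
      then show ?thesis using b st by (intro that[of "min ((s + b)/2) t"]) auto
    qed
    have "n - 1 - z t > 0"
    proof (rule first_zero[OF s'(2), where f = "\<lambda>t. n - 1 - z t"])
      show "continuous_on {s'..t} (\<lambda>t. n - 1 - z t)" by (intro continuous_intros z_cont Icc st)
      show "n - 1 - z s' > 0" using s' by auto
      fix r assume r: "s' < r" "r \<le> t" "n - 1 - z r = 0" "\<And>u. s' \<le> u \<Longrightarrow> u < r \<Longrightarrow> n - 1 - z u > 0"
      have zu: "z u < n - 1" if "s < u" "u < r" for u using that r(4)[of u] s'(3)[of u] by linarith
      have rI: "r \<in> I" using r st I_down by auto
      have "x s \<le> x r"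
      proof (rule x_incr[OF rI])
        fix w assume "s \<le> w" "w \<le> r"
        then show "mt w \<ge> 0" using zu r by (intro m) auto
      qed (use s' r in auto)
      then show "\<exists>D>0. ((\<lambda>t. n - 1 - z t) has_real_derivative D) (at r)" using r xs by (intro zd rI) auto
    qed
    then show ?thesis by simp
  qed
  show "s < t \<Longrightarrow> z t < n - 1" using main t m by blast
  show "mt t \<ge> 0"
  proof (rule m[OF st order_refl])
    fix u assume u: "s < u" "u < t"
    show "z u < n - 1" using u t I_down m by (intro main) auto
  qed
qed

text \<open>Read backwards from the crossing, where \<open>E > 0\<close>: \<open>stays_lower\<close>
  keeps the orbit below the corner in between, and there \<open>E\<close> does not increase because
  \<open>a \<ge> 0\<close>.\<close>

lemma E_nonneg_of_mcross:
  assumes mc: mcross and al: "2 * al \<le> N - 2" and t: "t \<in> I" and z: "z t < n - 1" and x: "x t > 1 / p"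
  shows "E t \<ge> 0"
proof -
  obtain T where T: "T \<in> I" "x T > N - 2" using mc by (auto simp: mcross_def)
  define S where "S = max t T"
  have S: "S \<in> I" "t \<le> S" using T t by (auto simp: S_def max_def)
  have "E S > 0" using x_ge_stays[of "N - 2" T S] T S al by (intro E_pos_right) (auto simp: S_def)
  moreover have "E S \<le> E t"
  proof (rule DERIV_nonpos_imp_nonincreasing[OF S(2)])
    fix r assume r: "t \<le> r" "r \<le> S"
    then have rI: "r \<in> I" using S I_down by auto
    have "z r \<le> n - 1"
      using stays_lower(1)[OF rI r(1) _ x] z mcross_m_pos[OF mc] rI I_down r by (cases "t = r") (auto simp: less_imp_le)
    then have "2 * Y r powr al * (- a * (x r - al)\<^sup>2 + (al - x r) * x r * (kap * z r - k (z r))) \<le> 0"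
      using al by (simp add: k_lower a_def mult_nonneg_nonpos)
    then show "\<exists>y. (E has_real_derivative y) (at r) \<and> y \<le> 0" using E_deriv[OF rI] by blast
  qed
  ultimately show ?thesis by simp
qed

text \<open>At \<open>po\<close> the friction \<open>a\<close> vanishes, so below the corner
  \<open>E\<close> is constant; it also factors as \<open>Y powr al\<close> times \<open>x b\<close>
  with \<open>b \<le> m\<close> there. Positive energy on arrival at the corner therefore keeps
  \<open>m\<close> away from 0, and this positivity follows from the lower barrier and
  \<open>N > n\<close>.\<close>

lemma mcross_po:
  assumes kap: "kap > 1" and p: "p = po" shows mcross
proof (rule ccontr)
  assume nm: "\<not> mcross"
  have N2: "N - 2 > 0" using N_ge by simp
  have p1: "p + 1 = 2 * N / (N - 2)" using N2 by (simp add: p po_def field_simps)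
  have al2: "2 * al = N - 2" using al_le(3)[OF p] .
  have a0: "a = 0" using al2 by (simp add: a_def)
  define b where "b t = x t - (N - 2) + kap * z t * (N - 2) / N" for t
  have Eb: "E t = Y t powr al * (x t * b t)" for t
  proof -
    have Ne: "N = 2 * al + 2" using al2 by simp
    have 1: "(x t - al)\<^sup>2 - al * (N - 2 - al) = x t * (x t - (N - 2))"
      unfolding Ne by (simp add: power2_eq_square algebra_simps)
    have 2: "2 * kap * Y t / (p + 1) = x t * (kap * z t * (N - 2) / N)"
      using N2 by (simp add: p1 Y_def)
    show ?thesis unfolding E_def 1 2 b_def by (simp only: distrib_left)
  qed
  have mb: "mt t \<ge> b t" if "t \<in> I" "z t \<le> n - 1" for t
  proof -
    have "kap * z t * ((N - 2) / N) \<le> kap * z t * 1"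
      using z_pos[OF that(1)] kap N2 by (intro mult_left_mono) auto
    then show ?thesis using k_lower[OF that(2)] by (simp add: m_def b_def)
  qed
  have bE: "b t > 0" if "E t > 0" "t \<in> I" for t
    using that x_pos[of t] Y_pos[of t] unfolding Eb by (simp add: zero_less_mult_iff)
  have outer: "z t \<le> n - 1 \<and> E t = E t1 \<and> E t1 > 0 \<and> mt t > 0"
    if t1: "z t1 = n - 1" "\<forall>r<t1. z r > n - 1" and t: "t1 \<le> t" "t \<in> I" for t t1
  proof -
    have t1I: "t1 \<in> I" using t I_down by auto
    have "z t1 + zeta * x t1 \<ge> n"
      using t1 k_upper po_le_pp p by (intro barrier_ge t1I) (auto simp: less_imp_le)
    then have zx: "zeta * x t1 \<ge> 1" using t1 by simp
    have x1: "x t1 \<ge> (n + 2) / (n * p)" using zx n_gt p_gt by (simp add: zeta_def field_simps)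
    have xp: "x t1 > 1 / p"
    proof -
      have "1 / p < (n + 2) / (n * p)" using n_gt p_gt by (simp add: field_simps)
      then show ?thesis using x1 by simp
    qed
    \<comment> \<open>The barrier gives \<open>x t1 \<ge> 1 / zeta\<close>, and
      \<open>b t1 > 0\<close> needs \<open>x t1 > (N - 2) / N\<close>. With \<open>p = po\<close>
      the difference between the two comes down to \<open>n < N\<close>.\<close>
    have "1 / N < (n + 2) / (n * (N + 2))"
    proof -
      have "n * (N + 2) < (n + 2) * N" using N_gt[OF kap] by (simp add: algebra_simps)
      moreover have "n * (N + 2) > 0" using n_gt N2 by simp
      ultimately have "1 < (n + 2) * N / (n * (N + 2))" by (simp only: less_divide_eq_1_pos)
      then show ?thesis using N2 by (subst pos_divide_less_eq) auto
    qed
    then have "(N - 2) * (1 / N) < (N - 2) * ((n + 2) / (n * (N + 2)))"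
      using N2 by (rule mult_strict_left_mono)
    also have "(N - 2) * ((n + 2) / (n * (N + 2))) = (n + 2) / (n * p)" by (simp add: p po_def)
    finally have "(N - 2) / N < (n + 2) / (n * p)" by simp
    then have "x t1 > (N - 2) / N" using x1 by simp
    moreover have "b t1 = x t1 - (N - 2) / N"
    proof -
      have "kap * z t1 = N - 1" by (simp add: t1 N_def)
      then have "b t1 = x t1 - (N - 2) + (N - 1) * (N - 2) / N" unfolding b_def by simp
      also have "\<dots> = x t1 - (N - 2) / N" using N2 by (simp add: field_simps)
      finally show ?thesis .
    qed
    ultimately have E1: "E t1 > 0" unfolding Eb using x_pos[OF t1I] Y_pos[OF t1I] by (intro mult_pos_pos) auto
    have const: "E r = E t1" if r: "t1 \<le> r" "r \<in> I" "\<And>u. t1 < u \<Longrightarrow> u < r \<Longrightarrow> z u < n - 1" for r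
    proof (cases "t1 = r")
      case False
      then have lt: "t1 < r" using r by simp
      show ?thesis
      proof (rule DERIV_isconst_end[OF lt])
        show "continuous_on {t1..r} E" by (intro E_cont Icc r)
        fix u assume u: "t1 < u" "u < r"
        then have "u \<in> I" using r I_down by auto
        then show "(E has_real_derivative 0) (at u)"
          using E_deriv[of u] r(3)[OF u] by (simp add: k_lower a0)
      qed
    qed simp
    have zle: "z r \<le> n - 1" if r: "t1 \<le> r" "r \<in> I" "\<And>u. t1 < u \<Longrightarrow> u < r \<Longrightarrow> z u < n - 1" for r
    proof (cases "t1 = r")
      case False
      then have lt: "t1 < r" using r by simp
      show ?thesis
      proof (rule tendsto_upperbound[where F = "at_left r" and f = z])
        show "(z \<longlongrightarrow> z r) (at_left r)" using z_isCont[OF r(2)] by (simp add: isCont_def filterlim_at_split)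
        show "\<forall>\<^sub>F u in at_left r. z u \<le> n - 1"
          using lt r(3) by (auto simp: eventually_at_left intro!: exI[of _ t1] less_imp_le)
      qed auto
    qed (use t1 in simp)
    have mpos: "mt r > 0" if r: "t1 \<le> r" "r \<in> I" "\<And>u. t1 < u \<Longrightarrow> u < r \<Longrightarrow> z u < n - 1" for r
      using mb[OF r(2) zle[OF r]] bE[of r] const[OF r] E1 r(2) by auto
    have z: "z r < n - 1" if r: "t1 < r" "r \<le> t" for r
    proof (rule stays_lower(1))
      show "r \<in> I" using r t I_down by auto
      show "mt u \<ge> 0" if "t1 \<le> u" "u \<le> r" "\<And>v. t1 < v \<Longrightarrow> v < u \<Longrightarrow> z v < n - 1" for u
        using mpos[of u] that r t I_down by (auto intro: less_imp_le)
    qed (use r t1 xp in auto)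
    then have z': "\<And>u. t1 < u \<Longrightarrow> u < t \<Longrightarrow> z u < n - 1" by auto
    show ?thesis using mpos[OF t z'] zle[OF t z'] const[OF t z'] E1 by auto
  qed
  have pos: "mt t > 0" if t: "t \<in> I" for t
  proof (cases "z t \<ge> n - 1")
    case True
    then show ?thesis using m_upper[of "z t" "x t"] x_pos[OF t] by simp
  next
    case False
    then obtain t1 where "t1 < t" "z t1 = n - 1" "\<forall>r<t1. z r > n - 1" using first_exit[OF t] by auto
    then show ?thesis using outer[of t1 t] t by auto
  qed
  note nc = not_mcross[OF nm pos]
  have UN: "I = UNIV" using nc(1) by blast
  have xle: "x t < N - 2" for t using nc(2) by blast
  have "\<exists>t. z t < n - 1"
  proof (rule ccontr)
    assume "\<nexists>t. z t < n - 1"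
    then have "mt t \<ge> 1" for t using m_upper[of "z t" "x t"] x_pos[of t] UN by (simp add: not_less)
    then show False using x_unbounded[OF UN, of 1 0 "N - 2"] xle by (meson less_asym zero_less_one)
  qed
  then obtain t1 where t1: "z t1 = n - 1" "\<forall>r<t1. z r > n - 1" using first_exit UN by blast
  \<comment> \<open>The lower bound for \<open>b\<close> that constant energy leaves when
    \<open>Y \<le> (N - 2) n\<close> and \<open>x \<le> N - 2\<close>.\<close>
  define c where "c = E t1 / (((N - 2) * n) powr al * (N - 2))"
  have E1: "E t1 > 0" using outer[OF t1 order_refl] UN by auto
  then have c: "c > 0" using N2 n_gt by (simp add: c_def)
  have "mt t \<ge> c" if t: "t \<ge> t1" for t
  proof -
    have tI: "t \<in> I" using UN by auto
    note o = outer[OF t1 t tI]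
    have b0: "b t > 0" using bE[of t] o tI by auto
    have "Y t \<le> (N - 2) * n" unfolding Y_def
      using xle[of t] z_lt[OF tI] x_pos[OF tI] z_pos[OF tI] N2 by (intro mult_mono) auto
    then have "Y t powr al \<le> ((N - 2) * n) powr al" using Y_pos[OF tI] al_pos by (intro powr_mono2) auto
    then have "Y t powr al * x t \<le> ((N - 2) * n) powr al * (N - 2)"
      using xle[of t] x_pos[OF tI] by (intro mult_mono) auto
    then have "Y t powr al * x t * b t \<le> ((N - 2) * n) powr al * (N - 2) * b t" using b0 by (intro mult_right_mono) auto
    then have "E t1 \<le> ((N - 2) * n) powr al * (N - 2) * b t" using o by (simp add: Eb mult.assoc)
    then have "c \<le> b t" using N2 n_gt unfolding c_def by (subst pos_divide_le_eq) (auto simp: mult.commute)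
    then show ?thesis using mb[OF tI] o by auto
  qed
  then show False using x_unbounded[OF UN c, of t1 "N - 2"] xle by (meson less_asym)
qed

end


section \<open>Fast decaying and bounded orbits\<close>


context orbit begin

definition "fast \<longleftrightarrow> I = UNIV \<and> (\<forall>t. mt t > 0) \<and> (x \<longlongrightarrow> N - 2) at_top"

lemma Y_decay:
  assumes I: "I = UNIV" and c: "c > 0" and T: "\<And>t. t \<ge> T \<Longrightarrow> (p - 1) * (al - x t) \<le> - c" and t: "t \<ge> T"
  shows "Y t \<le> Y T * exp (c * T) * exp (- c * t)"
proof -
  have "Y t * exp (c * t) \<le> Y T * exp (c * T)"
  proof (rule DERIV_nonpos_imp_nonincreasing[OF t])
    fix r assume r: "T \<le> r" "r \<le> t"
    have "Y r * ((p - 1) * (al - x r) + c) * exp (c * r) \<le> 0"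
      using T[OF r(1)] Y_pos[of r] I by (intro mult_nonpos_nonneg mult_nonneg_nonpos) auto
    moreover have "((\<lambda>t. Y t * exp (c * t)) has_real_derivative Y r * ((p - 1) * (al - x r) + c) * exp (c * r)) (at r)"
      using Y_deriv[of r] I by (auto intro!: derivative_eq_intros simp: algebra_simps)
    ultimately show "\<exists>y. ((\<lambda>t. Y t * exp (c * t)) has_real_derivative y) (at r) \<and> y \<le> 0" by blast
  qed
  then show ?thesis by (simp add: exp_minus field_simps)
qed

text \<open>Once \<open>x\<close> stays above a value larger than \<open>al\<close>,
  \<open>Y\<close> decays exponentially; as \<open>x\<close> does not decrease, dividing by it
  passes the decay on to \<open>z\<close>.\<close>

lemma z_decay:
  assumes I: "I = UNIV" and m: "\<And>t. mt t \<ge> 0" and lim: "(x \<longlongrightarrow> X) at_top" and X: "X > al"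
  shows "\<exists>C>0. \<exists>c>0. \<exists>T. \<forall>t\<ge>T. z t \<le> C * exp (- c * t)"
proof -
  have "\<forall>\<^sub>F t in at_top. x t > (X + al) / 2" using X by (intro order_tendstoD(1)[OF lim]) (simp add: field_simps)
  then obtain T where T: "\<And>t. t \<ge> T \<Longrightarrow> x t > (X + al) / 2" by (auto simp: eventually_at_top_linorder)
  define c where "c = (p - 1) * ((X - al) / 2)"
  have c: "c > 0" using X p_gt by (simp add: c_def)
  have le: "(p - 1) * (al - x t) \<le> - c" if "t \<ge> T" for t
  proof -
    have "(p - 1) * (al - x t) \<le> (p - 1) * (- ((X - al) / 2))"
      using T[OF that] p_gt by (intro mult_left_mono) (auto simp: field_simps)
    then show ?thesis by (simp add: c_def)
  qed
  have xT: "x T > 0" using x_pos I by auto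
  have "z t \<le> (Y T * exp (c * T) / x T) * exp (- c * t)" if "t \<ge> T" for t
  proof -
    have "x T \<le> x t" using that I m by (intro x_incr) auto
    then have "z t * x T \<le> Y t" using z_pos[of t] I by (simp add: Y_def mult.commute mult_right_mono)
    also have "\<dots> \<le> Y T * exp (c * T) * exp (- c * t)" by (rule Y_decay[OF I c le that])
    finally show ?thesis using xT by (simp add: field_simps)
  qed
  moreover have "Y T * exp (c * T) / x T > 0" using Y_pos[of T] I xT by auto
  ultimately show ?thesis using c by blast
qed

lemma z_tendsto_0:
  assumes "I = UNIV" "\<And>t. mt t \<ge> 0" "(x \<longlongrightarrow> X) at_top" "X > al"
  shows "(z \<longlongrightarrow> 0) at_top"
proof -
  obtain C c T where C: "C > 0" "c > 0" "\<forall>t\<ge>T. z t \<le> C * exp (- c * t)" using z_decay[OF assms] by auto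
  have "((\<lambda>t. C * exp (- c * t)) \<longlongrightarrow> 0) at_top" using C(2) by (rule exp_decay_tendsto_0)
  then show ?thesis
  proof (rule Lim_null_comparison[rotated])
    show "\<forall>\<^sub>F t in at_top. norm (z t) \<le> C * exp (- c * t)"
      using C(3) z_pos assms(1) by (auto simp: eventually_at_top_linorder less_imp_le abs_of_pos)
  qed
qed

text \<open>A limit \<open>X < N - 2\<close> of \<open>x\<close> is excluded. If
  \<open>X > al\<close>, then \<open>z\<close> tends to 0 and \<open>m\<close> to a negative number.
  If \<open>X \<le> al\<close>, then \<open>Y\<close> increases to a limit, so the orbit converges
  to the stationary point, where \<open>E < 0\<close>.\<close>

lemma fast_of_E_nonneg:
  assumes I: "I = UNIV" and m: "\<And>t. mt t > 0" and xle: "\<And>t. x t \<le> N - 2" and al: "al < N - 2"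
    and E: "\<And>t. z t < n - 1 \<Longrightarrow> x t > 1 / p \<Longrightarrow> E t \<ge> 0"
  shows fast
proof -
  have incr: "x s < x t" if "s < t" for s t using I m that by (intro x_strict_incr) auto
  obtain X where X: "(x \<longlongrightarrow> X) at_top" "\<And>t. 0 \<le> t \<Longrightarrow> x t \<le> X" "X \<le> N - 2"
    by (rule mono_bounded_tendsto[of 0 x "N - 2"]) (use incr xle in \<open>force simp: le_less\<close>)+
  have Xpos: "X > 0" using X(2)[of 0] x_pos[of 0] I by auto
  have "\<not> X < N - 2"
  proof
    assume XN: "X < N - 2"
    show False
    proof (cases "X > al")
      case True
      have "(mt \<longlongrightarrow> X + 2 - N + k 0) at_top"
        unfolding m_def by (intro tendsto_intros X k_tendsto z_tendsto_0[OF I _ X(1) True] less_imp_le m)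
      moreover have "k 0 = 0" using n_gt by (simp add: k_lower)
      ultimately have "(mt \<longlongrightarrow> X + 2 - N) at_top" by simp
      then have "0 \<le> X + 2 - N"
        by (rule tendsto_lowerbound) (auto intro!: always_eventually less_imp_le m)
      then show False using XN by simp
    next
      case False
      have xal: "x t < al" for t
      proof -
        have "x t < x (max t 0 + 1)" by (rule incr) simp
        also have "\<dots> \<le> X" by (rule X(2)) simp
        finally show ?thesis using False by simp
      qed
      have Yinc: "Y s \<le> Y t" if "s \<le> t" for s t
      proof (rule DERIV_nonneg_imp_nondecreasing[OF that])
        fix r
        show "\<exists>y. (Y has_real_derivative y) (at r) \<and> 0 \<le> y"
          using Y_deriv[of r] Y_pos[of r] I p_gt xal[of r] by (intro exI conjI) (auto intro!: mult_nonneg_nonneg)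
      qed
      have Ybd: "Y t \<le> (N - 2) * n" for t unfolding Y_def
        using xle[of t] z_lt[of t] I x_pos[of t] z_pos[of t] N_ge by (intro mult_mono) (auto simp: less_imp_le)
      obtain L where L: "(Y \<longlongrightarrow> L) at_top" "\<And>t. 0 \<le> t \<Longrightarrow> Y t \<le> L" "L \<le> (N - 2) * n"
        by (rule mono_bounded_tendsto[of 0 Y "(N - 2) * n"]) (use Yinc Ybd in auto)
      have Lpos: "L > 0" using L(2)[of 0] Y_pos[of 0] I by auto
      define Z where "Z = L / X"
      have "((\<lambda>t. Y t / x t) \<longlongrightarrow> Z) at_top" unfolding Z_def using Xpos by (intro tendsto_intros L X) auto
      moreover have "Y t / x t = z t" for t using x_pos[of t] I by (simp add: Y_def)
      ultimately have zZ: "(z \<longlongrightarrow> Z) at_top" by simp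
      have mM: "(mt \<longlongrightarrow> X + 2 - N + k Z) at_top"
        unfolding m_def by (intro tendsto_intros X k_tendsto zZ)
      have "0 \<le> X + 2 - N + k Z"
        by (rule tendsto_lowerbound[OF mM]) (auto intro!: always_eventually less_imp_le m)
      \<comment> \<open>A positive limit of \<open>m\<close> would make \<open>x\<close> grow
        without bound.\<close>
      moreover have "\<not> 0 < X + 2 - N + k Z"
      proof
        assume M: "0 < X + 2 - N + k Z"
        then have "\<forall>\<^sub>F t in at_top. mt t > (X + 2 - N + k Z) / 2" by (intro order_tendstoD(1)[OF mM]) simp
        then obtain T where "\<And>t. t \<ge> T \<Longrightarrow> mt t \<ge> (X + 2 - N + k Z) / 2"
          by (auto simp: eventually_at_top_linorder intro: less_imp_le)
        then have "\<exists>t. x t > N - 2" using M by (intro x_unbounded[OF I, of "(X + 2 - N + k Z) / 2"]) auto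
        then show False using xle by (meson not_less)
      qed
      ultimately have kZ: "k Z = N - 2 - X" by simp
      have Zn: "Z < n - 1"
      proof (rule ccontr)
        assume "\<not> Z < n - 1"
        then have "k Z \<ge> N - 1" by (simp add: k_upper)
        then show False using kZ Xpos by simp
      qed
      have kapZ: "kap * Z = N - 2 - X" using kZ Zn by (simp add: k_lower)
      \<comment> \<open>Otherwise the derivative of \<open>Y\<close> would stay above a positive
        constant, although \<open>Y\<close> is bounded.\<close>
      have "X = al"
      proof (rule ccontr)
        assume "X \<noteq> al"
        then have Xal: "X < al" using False by simp
        define c where "c = Y 0 * ((p - 1) * (al - X))"
        have c: "c > 0" using Y_pos[of 0] I p_gt Xal by (simp add: c_def)
        have "\<exists>t\<ge>0. Y t > (N - 2) * n"
        proof (rule deriv_ge_unbounded[OF c])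
          fix t :: real assume t: "0 \<le> t"
          have "c \<le> Y t * ((p - 1) * (al - x t))" unfolding c_def
            using Yinc[OF t] X(2)[OF t] Xal p_gt Y_pos[of 0] Y_pos[of t] I by (intro mult_mono) auto
          then show "\<exists>D\<ge>c. (Y has_real_derivative D) (at t)" using Y_deriv[of t] I by auto
        qed
        then show False using Ybd by (meson not_less)
      qed
      have "(E \<longlongrightarrow> L powr al * ((X - al)\<^sup>2 - al * (N - 2 - al) + 2 * kap * L / (p + 1))) at_top"
        unfolding E_def[abs_def] using Lpos p_gt by (intro tendsto_intros X L) auto
      moreover have "\<forall>\<^sub>F t in at_top. 0 \<le> E t"
      proof -
        have "\<forall>\<^sub>F t in at_top. z t < n - 1" using order_tendstoD(2)[OF zZ Zn] .
        moreover have "\<forall>\<^sub>F t in at_top. x t > 1 / p"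
          using order_tendstoD(1)[OF X(1), of "1 / p"] al_gt \<open>X = al\<close> by auto
        ultimately show ?thesis by eventually_elim (rule E)
      qed
      ultimately have "0 \<le> L powr al * ((X - al)\<^sup>2 - al * (N - 2 - al) + 2 * kap * L / (p + 1))"
        by (rule tendsto_lowerbound) auto
      then have "0 \<le> - al * (N - 2 - al) + 2 * kap * L / (p + 1)"
        using Lpos by (simp add: zero_le_mult_iff \<open>X = al\<close>)
      \<comment> \<open>At the stationary point this makes the bracket in \<open>E\<close> equal to
        \<open>- al (N - 2 - al) (1 - 2 / (p + 1))\<close>, which is negative.\<close>
      moreover have "kap * L = al * (N - 2 - al)" using kapZ Xpos \<open>X = al\<close> by (simp add: Z_def field_simps)
      then have "2 * kap * L / (p + 1) = al * (N - 2 - al) * (2 / (p + 1))" by simp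
      moreover have "al * (N - 2 - al) * (2 / (p + 1)) < al * (N - 2 - al) * 1"
        using al al_pos p_gt by (intro mult_strict_left_mono) auto
      ultimately show False by simp
    qed
  qed
  then have "X = N - 2" using X by simp
  then show ?thesis unfolding fast_def using I m X by auto
qed

text \<open>A zero of a nonnegative \<open>m\<close> is a minimum in time, hence a critical point;
  this forces \<open>x = al\<close>, the stationary point, where \<open>E < 0\<close>. The energy
  thus does the work of a uniqueness theorem for the system.\<close>

lemma m_pos_of_nonneg:
  assumes m: "\<And>t. t \<in> I \<Longrightarrow> mt t \<ge> 0" and al: "al < N - 2"
    and E: "\<And>t. t \<in> I \<Longrightarrow> z t < n - 1 \<Longrightarrow> x t > 1 / p \<Longrightarrow> E t \<ge> 0" and t: "t \<in> I"
  shows "mt t > 0"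
proof (rule ccontr)
  assume "\<not> mt t > 0"
  then have m0: "mt t = 0" using m[OF t] by simp
  have zn: "z t < n - 1" using m0 m_upper[of "z t" "x t"] x_pos[OF t] by force
  \<comment> \<open>\<open>m\<close> as it reads below the corner; \<open>m = 0\<close> forces
    \<open>z < n - 1\<close>, so both agree near \<open>t\<close>.\<close>
  define f where "f t = x t + 2 - N + kap * z t" for t
  have kz: "kap * z t = N - 2 - x t" using m0 zn by (simp add: m_def k_lower)
  have "(f has_real_derivative (x t * mt t + kap * (z t * (N - p * x t - k (z t))))) (at t)"
    unfolding f_def[abs_def] using x_deriv[OF t] z_deriv[OF t] by (auto intro!: derivative_eq_intros)
  moreover have "kap * (z t * (N - p * x t - k (z t))) = kap * z t * ((p - 1) * (al - x t))"
  proof -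
    have "N - p * x t - k (z t) = 2 - (p - 1) * x t" using zn kz by (simp add: k_lower algebra_simps)
    also have "\<dots> = (p - 1) * (al - x t)" using al_p by (simp add: algebra_simps)
    finally show ?thesis by simp
  qed
  ultimately have fd: "(f has_real_derivative (kap * z t * ((p - 1) * (al - x t)))) (at t)" by (simp add: m0)
  have "\<forall>\<^sub>F s in nhds t. s \<in> I \<and> z s < n - 1"
    using eventually_nhds_in_open[OF I_open t] order_tendstoD(2)[OF z_isCont[OF t, unfolded isCont_def] zn] zn t
    by (auto simp: eventually_at_filter elim: eventually_elim2)
  then have "\<forall>\<^sub>F s in nhds t. f t \<le> f s"
  proof eventually_elim
    case (elim s)
    then show ?case using m[of s] kz by (simp add: f_def m_def k_lower)
  qed
  then obtain d where d: "d > 0" "\<forall>s. dist s t < d \<longrightarrow> f t \<le> f s" by (auto simp: eventually_nhds_metric)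
  have "kap * z t * ((p - 1) * (al - x t)) = 0"
    by (rule DERIV_local_min[OF fd d(1)]) (use d(2) in \<open>auto simp: dist_real_def abs_minus_commute\<close>)
  then have xal: "x t = al" using kap_ge z_pos[OF t] p_gt by simp
  have Ef: "E t = Y t powr al * (- al * (N - 2 - al) + 2 * kap * Y t / (p + 1))" by (simp add: E_def xal)
  have "E t \<ge> 0" using E[OF t zn] al_gt xal by simp
  then have "0 \<le> - al * (N - 2 - al) + 2 * kap * Y t / (p + 1)"
    unfolding Ef using Y_pos[OF t] by (simp add: zero_le_mult_iff)
  moreover have "2 * kap * Y t / (p + 1) = al * (N - 2 - al) * (2 / (p + 1))"
    using kz by (simp add: Y_def xal mult.left_commute mult.assoc)
  moreover have "al * (N - 2 - al) * (2 / (p + 1)) < al * (N - 2 - al) * 1"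
    using al al_pos p_gt by (intro mult_strict_left_mono) auto
  ultimately show False by simp
qed

text \<open>Both barriers apply, so \<open>z\<close> and \<open>m\<close> are explicit affine
  functions of \<open>x\<close>.\<close>

lemma fast_classical:
  assumes kap: "kap = 1" and p: "p = pp" shows fast
proof -
  have N: "N = n" using N_eq kap by simp
  have k: "k z = z + N - n" for z unfolding k_def N using kap by simp
  have zeta: "zeta = n / (n - 2)" using zeta_def n_gt by (simp add: p pp_def)
  have zx: "z t = n - n / (n - 2) * x t" if "t \<in> I" for t
    using barrier_ge[OF that] barrier_le[OF that] k p zeta by force
  have mt: "mt t = 2 - 2 / (n - 2) * x t" if "t \<in> I" for t
    using zx[OF that] n_gt by (simp add: m_def k N field_simps)
  have xlt: "x t < n - 2" if "t \<in> I" for t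
  proof -
    have "n / (n - 2) * x t < n / (n - 2) * (n - 2)" using z_pos[OF that] zx[OF that] n_gt by simp
    then show ?thesis by (rule mult_left_less_imp_less) (use n_gt in simp)
  qed
  have UN: "I = UNIV" using xlt by (intro I_UNIV[of "n - 2"]) (auto intro: less_imp_le)
  have mpos: "mt t > 0" for t
  proof -
    have "2 / (n - 2) * x t < 2 / (n - 2) * (n - 2)" using xlt[of t] UN n_gt by (intro mult_strict_left_mono) auto
    moreover have "2 / (n - 2) * (n - 2) = 2" using n_gt by (simp add: field_simps)
    moreover have "mt t = 2 - 2 / (n - 2) * x t" by (rule mt) (simp add: UN)
    ultimately show ?thesis by linarith
  qed
  have incr: "x s \<le> x t" if "s \<le> t" for s t using UN mpos that by (intro x_incr) (auto simp: less_imp_le)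
  obtain X where X: "(x \<longlongrightarrow> X) at_top" "\<And>t. 0 \<le> t \<Longrightarrow> x t \<le> X" "X \<le> n - 2"
    by (rule mono_bounded_tendsto[of 0 x "n - 2"]) (use incr xlt UN in \<open>auto simp: less_imp_le\<close>)
  have "\<not> X < n - 2"
  proof
    assume XN: "X < n - 2"
    have "\<exists>t. x t > n - 2"
    proof (rule x_unbounded[OF UN])
      show "2 - 2 / (n - 2) * X > 0" using XN n_gt by (simp add: field_simps)
      show "mt t \<ge> 2 - 2 / (n - 2) * X" if "0 \<le> t" for t
        using X(2)[OF that] n_gt mt[of t] UN by (simp add: divide_right_mono)
    qed
    then show False using xlt UN by (meson UNIV_I less_asym)
  qed
  then show ?thesis unfolding fast_def using UN mpos X N by auto
qed

end


lemma (in pucci_ode) k_lipschitz: "\<bar>k u - k v\<bar> \<le> kap * \<bar>u - v\<bar>"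
proof -
  have *: "\<bar>k u - k v\<bar> \<le> kap * \<bar>u - v\<bar>" if "u \<le> v" for u v
  proof -
    have "kap * (v - u) \<ge> 1 * (v - u)" using that kap_ge by (intro mult_right_mono) auto
    then have "k v \<le> k u + kap * (v - u)" by (auto simp: k_def min_def algebra_simps)
    then show ?thesis using k_mono[OF that] that by simp
  qed
  show ?thesis using *[of u v] *[of v u] by (cases "u \<le> v") (auto simp: abs_minus_commute)
qed

context orbit begin

lemma fast_less: "fast \<Longrightarrow> x t < N - 2"
proof -
  assume f: fast
  have "x t < x (t + 1)" using f by (intro x_strict_incr) (auto simp: fast_def)
  also have "x (t + 1) \<le> N - 2"
  proof (rule tendsto_lowerbound[of x "N - 2" at_top])
    show "\<forall>\<^sub>F s in at_top. x (t + 1) \<le> x s"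
      unfolding eventually_at_top_linorder
    proof (intro exI[of _ "t + 1"] allI impI)
      fix s assume "t + 1 \<le> s"
      then show "x (t + 1) \<le> x s" using f by (intro x_incr) (auto simp: fast_def less_imp_le)
    qed
  qed (use f in \<open>auto simp: fast_def\<close>)
  finally show ?thesis .
qed

lemma al_less_iff: "al < N - 2 \<longleftrightarrow> 2 < (p - 1) * (N - 2)"
  using p_gt by (simp add: al_def field_simps)

lemma fast_z: "fast \<Longrightarrow> al < N - 2 \<Longrightarrow> (z \<longlongrightarrow> 0) at_top"
  by (rule z_tendsto_0) (auto simp: fast_def less_imp_le)

text \<open>The quotient \<open>w = (N - 2 - x) / (kap z)\<close> satisfies
  \<open>w' = w h - x\<close>, where \<open>h\<close> tends to \<open>(N - 2) p - 2\<close>. The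
  rest point \<open>1 / (p - 2 / (N - 2))\<close> of the limiting equation is repelling: once below
  \<open>1 / R\<close>, which is smaller, \<open>w\<close> would decrease at a fixed speed and
  become negative.\<close>

lemma fast_ratio:
  assumes f: fast and al: "al < N - 2" and R: "R > p - 2 / (N - 2)"
  shows "\<forall>\<^sub>F t in at_top. kap * z t \<le> R * (N - 2 - x t)"
proof -
  have I: "I = UNIV" and x: "(x \<longlongrightarrow> N - 2) at_top" and m: "\<And>t. mt t > 0" using f by (auto simp: fast_def)
  have N2: "N - 2 > 0" using N_ge by simp
  have pN: "(N - 2) * p > 2" using al N2 unfolding al_less_iff by (simp add: algebra_simps)
  have RN: "(N - 2) * R > (N - 2) * p - 2" using R N2 by (simp add: field_simps)
  have "(N - 2) * R > 0" using RN pN by simp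
  then have Rpos: "R > 0" using N2 by (simp add: zero_less_mult_iff)
  \<comment> \<open>\<open>2 c\<close> is the limit of \<open>x - h / R\<close>, the speed at which
    the level \<open>1 / R\<close> would be left downwards.\<close>
  define c where "c = ((N - 2) - ((N - 2) * p - 2) / R) / 2"
  have c: "c > 0" using RN Rpos by (simp add: c_def field_simps)
  define h where "h t = (p + 1) * x t + kap * z t - N" for t
  have "(h \<longlongrightarrow> (p + 1) * (N - 2) + kap * 0 - N) at_top"
    unfolding h_def by (intro tendsto_intros x fast_z f al)
  then have hlim: "(h \<longlongrightarrow> (N - 2) * p - 2) at_top" by (simp add: algebra_simps)
  have "((\<lambda>t. h t / R - x t) \<longlongrightarrow> ((N - 2) * p - 2) / R - (N - 2)) at_top"
    using Rpos by (intro tendsto_intros x hlim) auto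
  also have "(N - 2) - ((N - 2) * p - 2) / R = 2 * c" by (simp add: c_def)
  then have "((N - 2) * p - 2) / R - (N - 2) = - (2 * c)" by (metis minus_diff_eq)
  finally have "((\<lambda>t. h t / R - x t) \<longlongrightarrow> - (2 * c)) at_top" .
  then have e1: "\<forall>\<^sub>F t in at_top. h t / R - x t < - c" by (rule order_tendstoD) (use c in simp)
  have e2: "\<forall>\<^sub>F t in at_top. h t > 0" using hlim by (rule order_tendstoD) (use pN in simp)
  have e3: "\<forall>\<^sub>F t in at_top. z t < n - 1" using fast_z[OF f al] by (rule order_tendstoD) (use n_gt in simp)
  obtain T where T: "\<And>t. t \<ge> T \<Longrightarrow> h t / R - x t < - c \<and> h t > 0 \<and> z t < n - 1"
    using eventually_conj[OF e1 eventually_conj[OF e2 e3]] by (auto simp: eventually_at_top_linorder)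
  define w where "w t = (N - 2 - x t) / (kap * z t)" for t
  have kz: "kap * z t > 0" for t using z_pos[of t] I kap_ge by simp
  have wpos: "w t > 0" for t using fast_less[OF f, of t] kz by (simp add: w_def)
  have wd: "(w has_real_derivative w t * h t - x t) (at t)" if t: "t \<ge> T" for t
  proof -
    have mk: "mt t = kap * z t - (N - 2 - x t)" using T[OF t] by (simp add: m_def k_lower)
    have kk: "k (z t) = kap * z t" using T[OF t] by (simp add: k_lower)
    have "((\<lambda>t. (N - 2 - x t) / (kap * z t)) has_real_derivative
      ((0 - x t * mt t) * (kap * z t) - (N - 2 - x t) * (kap * (z t * (N - p * x t - k (z t))))) / (kap * z t * (kap * z t))) (at t)"
      using kz[of t] I by (intro DERIV_divide DERIV_diff DERIV_const x_deriv DERIV_cmult z_deriv) auto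
    moreover have "((0 - x t * mt t) * (kap * z t) - (N - 2 - x t) * (kap * (z t * (N - p * x t - k (z t))))) / (kap * z t * (kap * z t))
      = w t * h t - x t"
    proof -
      define q where "q = kap * z t"
      have q0: "q > 0" using kz[of t] by (simp add: q_def)
      have sq: "N - 2 - x t = w t * q" unfolding w_def q_def[symmetric] using q0 by simp
      have "(0 - x t * mt t) * (kap * z t) - (N - 2 - x t) * (kap * (z t * (N - p * x t - k (z t))))
        = (0 - x t * (q - (N - 2 - x t))) * q - (N - 2 - x t) * (q * (N - p * x t - q))"
        by (simp add: mk kk q_def mult.assoc)
      also have "\<dots> = (q * q) * (w t * h t - x t)"
        unfolding sq by (simp add: h_def q_def[symmetric] algebra_simps)
      finally have *: "(0 - x t * mt t) * (kap * z t) - (N - 2 - x t) * (kap * (z t * (N - p * x t - k (z t))))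
        = (q * q) * (w t * h t - x t)" .
      show ?thesis unfolding * unfolding q_def[symmetric] using q0 by simp
    qed
    ultimately show ?thesis unfolding w_def[abs_def] by simp
  qed
  have wd': "w t * h t - x t \<le> - c" if "t \<ge> T" "w t \<le> 1 / R" for t
  proof -
    have "w t * h t \<le> 1 / R * h t" using that T[of t] by (intro mult_right_mono) auto
    then show ?thesis using T[of t] that by simp
  qed
  have "w t \<ge> 1 / R" if t: "t \<ge> T" for t
  proof (rule ccontr)
    assume "\<not> w t \<ge> 1 / R"
    then have w0: "1 / R - w t > 0" by simp
    have below: "1 / R - w s > 0" if s: "t \<le> s" for s
    proof (rule first_zero[OF s, where f = "\<lambda>t. 1 / R - w t"])
      have "isCont w r" if "r \<in> {t..s}" for r using wd[of r] DERIV_isCont that t by auto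
      then show "continuous_on {t..s} (\<lambda>t. 1 / R - w t)"
        by (intro continuous_intros continuous_at_imp_continuous_on) auto
      fix r assume r: "t < r" "r \<le> s" "1 / R - w r = 0"
      have rT: "r \<ge> T" using r t by simp
      show "\<exists>D>0. ((\<lambda>t. 1 / R - w t) has_real_derivative D) (at r)"
        using wd'[OF rT] r c wd[OF rT] by (intro exI[of _ "- (w r * h r - x r)"]) (auto intro!: derivative_eq_intros)
    qed (use w0 in simp)
    have "\<exists>s\<ge>t. - w s > 0"
    proof (rule deriv_ge_unbounded[OF c])
      fix s assume s: "t \<le> s"
      have "w s * h s - x s \<le> - c" using below[OF s] s t by (intro wd') auto
      then show "\<exists>D\<ge>c. ((\<lambda>t. - w t) has_real_derivative D) (at s)"
        using DERIV_minus[OF wd[of s]] s t by (intro exI[of _ "- (w s * h s - x s)"]) auto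
    qed
    then show False using wpos by (metis less_asym neg_0_less_iff_less)
  qed
  then have "kap * z t \<le> R * (N - 2 - x t)" if "t \<ge> T" for t
  proof -
    have "1 / R \<le> (N - 2 - x t) / (kap * z t)" using \<open>\<And>t. t \<ge> T \<Longrightarrow> w t \<ge> 1 / R\<close>[OF that] by (simp add: w_def)
    then show ?thesis using kz[of t] Rpos by (simp only: pos_le_divide_eq pos_divide_le_eq times_divide_eq_left mult_1 mult.commute)
  qed
  then show ?thesis unfolding eventually_at_top_linorder by blast
qed

text \<open>\<open>L\<close> stands for \<open>ln (r^(N-2) v)\<close>. It increases, and
  \<open>m > 0\<close> bounds its derivative \<open>N - 2 - x\<close> by \<open>kap z\<close>, which
  decays exponentially.\<close>

lemma fast_converges:
  assumes f: fast and al: "al < N - 2" and L: "\<And>t. (L has_real_derivative N - 2 - x t) (at t)"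
  shows "\<exists>l. (L \<longlongrightarrow> l) at_top"
proof -
  have I: "I = UNIV" and x: "(x \<longlongrightarrow> N - 2) at_top" and m: "\<And>t. mt t > 0" using f by (auto simp: fast_def)
  obtain C c T0 where C: "C > 0" "c > 0" "\<forall>t\<ge>T0. z t \<le> C * exp (- c * t)"
    using z_decay[OF I _ x al] m by (meson less_imp_le)
  have "\<forall>\<^sub>F t in at_top. z t < n - 1" using fast_z[OF f al] by (rule order_tendstoD) (use n_gt in simp)
  then have "\<forall>\<^sub>F t in at_top. t \<ge> T0 \<and> z t < n - 1" by (intro eventually_conj eventually_ge_at_top)
  then obtain T where T: "T \<ge> T0" "\<And>t. t \<ge> T \<Longrightarrow> z t < n - 1"
    unfolding eventually_at_top_linorder by blast
  define F where "F t = L t + kap * C / c * exp (- c * t)" for t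
  have Fd: "F t \<le> F T" if t: "t \<ge> T" for t
  proof (rule DERIV_nonpos_imp_nonincreasing[OF t])
    fix s assume s: "T \<le> s" "s \<le> t"
    have "mt s = kap * z s - (N - 2 - x s)" using T(2)[OF s(1)] by (simp add: m_def k_lower)
    then have "N - 2 - x s \<le> kap * z s" using m[of s] by simp
    also have "\<dots> \<le> kap * (C * exp (- c * s))" using C s T kap_ge by (intro mult_left_mono) auto
    finally have "N - 2 - x s - kap * C * exp (- c * s) \<le> 0" by simp
    moreover have "(F has_real_derivative N - 2 - x s - kap * C * exp (- c * s)) (at s)"
      unfolding F_def[abs_def] using L[of s] C(2) by (auto intro!: derivative_eq_intros)
    ultimately show "\<exists>y. (F has_real_derivative y) (at s) \<and> y \<le> 0" by blast
  qed
  have "L t \<le> F T" if "t \<ge> T" for t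
  proof -
    have "kap * C / c * exp (- c * t) \<ge> 0" using kap_ge C by (intro mult_nonneg_nonneg divide_nonneg_nonneg) auto
    then show ?thesis using Fd[OF that] by (simp add: F_def)
  qed
  moreover have "L s \<le> L t" if "s \<le> t" for s t
  proof (rule DERIV_nonneg_imp_nondecreasing[OF that])
    fix r show "\<exists>y. (L has_real_derivative y) (at r) \<and> 0 \<le> y"
      using L[of r] fast_less[OF f, of r] by (intro exI conjI) auto
  qed
  ultimately obtain l where "(L \<longlongrightarrow> l) at_top" using mono_bounded_tendsto[of T L "F T"] by metis
  then show ?thesis by blast
qed

text \<open>Below \<open>X < N - 2\<close> a small \<open>z\<close> forces \<open>x\<close> to decay exponentially, so \<open>Y x\<^sup>-\<^sup>K\<close> increases for
  large \<open>K\<close>; and \<open>Y\<close> itself increases while \<open>x < al\<close>.\<close>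

lemma Y_lower_bound:
  assumes I: "I = UNIV" and X: "\<And>t. x t \<le> X" "X < N - 2"
  shows "\<exists>c>0. \<exists>T. \<forall>t\<ge>T. Y t \<ge> c"
proof -
  define c where "c = (N - 2 - X) / 2"
  \<comment> \<open>\<open>c / kap\<close> makes \<open>m \<le> - c\<close> below this level;
    \<open>n / 2\<close> puts the level below the starting value \<open>n\<close> of
    \<open>z\<close>.\<close>
  define d where "d = min (c / kap) (n / 2)"
  have c: "c > 0" using X by (simp add: c_def)
  have d: "d > 0" "kap * d \<le> c" using c kap_ge n_gt mult_left_mono[of d "c / kap" kap] by (auto simp: d_def)
  have dn: "d < n" unfolding d_def min_less_iff_disj using n_gt by simp
  have mc: "mt t \<le> - c" if "z t < d" for t
  proof -
    have "k (z t) \<le> kap * d" by (rule order_trans[OF k_le mult_left_mono]) (use that kap_ge in auto)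
    moreover have "N - 2 - X = 2 * c" by (simp add: c_def)
    ultimately show ?thesis using X(1)[of t] d(2) unfolding m_def by linarith
  qed
  \<comment> \<open>Chosen so that \<open>K c\<close> exceeds \<open>(p - 1) (N - 2)\<close>, a
    bound for the decay rate of \<open>ln Y\<close>.\<close>
  define K where "K = 1 + (p - 1) * (N - 2) / c"
  define G where "G t = ln (Y t) - K * ln (x t)" for t
  define m0 where "m0 = ln d + (1 - K) * ln (N - 2)"
  have xp: "x t > 0" and zp: "z t > 0" and Yp: "Y t > 0" for t using x_pos z_pos Y_pos I by auto
  have K1: "K \<ge> 1" using p_gt c N_ge by (simp add: K_def)
  have Gd: "(G has_real_derivative (p - 1) * (al - x t) - K * mt t) (at t)" for t
  proof -
    have "((\<lambda>t. ln (Y t)) has_real_derivative (p - 1) * (al - x t)) (at t)"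
      using Y_deriv[of t] Yp[of t] I by (auto intro!: derivative_eq_intros)
    moreover have "((\<lambda>t. ln (x t)) has_real_derivative mt t) (at t)"
      using x_deriv[of t] xp[of t] I by (auto intro!: derivative_eq_intros)
    ultimately show ?thesis unfolding G_def[abs_def] by (intro DERIV_diff DERIV_cmult)
  qed
  have Gm: "G t \<ge> m0" for t
  proof -
    have "\<forall>\<^sub>F t in at_bot. z t > d" using z_lim by (rule order_tendstoD) (rule dn)
    then obtain a where a: "a \<le> t" "z a > d" using eventually_bot_le by blast
    show ?thesis
    proof (rule last_time[OF a(1), where u = z and d = d])
      show "continuous_on {a..t} z" using I by (intro z_cont) auto
      show "continuous_on {a..t} G" using Gd DERIV_isCont continuous_at_imp_continuous_on by blast
      fix s
      show "m0 \<le> G s" if "d \<le> z s"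
      proof -
        have "G s = ln (z s) + (1 - K) * ln (x s)"
          using xp[of s] zp[of s] by (simp add: G_def Y_def ln_mult algebra_simps)
        moreover have "ln (x s) \<le> ln (N - 2)" using X(1)[of s] X(2) xp[of s] by (intro ln_mono) linarith+
        then have "(1 - K) * ln (N - 2) \<le> (1 - K) * ln (x s)"
          using K1 by (intro mult_left_mono_neg) auto
        moreover have "ln d \<le> ln (z s)" using that d by simp
        ultimately show ?thesis by (simp add: m0_def)
      qed
      assume s: "z s < d"
      have "(p - 1) * (al - x s) \<ge> (p - 1) * (- (N - 2))"
        using p_gt al_pos X(1)[of s] X(2) by (intro mult_left_mono) auto
      moreover have "K * mt s \<le> K * (- c)" using mc[OF s] K1 by (intro mult_left_mono) auto
      moreover have "K * c = c + (p - 1) * (N - 2)" using c by (simp add: K_def field_simps)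
      moreover have "(p - 1) * (- (N - 2)) = - ((p - 1) * (N - 2))" "K * (- c) = - (K * c)" by (simp_all only: mult_minus_right)
      ultimately have "(p - 1) * (al - x s) - K * mt s \<ge> 0" using c by linarith
      then show "\<exists>D\<ge>0. (G has_real_derivative D) (at s)" using Gd by blast
    qed (use a in auto)
  qed
  have Yd: "\<exists>D\<ge>0. (Y has_real_derivative D) (at t)" if "x t < al" for t
    using Y_deriv[of t] I Yp[of t] that p_gt by (intro exI[of _ "Y t * ((p - 1) * (al - x t))"]) auto
  show ?thesis
  proof (cases "\<exists>t0. x t0 \<ge> al")
    case True
    then obtain t0 where t0: "x t0 \<ge> al" by auto
    have "Y t \<ge> exp (m0 + K * ln al)" if t: "t \<ge> t0" for t
    proof (rule last_time[OF t, where u = x and d = al])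
      show "continuous_on {t0..t} x" using I by (intro x_cont) auto
      show "continuous_on {t0..t} Y" unfolding Y_def using I by (intro continuous_intros x_cont z_cont) auto
      show "exp (m0 + K * ln al) \<le> Y s" if "al \<le> x s" for s
      proof -
        have "K * ln al \<le> K * ln (x s)" using that al_pos K1 by (intro mult_left_mono) auto
        then have "m0 + K * ln al \<le> ln (Y s)" using Gm[of s] by (simp add: G_def)
        then show ?thesis using Yp[of s] by (simp add: ln_ge_iff)
      qed
    qed (use t0 Yd in auto)
    then show ?thesis by (intro exI[of _ "exp (m0 + K * ln al)"]) auto
  next
    case False
    have "Y 0 \<le> Y t" if "t \<ge> 0" for t
    proof (rule DERIV_nonneg_imp_nondecreasing[OF that])
      show "\<exists>y. (Y has_real_derivative y) (at s) \<and> 0 \<le> y" for s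
        using Yd[of s] False by (auto simp: not_le)
    qed
    then show ?thesis using Yp[of 0] by blast
  qed
qed

text \<open>\<open>E\<close> decreases, is bounded below, and dissipates at least
  \<open>q (al - x)^2\<close>, so \<open>x\<close> tends to \<open>al\<close> by Barbalat. Barbalat
  applied to \<open>x\<close> itself makes \<open>x'\<close>, hence \<open>m\<close>, tend to 0. So
  \<open>k z\<close> converges, to a value below \<open>N - 1\<close>, where \<open>k\<close> is
  linear and can be inverted.\<close>

lemma Y_converges:
  assumes p: "p > pp" and I: "I = UNIV" and xle: "\<And>t. x t \<le> N - 2" and c0: "c0 > 0" "\<And>t. t \<ge> T \<Longrightarrow> Y t \<ge> c0"
  shows "\<exists>L>0. (Y \<longlongrightarrow> L) at_top"
proof -
  have N2: "N - 2 > 0" using N_ge by simp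
  have al: "2 * al < n - 2" using pp_ge(2)[OF p] .
  then have alN: "al < N - 2" using al_pos N_ge by simp
  have rp: "rate > 0" using al by (simp add: rate_def)
  have xp: "x t > 0" and zp: "z t > 0" and Yp: "Y t > 0" and zn: "z t < n" for t
    using x_pos z_pos Y_pos z_lt I by auto
  define B where "B = (N - 2) * n"
  have YB: "Y t \<le> B" for t unfolding Y_def B_def
    using xle[of t] zn[of t] xp[of t] zp[of t] N2 by (intro mult_mono) (auto simp: less_imp_le)
  have E_lower: "- E t \<le> B powr al * (al * (N - 2 - al))" for t
  proof -
    have "- (al * (N - 2 - al)) \<le> (x t - al)\<^sup>2 - al * (N - 2 - al) + 2 * kap * Y t / (p + 1)"
      using Yp[of t] kap_ge p_gt by simp
    then have "Y t powr al * - (al * (N - 2 - al)) \<le> E t" unfolding E_def by (intro mult_left_mono) auto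
    moreover have "Y t powr al * (al * (N - 2 - al)) \<le> B powr al * (al * (N - 2 - al))"
      using YB Yp[of t] al_pos alN by (intro mult_right_mono powr_mono2) (auto simp: less_imp_le)
    ultimately show ?thesis by simp
  qed
  obtain l where l: "((\<lambda>t. - E t) \<longlongrightarrow> l) at_top"
  proof (rule mono_bounded_tendsto[of 0 "\<lambda>t. - E t"])
    show "- E s \<le> - E t" if "s \<le> t" for s t using E_decr[of t s] p I that by simp
  qed (use E_lower in auto)
  define M where "M = N + N + 2 + kap * n"
  have mM: "\<bar>mt t\<bar> \<le> M" for t
  proof -
    have "0 \<le> k (z t)" using k_ge[of "z t"] zp[of t] by simp
    moreover have "k (z t) \<le> kap * n" by (rule order_trans[OF k_le mult_left_mono]) (use zn[of t] kap_ge in auto)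
    ultimately show ?thesis using xle[of t] xp[of t] N2 by (simp add: m_def M_def abs_le_iff)
  qed
  have Mpos: "M > 0" using N2 kap_ge n_gt by (simp add: M_def add_pos_pos)
  have xd: "\<exists>D. (x has_real_derivative D) (at t) \<and> \<bar>D\<bar> \<le> (N - 2) * M" for t
    using x_deriv[of t] I xle[of t] xp[of t] mM[of t] Mpos
    by (intro exI[of _ "x t * mt t"]) (auto simp: abs_mult intro!: mult_mono)
  have xL: "\<bar>x t - x s\<bar> \<le> (N - 2) * M * (t - s)" if "s \<le> t" for s t
    using lipschitz_of_deriv[of s x, OF xd order_refl that] .
  define M' where "M' = N + p * N + kap * n"
  have zd: "\<exists>D. (z has_real_derivative D) (at t) \<and> \<bar>D\<bar> \<le> n * M'" for t
  proof -
    have "0 \<le> k (z t)" using k_ge[of "z t"] zp[of t] by simp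
    moreover have "k (z t) \<le> kap * n" by (rule order_trans[OF k_le mult_left_mono]) (use zn[of t] kap_ge in auto)
    moreover have "0 \<le> p * x t" "p * x t \<le> p * N" using xp[of t] xle[of t] p_gt by (auto intro!: mult_left_mono)
    moreover have "0 < kap * n" using kap_ge n_gt by simp
    ultimately have "\<bar>N - p * x t - k (z t)\<bar> \<le> M'" using N2 unfolding M'_def abs_le_iff by linarith
    then show ?thesis using z_deriv[of t] I zn[of t] zp[of t]
      by (intro exI[of _ "z t * (N - p * x t - k (z t))"]) (auto simp: abs_mult intro!: mult_mono)
  qed
  have zL: "\<bar>z t - z s\<bar> \<le> n * M' * (t - s)" if "s \<le> t" for s t
    using lipschitz_of_deriv[of s z, OF zd order_refl that] .
  have M'pos: "M' > 0" using N2 kap_ge n_gt p_gt by (simp add: M'_def add_pos_pos)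
  define q where "q = 2 * rate * c0 powr al"
  have q: "q > 0" using rp c0 by (simp add: q_def)
  define \<phi> where "\<phi> t = q * (al - x t)\<^sup>2" for t
  have small: "\<forall>\<^sub>F t in at_top. \<phi> t < e" if e: "e > 0" for e
  proof (rule barbalat_upper[OF l _ _ _ e, of T])
    show "\<exists>D\<ge>\<phi> t. ((\<lambda>t. - E t) has_real_derivative D) (at t)" if t: "T \<le> t" for t
    proof -
      obtain D where D: "(E has_real_derivative D) (at t)" "D \<le> - (2 * rate * Y t powr al * (al - x t)\<^sup>2)"
        using E_deriv_le[of t] I p by auto
      have "c0 powr al \<le> Y t powr al" using c0 t al_pos by (intro powr_mono2) auto
      then have "\<phi> t \<le> 2 * rate * Y t powr al * (al - x t)\<^sup>2"
        unfolding \<phi>_def q_def using rp by (intro mult_right_mono mult_left_mono) auto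
      then show ?thesis using DERIV_minus[OF D(1)] D(2) by (intro exI[of _ "- D"]) auto
    qed
    have pd: "\<exists>D. (\<phi> has_real_derivative D) (at t) \<and> \<bar>D\<bar> \<le> 2 * q * (N - 2) * ((N - 2) * M)" for t
    proof -
      obtain D where D: "(x has_real_derivative D) (at t)" "\<bar>D\<bar> \<le> (N - 2) * M" using xd by blast
      have "\<bar>al - x t\<bar> \<le> N - 2" using xle[of t] xp[of t] al_pos alN by (simp add: abs_le_iff)
      then have "\<bar>2 * q * (al - x t) * (- D)\<bar> \<le> 2 * q * (N - 2) * ((N - 2) * M)"
        unfolding abs_mult using D(2) q by (intro mult_mono) auto
      moreover have "(\<phi> has_real_derivative 2 * q * (al - x t) * (- D)) (at t)"
        unfolding \<phi>_def[abs_def] using D(1) by (auto intro!: derivative_eq_intros)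
      ultimately show ?thesis by blast
    qed
    show "\<bar>\<phi> t - \<phi> s\<bar> \<le> 2 * q * (N - 2) * ((N - 2) * M) * (t - s)" if "T \<le> s" "s \<le> t" for s t
      using lipschitz_of_deriv[of s \<phi>, OF pd order_refl that(2)] .
    show "0 < 2 * q * (N - 2) * ((N - 2) * M)" using q N2 Mpos by simp
  qed
  have xlim: "(x \<longlongrightarrow> al) at_top"
  proof (rule tendstoI)
    fix e :: real assume e: "e > 0"
    have "\<forall>\<^sub>F t in at_top. \<phi> t < q * e\<^sup>2" using q e by (intro small) simp
    then show "\<forall>\<^sub>F t in at_top. dist (x t) al < e"
    proof eventually_elim
      case (elim t)
      then have "\<bar>al - x t\<bar>\<^sup>2 < e\<^sup>2" using q by (simp add: \<phi>_def)
      then show ?case using e power_less_imp_less_base[of "\<bar>al - x t\<bar>" 2 e]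
        by (simp add: dist_real_def abs_minus_commute)
    qed
  qed
  have "((\<lambda>t. x t * mt t) \<longlongrightarrow> 0) at_top"
  proof (rule barbalat[OF xlim])
    show "(x has_real_derivative x t * mt t) (at t)" for t using x_deriv I by auto
    define L where "L = (N - 2) * M * M + (N - 2) * ((N - 2) * M + kap * (n * M'))"
    show "0 < L" unfolding L_def using N2 Mpos M'pos kap_ge n_gt by (intro add_pos_pos mult_pos_pos) auto
    show "\<bar>x t * mt t - x s * mt s\<bar> \<le> L * (t - s)" if st: "s \<le> t" for s t
    proof -
      have "x t * mt t - x s * mt s = (x t - x s) * mt t + x s * ((x t - x s) + (k (z t) - k (z s)))"
        by (simp add: m_def algebra_simps)
      then have "\<bar>x t * mt t - x s * mt s\<bar> \<le> \<bar>(x t - x s) * mt t\<bar> + \<bar>x s * ((x t - x s) + (k (z t) - k (z s)))\<bar>"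
        by (simp only: abs_triangle_ineq)
      also have "\<dots> \<le> \<bar>x t - x s\<bar> * \<bar>mt t\<bar> + \<bar>x s\<bar> * (\<bar>x t - x s\<bar> + \<bar>k (z t) - k (z s)\<bar>)"
        unfolding abs_mult by (intro add_left_mono mult_left_mono abs_triangle_ineq) simp
      also have "\<dots> \<le> (N - 2) * M * (t - s) * M + (N - 2) * ((N - 2) * M * (t - s) + kap * (n * M' * (t - s)))"
      proof (intro add_mono mult_mono)
        have "kap * \<bar>z t - z s\<bar> \<le> kap * (n * M' * (t - s))" using zL[OF st] kap_ge by (intro mult_left_mono) auto
        then show "\<bar>k (z t) - k (z s)\<bar> \<le> kap * (n * M' * (t - s))" using k_lipschitz[of "z t" "z s"] by simp
      qed (use xL[OF st] mM[of t] N2 Mpos st xle[of s] xp[of s] in auto)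
      also have "\<dots> = L * (t - s)" by (simp add: L_def algebra_simps)
      finally show ?thesis .
    qed
  qed
  then have "((\<lambda>t. x t * mt t / x t) \<longlongrightarrow> 0 / al) at_top" using al_pos by (intro tendsto_intros xlim) auto
  moreover have "x t * mt t / x t = mt t" for t using xp[of t] by simp
  ultimately have mlim: "(mt \<longlongrightarrow> 0) at_top" by simp
  have "((\<lambda>t. mt t - x t - 2 + N) \<longlongrightarrow> 0 - al - 2 + N) at_top" by (intro tendsto_intros mlim xlim)
  then have klim: "((\<lambda>t. k (z t)) \<longlongrightarrow> N - 2 - al) at_top" by (simp add: m_def algebra_simps)
  have "\<forall>\<^sub>F t in at_top. k (z t) < N - 1" using klim by (rule order_tendstoD) (use al_pos in simp)
  then have "\<forall>\<^sub>F t in at_top. k (z t) / kap = z t"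
  proof eventually_elim
    case (elim t)
    then have "z t < n - 1" using k_upper[of "z t"] by (cases "z t < n - 1") auto
    then show ?case using kap_ge by (simp add: k_lower)
  qed
  moreover have "((\<lambda>t. k (z t) / kap) \<longlongrightarrow> (N - 2 - al) / kap) at_top" using kap_ge by (intro tendsto_intros klim) auto
  ultimately have "(z \<longlongrightarrow> (N - 2 - al) / kap) at_top" by (simp add: tendsto_cong)
  then have "(Y \<longlongrightarrow> al * ((N - 2 - al) / kap)) at_top" unfolding Y_def by (intro tendsto_intros xlim)
  moreover have "al * ((N - 2 - al) / kap) > 0" using al_pos alN kap_ge by auto
  ultimately show ?thesis by blast
qed

end


section \<open>Comparison of orbits for different exponents\<close>


context orbit begin

lemma x_reaches:
  assumes t: "t1 \<in> I" and y: "0 < y" "y \<le> x t1"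
  shows "\<exists>t\<le>t1. x t = y"
proof -
  obtain a where a: "a \<le> t1" "x a < y" using eventually_bot_le[OF order_tendstoD(2)[OF x_lim y(1)]] by blast
  then show ?thesis using IVT'[of x a y t1] y x_cont[OF Icc(1)[OF t]] by auto
qed

lemma strict_mono_of_m_pos:
  assumes m: "\<And>t. t \<in> I \<Longrightarrow> mt t > 0"
  shows "strict_mono_on I x"
  by (intro strict_mono_onI x_strict_incr) (use m I_down in blast)+

end

context pucci_ode begin

text \<open>Only \<open>G\<close> has to be a graph over \<open>x\<close>. \<open>O\<close> is
  followed in its own time and compared with the point of \<open>G\<close> at the same
  \<open>x\<close>, found by the inverse \<open>tau\<close> of \<open>xG\<close>; a touching point
  has \<open>m > 0\<close> because it lies on \<open>G\<close>. The factor \<open>pO - pG\<close>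
  treats both orders of the exponents at once.\<close>

lemma orbit_comparison:
  assumes G: "orbit n kap pG IG xG zG" and O: "orbit n kap pO IO xO zO" and ne: "pG \<noteq> pO"
    and mG: "\<And>t. t \<in> IG \<Longrightarrow> m (xG t) (zG t) > 0"
    and t0: "t0 \<in> IO" and T: "T \<in> IG" "\<And>s. s \<le> t0 \<Longrightarrow> xO s < xG T"
  shows "\<exists>u\<in>IG. u < T \<and> xG u = xO t0 \<and> (pO - pG) * (zG u - zO t0) > 0"
proof -
  interpret G: orbit n kap pG IG xG zG by fact
  interpret O: orbit n kap pO IO xO zO by fact
  have sm: "strict_mono_on IG xG" using G.strict_mono_of_m_pos mG by blast
  have inj: "inj_on xG IG" using sm strict_mono_on_imp_inj_on by blast
  define tau where "tau = the_inv_into IG xG"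
  have tau_x: "tau (xG t) = t" if "t \<in> IG" for t using that inj by (simp add: tau_def the_inv_into_f_f)
  have ex: "\<exists>u\<in>IG. u < T \<and> xG u = y" if y: "0 < y" "y < xG T" for y
  proof -
    obtain u where u: "u \<le> T" "xG u = y" using G.x_reaches[OF T(1) y(1)] y by auto
    then show ?thesis using y G.I_down[OF T(1)] by (intro bexI[of _ u]) (auto simp: le_less)
  qed
  have tau: "tau y \<in> IG" "xG (tau y) = y" "tau y < T" if y: "0 < y" "y < xG T" for y
    using ex[OF y] tau_x by auto
  have tau_deriv: "(tau has_real_derivative inverse (y * m y (zG (tau y)))) (at y)"
    if y: "0 < y" "y < xG T" for y
  proof (rule DERIV_inverse_function[where f = xG and a = 0 and b = "xG T"])
    show "(xG has_real_derivative y * m y (zG (tau y))) (at (tau y))"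
      using G.x_deriv[OF tau(1)[OF y]] tau(2)[OF y] by simp
    show "y * m y (zG (tau y)) \<noteq> 0" using mG[OF tau(1)[OF y]] tau(2)[OF y] y by simp
    obtain d where d: "d > 0" "\<And>t. \<bar>t - tau y\<bar> \<le> d \<Longrightarrow> t \<in> IG"
    proof -
      obtain e where "e > 0" "cball (tau y) e \<subseteq> IG"
        using G.I_open tau(1)[OF y] open_contains_cball by blast
      then show ?thesis by (intro that[of e]) (auto simp: subset_iff dist_real_def abs_minus_commute)
    qed
    have "isCont tau (xG (tau y))"
      by (rule isCont_inverse_function[OF d(1)]) (use d tau_x G.x_isCont in auto)
    then show "isCont tau y" by (simp add: tau(2)[OF y])
  qed (use y tau in auto)
  define e where "e s = (pO - pG) * (zG (tau (xO s)) - zO s)" for s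
  have rng: "0 < xO s" "xO s < xG T" if "s \<le> t0" for s using that T O.x_pos O.I_down[OF t0] by auto
  have e_deriv: "(e has_real_derivative (pO - pG) *
      (zG (tau (xO s)) * (N - pG * xG (tau (xO s)) - k (zG (tau (xO s)))) *
        (inverse (xO s * m (xO s) (zG (tau (xO s)))) * (xO s * m (xO s) (zO s)))
        - zO s * (N - pO * xO s - k (zO s)))) (at s)" if s: "s \<le> t0" for s
  proof -
    note r = rng[OF s]
    have sI: "s \<in> IO" using O.I_down[OF t0 s] .
    have "((\<lambda>s. tau (xO s)) has_real_derivative inverse (xO s * m (xO s) (zG (tau (xO s)))) * (xO s * m (xO s) (zO s))) (at s)"
      by (rule DERIV_chain2[OF tau_deriv[OF r] O.x_deriv[OF sI]])
    then have "((\<lambda>s. zG (tau (xO s))) has_real_derivative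
      zG (tau (xO s)) * (N - pG * xG (tau (xO s)) - k (zG (tau (xO s)))) *
      (inverse (xO s * m (xO s) (zG (tau (xO s)))) * (xO s * m (xO s) (zO s)))) (at s)"
      by (rule DERIV_chain2[where f = zG and g = "\<lambda>s. tau (xO s)", OF G.z_deriv[OF tau(1)[OF r]]])
    then show ?thesis unfolding e_def[abs_def] by (intro DERIV_cmult DERIV_diff O.z_deriv sI)
  qed
  have tau_bot: "filterlim (\<lambda>s. tau (xO s)) at_bot at_bot"
    unfolding filterlim_at_bot
  proof
    fix B
    define b where "b = min B T"
    have bI: "b \<in> IG" using G.I_down[OF T(1)] by (auto simp: b_def)
    have "\<forall>\<^sub>F s in at_bot. xO s < xG b \<and> s \<le> t0"
      by (intro eventually_conj order_tendstoD(2)[OF O.x_lim G.x_pos[OF bI]] eventually_le_at_bot)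
    then show "\<forall>\<^sub>F s in at_bot. tau (xO s) \<le> B"
    proof eventually_elim
      case (elim s)
      note tt = tau[OF rng[of s]]
      have "tau (xO s) < b"
        using elim tt strict_mono_on_less[OF sm, of "tau (xO s)" b] bI by auto
      then show ?case by (simp add: b_def)
    qed
  qed
  \<comment> \<open>Both orbits are compared at the start \<open>(0, n)\<close>: their slopes there
    differ by a positive multiple of \<open>pO - pG\<close>.\<close>
  have e_bot: "\<forall>\<^sub>F s in at_bot. e s > 0"
  proof -
    have 1: "((\<lambda>s. (n - zG (tau (xO s))) / xG (tau (xO s))) \<longlongrightarrow> n * pG / (n + 2)) at_bot"
      by (rule filterlim_compose[OF G.y_lim tau_bot])
    have lim: "((\<lambda>s. (pO - pG) * ((n - zO s) / xO s - (n - zG (tau (xO s))) / xG (tau (xO s))))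
      \<longlongrightarrow> (pO - pG) * (n * pO / (n + 2) - n * pG / (n + 2))) at_bot"
      by (intro tendsto_intros O.y_lim 1)
    have "(pO - pG) * (n * pO / (n + 2) - n * pG / (n + 2)) = (pO - pG)\<^sup>2 * (n / (n + 2))"
      by (simp add: power2_eq_square diff_divide_distrib[symmetric] right_diff_distrib[symmetric])
    moreover have "(pO - pG)\<^sup>2 * (n / (n + 2)) > 0" using ne n_gt by simp
    ultimately have "(pO - pG) * (n * pO / (n + 2) - n * pG / (n + 2)) > 0" by (simp only:)
    from order_tendstoD(1)[OF lim this]
    have "\<forall>\<^sub>F s in at_bot. (pO - pG) * ((n - zO s) / xO s - (n - zG (tau (xO s))) / xG (tau (xO s))) > 0" .
    then show ?thesis using eventually_le_at_bot[of t0]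
    proof eventually_elim
      case (elim s)
      note tt = tau[OF rng[of s]]
      have "(pO - pG) * ((n - zO s) / xO s - (n - zG (tau (xO s))) / xG (tau (xO s))) = e s / xO s"
        using elim tt rng[of s] by (simp add: e_def field_simps)
      then show ?case using elim rng[of s] by (simp add: zero_less_divide_iff)
    qed
  qed
  obtain a where a: "a \<le> t0" "e a > 0" using O.eventually_bot_le[OF e_bot] by blast
  have "e t0 > 0"
  proof (rule first_zero[OF a(1)])
    show "continuous_on {a..t0} e"
      using DERIV_isCont[OF e_deriv] by (intro continuous_at_imp_continuous_on) auto
    fix s assume s: "a < s" "s \<le> t0" "e s = 0"
    note r = rng[OF s(2)]
    have eq: "zG (tau (xO s)) = zO s" using s ne by (simp add: e_def)
    have m: "m (xO s) (zO s) > 0" using mG[OF tau(1)[OF r]] eq tau(2)[OF r] by simp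
    have zp: "zO s > 0" using O.z_pos O.I_down[OF t0 s(2)] by simp
    \<comment> \<open>At a touching point the two \<open>x\<close>-velocities agree, so the
      reparametrisation factor is 1 and only the terms \<open>p x z\<close> differ.\<close>
    have "(pO - pG) * (zO s * (N - pG * xO s - k (zO s)) *
        (inverse (xO s * m (xO s) (zO s)) * (xO s * m (xO s) (zO s)))
        - zO s * (N - pO * xO s - k (zO s))) = (pO - pG)\<^sup>2 * (zO s * xO s)"
      using m r by (simp add: power2_eq_square algebra_simps)
    moreover have "\<dots> > 0" using ne zp r by simp
    ultimately show "\<exists>D>0. (e has_real_derivative D) (at s)"
      using e_deriv[OF s(2)] unfolding eq tau(2)[OF r] by metis
  qed (use a in auto)
  then show ?thesis using tau[OF rng[OF order_refl]] by (intro bexI[of _ "tau (xO t0)"]) (auto simp: e_def)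
qed

text \<open>The orbit of the smaller exponent runs above the graph \<open>G\<close>, so its
  \<open>m\<close> is at least that of \<open>G\<close> at the same \<open>x\<close>. On the compact
  part of \<open>G\<close> up to beyond \<open>N - 2\<close> this has a positive minimum, which
  drives \<open>O\<close> across.\<close>

lemma mcross_mono:
  assumes G: "orbit n kap pG IG xG zG" and O: "orbit n kap pO IO xO zO" and less: "pO < pG"
    and mc: "orbit.mcross n kap IG xG zG"
  shows "orbit.mcross n kap IO xO zO"
proof (rule ccontr)
  interpret G: orbit n kap pG IG xG zG by fact
  interpret O: orbit n kap pO IO xO zO by fact
  assume nm: "\<not> O.mcross"
  have mG: "m (xG t) (zG t) > 0" if "t \<in> IG" for t using G.mcross_m_pos[OF mc that] .
  obtain T where T: "T \<in> IG" "xG T > N - 2" using mc by (auto simp: G.mcross_def)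
  have cmp: "\<exists>u\<in>IG. u < T \<and> xG u = xO t \<and> zG u < zO t"
    if t: "t \<in> IO" "\<And>s. s \<le> t \<Longrightarrow> xO s \<le> N - 2" for t
  proof -
    have "xO s < xG T" if "s \<le> t" for s using t(2)[OF that] T by simp
    then obtain u where u: "u \<in> IG" "u < T" "xG u = xO t" "(pO - pG) * (zG u - zO t) > 0"
      using orbit_comparison[OF G O _ mG t(1) T(1)] less by auto
    then show ?thesis using less by (intro bexI[of _ u]) (auto simp: zero_less_mult_iff)
  qed
  have pos: "m (xO t) (zO t) > 0" if t: "t \<in> IO" "\<And>s. s \<le> t \<Longrightarrow> xO s \<le> N - 2" for t
  proof -
    obtain u where u: "u \<in> IG" "xG u = xO t" "zG u < zO t" using cmp[OF t] by auto
    then show ?thesis using mG[OF u(1)] k_mono[of "zG u" "zO t"] by (simp add: m_def)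
  qed
  note nc = O.not_mcross[OF nm pos]
  have UN: "IO = UNIV" using nc(1) by blast
  have xle: "xO t < N - 2" and mpos: "m (xO t) (zO t) > 0" for t using nc(2,3) by blast+
  have sm: "strict_mono_on IG xG" using G.strict_mono_of_m_pos mG by blast
  obtain u0 where u0: "u0 \<in> IG" "u0 < T" "xG u0 = xO 0" using cmp[of 0] xle UN by (auto simp: less_imp_le)
  have sub: "{u0..T} \<subseteq> IG" using G.I_down[OF T(1)] by auto
  have "continuous_on {u0..T} (\<lambda>u. m (xG u) (zG u))"
    unfolding m_def by (intro continuous_intros k_cont G.x_cont G.z_cont sub)
  then obtain w where w: "w \<in> {u0..T}" "\<And>u. u \<in> {u0..T} \<Longrightarrow> m (xG w) (zG w) \<le> m (xG u) (zG u)"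
    using continuous_attains_inf[of "{u0..T}" "\<lambda>u. m (xG u) (zG u)"] u0 by auto
  have c: "m (xG w) (zG w) > 0" using mG w sub by auto
  have "m (xO t) (zO t) \<ge> m (xG w) (zG w)" if "t \<ge> 0" for t
  proof -
    obtain u where u: "u \<in> IG" "u < T" "xG u = xO t" "zG u < zO t" using cmp[of t] xle UN by (auto simp: less_imp_le)
    have "xO 0 \<le> xO t" using UN mpos that by (intro O.x_incr) (auto simp: less_imp_le)
    then have "u0 \<le> u" using strict_mono_on_less[OF sm u(1) u0(1)] u0 u by (auto simp: not_less[symmetric])
    then have "m (xG w) (zG w) \<le> m (xG u) (zG u)" by (intro w) (use u in auto)
    also have "\<dots> \<le> m (xO t) (zO t)" using k_mono[of "zG u" "zO t"] u by (simp add: m_def)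
    finally show ?thesis .
  qed
  then have "\<exists>t. xO t > N - 2" by (rule O.x_unbounded[OF UN c])
  then show False using xle by (meson less_asym)
qed

text \<open>Below the fast orbit the ratio \<open>rho = kap z / (N - 2 - x)\<close> stays under its limit there, hence
  decays exponentially near \<open>x = N - 2\<close>; as it controls the decay of \<open>ln (N - 2 - x)\<close>, the
  corner \<open>(N - 2, 0)\<close> is never approached.\<close>

lemma above_fast_bounded:
  assumes G: "orbit n kap pG IG xG zG" and O: "orbit n kap pO IO xO zO" and less: "pG < pO"
    and fast: "orbit.fast n kap IG xG zG" and al: "2 < (pG - 1) * (N - 2)"
  shows "IO = UNIV \<and> (\<exists>X<N - 2. \<forall>t. xO t \<le> X)"
proof -
  interpret G: orbit n kap pG IG xG zG by fact
  interpret O: orbit n kap pO IO xO zO by fact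
  have N2: "N - 2 > 0" using N_ge by simp
  have alG: "G.al < N - 2" using al G.al_less_iff by blast
  have IG: "IG = UNIV" and mG: "\<And>t. m (xG t) (zG t) > 0" and xG: "(xG \<longlongrightarrow> N - 2) at_top"
    using fast by (auto simp: G.fast_def)
  have sm: "strict_mono_on IG xG" using G.strict_mono_of_m_pos mG by blast
  have cmp: "\<exists>u. xG u = xO t \<and> zO t < zG u"
    if t: "t \<in> IO" "\<And>s. s \<le> t \<Longrightarrow> xO s < N - 2" for t
  proof -
    \<comment> \<open>\<open>orbit_comparison\<close> needs one point of \<open>G\<close> to the
      right of \<open>O\<close> at all times up to \<open>t\<close>. Before \<open>a'\<close> the
      orbit is left of \<open>xO t\<close>, and afterwards a maximum exists by compactness.\<close>
    obtain a where a: "\<And>s. s \<le> a \<Longrightarrow> xO s < xO t / 2 + xO t / 2"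
      using order_tendstoD(2)[OF O.x_lim O.x_pos[OF t(1)]] by (auto simp: eventually_at_bot_linorder)
    define a' where "a' = min a t"
    have "continuous_on {a'..t} xO" by (intro O.x_cont O.Icc t)
    then obtain w where w: "w \<in> {a'..t}" "\<And>s. s \<in> {a'..t} \<Longrightarrow> xO s \<le> xO w"
      using continuous_attains_sup[of "{a'..t}" xO] by (auto simp: a'_def)
    have "xO w < N - 2" using w t by auto
    then have "\<forall>\<^sub>F T in at_top. xO w < xG T" by (rule order_tendstoD(1)[OF xG])
    then obtain T where T: "xO w < xG T" by (auto simp: eventually_at_top_linorder)
    have "xO s < xG T" if s: "s \<le> t" for s
    proof (cases "s \<le> a'")
      case True
      then have "xO s < xO t" using a[of s] by (simp add: a'_def)
      also have "xO t \<le> xO w" by (rule w) (simp add: a'_def)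
      finally show ?thesis using T by simp
    next
      case False
      then have "xO s \<le> xO w" using s by (intro w) auto
      then show ?thesis using T by simp
    qed
    then obtain u where u: "xG u = xO t" "(pO - pG) * (zG u - zO t) > 0"
      using orbit_comparison[OF G O _ mG t(1), of T] less IG by auto
    then show ?thesis using less by (intro exI[of _ u]) (auto simp: zero_less_mult_iff)
  qed
  have xlt: "xO t < N - 2" if tI: "t \<in> IO" for t
  proof -
    obtain a where a: "a \<le> t" "\<And>s. s \<le> a \<Longrightarrow> xO s < N - 2"
    proof -
      obtain b where "\<And>s. s \<le> b \<Longrightarrow> xO s < N - 2"
        using order_tendstoD(2)[OF O.x_lim N2] by (auto simp: eventually_at_bot_linorder)
      then show ?thesis by (intro that[of "min b t"]) auto
    qed
    \<comment> \<open>At a first contact with \<open>x = N - 2\<close> the orbit would have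
      \<open>z > 0\<close>, while just before it lies below \<open>G\<close>, whose \<open>z\<close>
      is arbitrarily small near that line.\<close>
    have "N - 2 - xO t > 0"
    proof (rule first_zero[OF a(1), where f = "\<lambda>t. N - 2 - xO t"])
      show "continuous_on {a..t} (\<lambda>t. N - 2 - xO t)" by (intro continuous_intros O.x_cont O.Icc tI)
      fix s assume s: "a < s" "s \<le> t" "N - 2 - xO s = 0" "\<And>r. a \<le> r \<Longrightarrow> r < s \<Longrightarrow> N - 2 - xO r > 0"
      have sI: "s \<in> IO" using O.I_down[OF tI s(2)] .
      have lt: "xO r < N - 2" if "r < s" for r using a(2)[of r] s(4)[of r] that by linarith
      have zs: "zO s > 0" using O.z_pos[OF sI] .
      have "\<forall>\<^sub>F u in at_top. zG u < zO s / 2" by (rule order_tendstoD(2)[OF G.fast_z[OF fast alG]]) (use zs in simp)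
      then obtain T where T: "\<And>u. u \<ge> T \<Longrightarrow> zG u < zO s / 2" by (auto simp: eventually_at_top_linorder)
      have "xG T < xO s" using G.fast_less[OF fast, of T] s by simp
      then have e1: "\<forall>\<^sub>F r in at s. xG T < xO r"
        using order_tendstoD(1)[OF O.x_isCont[OF sI, unfolded isCont_def]] by blast
      have e2: "\<forall>\<^sub>F r in at s. zO s / 2 < zO r"
        using order_tendstoD(1)[OF O.z_isCont[OF sI, unfolded isCont_def], of "zO s / 2"] zs by simp
      have "\<forall>\<^sub>F r in at_left s. xG T < xO r \<and> zO s / 2 < zO r"
        using eventually_conj[OF e1 e2] by (simp add: eventually_at_split)
      then obtain b where b: "b < s" "\<And>r. b < r \<Longrightarrow> r < s \<Longrightarrow> xG T < xO r \<and> zO s / 2 < zO r"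
        by (auto simp: eventually_at_left_field)
      define r where "r = (b + s) / 2"
      have r: "r < s" "xG T < xO r" "zO s / 2 < zO r" using b(1) b(2)[of r] by (auto simp: r_def)
      obtain u where u: "xG u = xO r" "zO r < zG u"
        using cmp[of r] lt r(1) O.I_down[OF sI, of r] by auto
      have "T \<le> u" using strict_mono_on_less[OF sm, of u T] IG u r by (auto simp: not_less[symmetric])
      then show "\<exists>D>0. ((\<lambda>t. N - 2 - xO t) has_real_derivative D) (at s)" using T[of u] u r by simp
    qed (use a in auto)
    then show ?thesis by simp
  qed
  have IO: "IO = UNIV" by (rule O.I_UNIV[of "N - 2"]) (use xlt in \<open>auto intro: less_imp_le\<close>)
  have xlt: "xO t < N - 2" for t using xlt IO by auto
  define rO where "rO = pO - 2 / (N - 2)"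
  \<comment> \<open>The midpoint between the entry ratio of the fast orbit and the number
    \<open>rO\<close> given by the same formula for \<open>pO\<close>.\<close>
  define R where "R = (pO + pG) / 2 - 2 / (N - 2)"
  have R: "R > pG - 2 / (N - 2)" "R < rO" "rO < pO" using less N2 by (auto simp: R_def rO_def)
  have e: "\<forall>\<^sub>F t in at_top. kap * zG t \<le> R * (N - 2 - xG t) \<and> zG t < n - 1"
    by (intro eventually_conj G.fast_ratio fast alG R order_tendstoD(2)[OF G.fast_z[OF fast alG]]) (use n_gt in simp)
  then obtain T where T: "\<And>t. t \<ge> T \<Longrightarrow> kap * zG t \<le> R * (N - 2 - xG t) \<and> zG t < n - 1"
    by (auto simp: eventually_at_top_linorder)
  \<comment> \<open>Then \<open>(pO + 1 - R) (N - 2) = N + 2 c\<close>, so near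
    \<open>x = N - 2\<close> the logarithmic derivative of \<open>rho\<close> is at most
    \<open>- c\<close>.\<close>
  define c where "c = (N - 2) * (rO - R) / 2"
  have c: "c > 0" using N2 R by (simp add: c_def)
  define X where "X = max (xG T) (N - 2 - c / (pO + 1 - R))"
  have den: "pO + 1 - R > 0" using R by simp
  have XN: "X < N - 2" using G.fast_less[OF fast, of T] c den by (simp add: X_def)
  have near: "kap * zO t \<le> R * (N - 2 - xO t) \<and> zO t < n - 1 \<and> N - (pO + 1) * xO t + xO t * R \<le> - c"
    if t: "xO t \<ge> X" for t
  proof -
    obtain u where u: "xG u = xO t" "zO t < zG u" using cmp[of t] xlt IO by auto
    have "xG T \<le> xG u" using t u by (simp add: X_def)
    then have "T \<le> u" using strict_mono_on_less[OF sm, of u T] IG by (auto simp: not_less[symmetric])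
    note Tu = T[OF this]
    have "kap * zO t \<le> kap * zG u" using u kap_ge by (intro mult_left_mono) auto
    moreover have "(pO + 1 - R) * (N - 2 - c / (pO + 1 - R)) \<le> (pO + 1 - R) * xO t"
      using t den by (intro mult_left_mono) (auto simp: X_def)
    then have "(pO + 1 - R) * (N - 2) - c \<le> (pO + 1 - R) * xO t" using den by (simp add: right_diff_distrib)
    moreover have "(pO + 1 - R) * (N - 2) = N + 2 * c"
      using N2 by (simp add: c_def rO_def field_simps)
    ultimately show ?thesis using Tu u by (simp add: algebra_simps)
  qed
  define rho where "rho t = kap * zO t / (N - 2 - xO t)" for t
  \<comment> \<open>With \<open>K c = N - 2\<close> the decay of \<open>rho\<close> compensates the
    term \<open>- x rho\<close> in the derivative of \<open>ln (N - 2 - x)\<close>, and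
    \<open>V\<close> does not decrease.\<close>
  define K where "K = (N - 2) / c"
  define V where "V t = ln (N - 2 - xO t) - K * rho t" for t
  have Kc: "K * c = N - 2" using c by (simp add: K_def)
  have Kp: "K > 0" using N2 c by (simp add: K_def)
  have zp: "zO t > 0" and xp: "xO t > 0" for t using O.z_pos O.x_pos IO by auto
  have sp: "N - 2 - xO t > 0" for t using xlt[of t] by simp
  have rp: "rho t > 0" for t using zp[of t] sp[of t] kap_ge by (simp add: rho_def)
  have Vd: "(V has_real_derivative (- (xO t * m (xO t) (zO t))) / (N - 2 - xO t) -
      K * ((kap * (zO t * (N - pO * xO t - k (zO t))) * (N - 2 - xO t) - kap * zO t * (- (xO t * m (xO t) (zO t))))
        / ((N - 2 - xO t) * (N - 2 - xO t)))) (at t)" for t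
  proof -
    have s: "((\<lambda>t. N - 2 - xO t) has_real_derivative - (xO t * m (xO t) (zO t))) (at t)"
      using O.x_deriv[of t] IO by (auto intro!: derivative_eq_intros)
    have z: "((\<lambda>t. kap * zO t) has_real_derivative kap * (zO t * (N - pO * xO t - k (zO t)))) (at t)"
      using O.z_deriv[of t] IO by (intro DERIV_cmult) auto
    have "((\<lambda>t. ln (N - 2 - xO t)) has_real_derivative (- (xO t * m (xO t) (zO t))) / (N - 2 - xO t)) (at t)"
      using DERIV_chain2[OF DERIV_ln[OF sp] s] by (simp add: divide_inverse mult.commute)
    moreover have "(rho has_real_derivative (kap * (zO t * (N - pO * xO t - k (zO t))) * (N - 2 - xO t) - kap * zO t * (- (xO t * m (xO t) (zO t))))
        / ((N - 2 - xO t) * (N - 2 - xO t))) (at t)"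
      unfolding rho_def[abs_def] by (rule DERIV_divide[OF z s]) (use sp[of t] in auto)
    ultimately show ?thesis unfolding V_def[abs_def] by (intro DERIV_diff DERIV_cmult)
  qed
  have Vd': "\<exists>D\<ge>0. (V has_real_derivative D) (at t)" if t: "xO t \<ge> X" for t
  proof -
    note nr = near[OF t]
    have kz: "k (zO t) = kap * zO t" using nr by (simp add: k_lower)
    have mz: "m (xO t) (zO t) = kap * zO t - (N - 2 - xO t)" by (simp add: m_def kz)
    have rR: "rho t \<le> R" using nr sp[of t] by (simp add: rho_def pos_divide_le_eq)
    define s where "s = N - 2 - xO t"
    have s0: "s > 0" using sp[of t] by (simp add: s_def)
    have kr: "kap * zO t = rho t * s" using s0 by (simp add: rho_def s_def)
    have mzs: "m (xO t) (zO t) = (rho t - 1) * s" using mz kr by (simp add: s_def algebra_simps)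
    have "(- (xO t * m (xO t) (zO t))) / s = - xO t * (rho t - 1)"
      unfolding mzs using s0 by simp
    moreover have "(kap * (zO t * (N - pO * xO t - k (zO t))) * s - kap * zO t * (- (xO t * m (xO t) (zO t)))) / (s * s)
      = rho t * (N - (pO + 1) * xO t - kap * zO t + xO t * rho t)"
    proof -
      have "kap * (zO t * (N - pO * xO t - k (zO t))) * s - kap * zO t * (- (xO t * m (xO t) (zO t)))
        = (kap * zO t) * ((N - pO * xO t - kap * zO t) * s + xO t * (kap * zO t - s))"
        unfolding kz mz s_def[symmetric] by (simp add: algebra_simps)
      also have "\<dots> = (s * s) * (rho t * (N - (pO + 1) * xO t - kap * zO t + xO t * rho t))"
        unfolding kr by (simp add: algebra_simps)
      finally show ?thesis using s0 by simp
    qed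
    ultimately have D: "(V has_real_derivative - xO t * (rho t - 1) -
        K * (rho t * (N - (pO + 1) * xO t - kap * zO t + xO t * rho t))) (at t)"
      using Vd[of t] unfolding s_def[symmetric] by simp
    have "xO t * rho t \<le> xO t * R" using rR xp[of t] by (intro mult_left_mono) auto
    moreover have "kap * zO t > 0" using zp[of t] kap_ge by simp
    ultimately have "N - (pO + 1) * xO t - kap * zO t + xO t * rho t \<le> - c" using nr by linarith
    then have "K * (rho t * (N - (pO + 1) * xO t - kap * zO t + xO t * rho t)) \<le> K * (rho t * (- c))"
      using Kp rp[of t] by (intro mult_left_mono) auto
    also have "\<dots> = - (K * c) * rho t" by simp
    also have "\<dots> = - (N - 2) * rho t" by (simp only: Kc)
    finally have "K * (rho t * (N - (pO + 1) * xO t - kap * zO t + xO t * rho t)) \<le> - (N - 2) * rho t" .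
    moreover have "xO t * rho t \<le> (N - 2) * rho t" using xlt[of t] rp[of t] by (intro mult_right_mono) auto
    ultimately have "- xO t * (rho t - 1) -
        K * (rho t * (N - (pO + 1) * xO t - kap * zO t + xO t * rho t)) \<ge> 0" using xp[of t] by (simp add: algebra_simps)
    then show ?thesis using D by blast
  qed
  define m0 where "m0 = ln (N - 2 - X) - K * (kap * n / (N - 2 - X))"
  have Xpos: "X > 0" using G.x_pos[of T] IG by (simp add: X_def less_max_iff_disj)
  have "V t \<ge> m0" for t
  proof -
    obtain a where a: "a \<le> t" "xO a < X" using O.eventually_bot_le[OF order_tendstoD(2)[OF O.x_lim Xpos]] by blast
    show ?thesis
    proof (rule last_time[OF a(1), where u = "\<lambda>t. - xO t" and d = "- X"])
      show "continuous_on {a..t} (\<lambda>t. - xO t)" using IO by (intro continuous_intros O.x_cont) auto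
      show "continuous_on {a..t} V" using Vd DERIV_isCont continuous_at_imp_continuous_on by blast
      fix s
      show "m0 \<le> V s" if "- X \<le> - xO s"
      proof -
        have "ln (N - 2 - X) \<le> ln (N - 2 - xO s)" using that XN by simp
        moreover have "rho s \<le> kap * n / (N - 2 - X)" unfolding rho_def
          using that XN O.z_lt[of s] IO kap_ge zp[of s] by (intro frac_le mult_left_mono) auto
        then have "K * rho s \<le> K * (kap * n / (N - 2 - X))" using Kp by (intro mult_left_mono) auto
        ultimately show ?thesis by (simp add: m0_def V_def)
      qed
      show "\<exists>D\<ge>0. (V has_real_derivative D) (at s)" if "- xO s < - X" using Vd'[of s] that by simp
    qed (use a in auto)
  qed
  then have "m0 \<le> ln (N - 2 - xO t)" for t
    using mult_pos_pos[OF Kp rp[of t]] by (smt (verit) V_def)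
  then have "exp m0 \<le> N - 2 - xO t" for t using ln_ge_iff[OF sp[of t]] by blast
  then have "xO t \<le> N - 2 - exp m0" for t by (simp add: algebra_simps)
  then show ?thesis using IO by (intro conjI exI[of _ "N - 2 - exp m0"]) auto
qed

end


section \<open>Existence and uniqueness of the radial profile\<close>


lemma powr_lipschitz_base:
  fixes a b p :: real
  assumes "0 \<le> a" "a \<le> b" "b \<le> 1" "p \<ge> 1"
  shows "b powr p - a powr p \<le> p * (b - a)"
proof -
  have "p * a - a powr p \<le> p * b - b powr p"
  proof (rule DERIV_nonneg_imp_increasing_open[OF assms(2)])
    show "continuous_on {a..b} (\<lambda>x. p * x - x powr p)"
      using assms by (intro continuous_intros continuous_on_powr') auto
    fix x assume x: "a < x" "x < b"
    have "x powr (p - 1) \<le> 1" using x assms by (intro powr_le1) auto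
    then have "p * 1 - p * x powr (p - 1) \<ge> 0" using assms by (simp add: mult_left_le)
    moreover have "((\<lambda>x. p * x - x powr p) has_real_derivative p * 1 - p * x powr (p - 1)) (at x)"
      using x assms by (auto intro!: derivative_eq_intros)
    ultimately show "\<exists>y. ((\<lambda>x. p * x - x powr p) has_real_derivative y) (at x) \<and> 0 \<le> y" by blast
  qed
  then show ?thesis by (simp add: algebra_simps)
qed

text \<open>The derivative in the exponent is \<open>a powr p * ln a\<close>, bounded by 1 because
  \<open>- a ln a \<le> 1\<close> and \<open>p \<ge> 1\<close>.\<close>

lemma powr_lipschitz_exponent:
  fixes a p q :: real
  assumes a: "0 \<le> a" "a \<le> 1" and pq: "p \<ge> 1" "q \<ge> 1"
  shows "\<bar>a powr p - a powr q\<bar> \<le> \<bar>p - q\<bar>"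
proof -
  have *: "\<bar>a powr p - a powr q\<bar> \<le> q - p" if pq: "1 \<le> p" "p \<le> q" for p q
  proof (cases "a = 0")
    case False
    then have a0: "a > 0" using a by simp
    have mono: "a powr q \<le> a powr p" using a0 a pq by (intro powr_mono') auto
    have "a powr q = a powr p * a powr (q - p)" by (simp add: powr_add[symmetric])
    moreover have "a powr (q - p) \<ge> 1 + (q - p) * ln a"
      using a0 exp_ge_add_one_self[of "(q - p) * ln a"] by (simp add: powr_def)
    ultimately have "a powr p - a powr q \<le> a powr p * (- ((q - p) * ln a))"
      using mult_left_mono[of "1 + (q - p) * ln a" "a powr (q - p)" "a powr p"] by (simp add: algebra_simps)
    also have "\<dots> = (q - p) * (a powr p * (- ln a))" by simp
    also have "\<dots> \<le> (q - p) * 1"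
    proof (intro mult_left_mono)
      have "- ln a \<le> 1 / a - 1" using ln_le_minus_one[of "1 / a"] a0 by (simp add: ln_div)
      then have "a * (- ln a) \<le> a * (1 / a - 1)" using a0 by (intro mult_left_mono) auto
      also have "\<dots> \<le> 1" using a0 by (simp add: algebra_simps)
      finally have "a * (- ln a) \<le> 1" .
      moreover have "a powr p \<le> a powr 1" using a0 a pq by (intro powr_mono') auto
      then have "a powr p * (- ln a) \<le> a * (- ln a)" using a0 a by (intro mult_right_mono) auto
      ultimately show "a powr p * (- ln a) \<le> 1" by linarith
    qed (use pq in auto)
    finally show ?thesis using mono by simp
  qed (use pq in simp)
  show ?thesis using *[of p q] *[of q p] pq by (cases "p \<le> q") (auto simp: abs_minus_commute)
qed

lemma integral_gauss:
  fixes L s :: real assumes "L > 0" "s \<ge> 0"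
  shows "((\<lambda>t. t * exp (L * t\<^sup>2)) has_integral (exp (L * s\<^sup>2) - 1) / (2 * L)) {0..s}"
proof -
  have "((\<lambda>t. t * exp (L * t\<^sup>2)) has_integral (exp (L * s\<^sup>2) / (2 * L) - exp (L * 0\<^sup>2) / (2 * L))) {0..s}"
  proof (rule fundamental_theorem_of_calculus[OF assms(2)])
    fix t
    show "((\<lambda>t. exp (L * t\<^sup>2) / (2 * L)) has_vector_derivative t * exp (L * t\<^sup>2)) (at t within {0..s})"
      unfolding has_real_derivative_iff_has_vector_derivative[symmetric]
      using assms by (auto intro!: derivative_eq_intros simp: field_simps)
  qed
  then show ?thesis by (simp add: diff_divide_distrib)
qed

lemma integral_powr_01:
  fixes a :: real assumes "a > 1"
  shows "((\<lambda>t. t powr (a - 1)) has_integral 1 / a) {0..1}"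
proof -
  have "((\<lambda>t. t powr (a - 1)) has_integral (1 powr a / a - 0 powr a / a)) {0..1::real}"
  proof (rule fundamental_theorem_of_calculus_interior)
    show "continuous_on {0..1} (\<lambda>t::real. t powr a / a)" using assms by (intro continuous_intros continuous_on_powr') auto
    fix t :: real assume "t \<in> {0<..<1}"
    then show "((\<lambda>t. t powr a / a) has_vector_derivative t powr (a - 1)) (at t)"
      unfolding has_real_derivative_iff_has_vector_derivative[symmetric]
      using assms by (auto intro!: derivative_eq_intros)
  qed simp
  then show ?thesis using assms by simp
qed

context pucci_ode begin

text \<open>
The profile solves \<open>v' = - r q\<close>, \<open>r q' = Psi - N q\<close>, \<open>v(0) = 1\<close>, where \<open>Psi\<close> collects both signs of
\<open>v''\<close>. Since \<open>Psi\<close> is Lipschitz in \<open>q\<close> with constant \<open>N - n\<close> only, integrating against \<open>r\<^sup>N\<^sup>-\<^sup>1\<close> (rather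
than \<open>r\<^sup>n\<^sup>-\<^sup>1\<close>) gives a contraction up to the singular point \<open>r = 0\<close>. The truncations at \<open>0\<close> and \<open>1\<close>
make everything globally Lipschitz and are inactive as long as \<open>v > 0\<close>.
\<close>

definition "nl p v = (max 0 (min 1 v)) powr p" for p v :: real
definition "Psi p v q = kap * nl p v - (kap - 1) * max 0 (nl p v - (n - 1) * max 0 q)"
definition "height q r = 1 - integral {0..r} (\<lambda>t. t * q t)" for q :: "real \<Rightarrow> real" and r
text \<open>The equation \<open>(r^N q)' = r^(N-1) Psi\<close> integrated over \<open>[0, r]\<close>
  and rescaled to \<open>[0, 1]\<close>, so that it makes sense at \<open>r = 0\<close>.\<close>

definition "picard p q r = integral {0..1} (\<lambda>s. s powr (N - 1) * Psi p (height q (r * s)) (q (r * s)))"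

lemma nl_bounds: "0 \<le> nl p v" "p \<ge> 0 \<Longrightarrow> nl p v \<le> 1"
  by (auto simp: nl_def intro!: powr_le1)

lemma nl_lipschitz: "p \<ge> 1 \<Longrightarrow> \<bar>nl p u - nl p v\<bar> \<le> p * \<bar>u - v\<bar>"
proof -
  assume p: "p \<ge> 1"
  have *: "\<bar>nl p u - nl p v\<bar> \<le> p * \<bar>u - v\<bar>" if "u \<le> v" for u v
  proof -
    have m: "max 0 (min 1 u) \<le> max 0 (min 1 v)" using that by auto
    have "nl p v - nl p u \<le> p * (max 0 (min 1 v) - max 0 (min 1 u))"
      unfolding nl_def using m p by (intro powr_lipschitz_base) auto
    also have "\<dots> \<le> p * (v - u)" using p that by (intro mult_left_mono) auto
    finally have "nl p v - nl p u \<le> p * (v - u)" .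
    moreover have "nl p u \<le> nl p v" unfolding nl_def using m p by (intro powr_mono2) auto
    ultimately show ?thesis using that by simp
  qed
  show ?thesis using *[of u v] *[of v u] by (cases "u \<le> v") (auto simp: abs_minus_commute)
qed

lemma nl_lipschitz_p: "p \<ge> 1 \<Longrightarrow> p' \<ge> 1 \<Longrightarrow> \<bar>nl p u - nl p' u\<bar> \<le> \<bar>p - p'\<bar>"
  unfolding nl_def by (intro powr_lipschitz_exponent) auto

lemma Psi_ge: "Psi p v q \<ge> nl p v"
proof -
  have "max 0 (nl p v - (n - 1) * max 0 q) \<le> nl p v" using nl_bounds(1)[of p v] n_gt by simp
  then have "(kap - 1) * max 0 (nl p v - (n - 1) * max 0 q) \<le> (kap - 1) * nl p v"
    using kap_ge by (intro mult_left_mono) auto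
  then show ?thesis by (simp add: Psi_def algebra_simps)
qed

lemma Psi_bounds: assumes "p \<ge> 0" shows "0 \<le> Psi p v q" "Psi p v q \<le> kap"
proof -
  show "0 \<le> Psi p v q" using Psi_ge[of p v q] nl_bounds(1)[of p v] by simp
  have "Psi p v q \<le> kap * nl p v" using kap_ge by (simp add: Psi_def)
  also have "\<dots> \<le> kap * 1" using kap_ge nl_bounds(2)[OF assms] by (intro mult_left_mono) auto
  finally show "Psi p v q \<le> kap" by simp
qed

lemma Psi_lipschitz:
  "\<bar>Psi p u q - Psi p' u' q'\<bar> \<le> (2 * kap - 1) * \<bar>nl p u - nl p' u'\<bar> + (N - n) * \<bar>q - q'\<bar>"
proof -
  define A where "A = nl p u" define B where "B = nl p' u'"
  have "\<bar>max 0 (A - (n - 1) * max 0 q) - max 0 (B - (n - 1) * max 0 q')\<bar>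
    \<le> \<bar>(A - (n - 1) * max 0 q) - (B - (n - 1) * max 0 q')\<bar>" by (auto simp: max_def abs_if)
  also have "\<dots> = \<bar>(A - B) + (n - 1) * (max 0 q' - max 0 q)\<bar>" by (simp add: algebra_simps)
  also have "\<dots> \<le> \<bar>A - B\<bar> + \<bar>(n - 1) * (max 0 q' - max 0 q)\<bar>" by (rule abs_triangle_ineq)
  also have "\<bar>(n - 1) * (max 0 q' - max 0 q)\<bar> \<le> (n - 1) * \<bar>q - q'\<bar>"
    using n_gt unfolding abs_mult by (intro mult_mono) (auto simp: max_def abs_if)
  finally have 1: "\<bar>max 0 (A - (n - 1) * max 0 q) - max 0 (B - (n - 1) * max 0 q')\<bar> \<le> \<bar>A - B\<bar> + (n - 1) * \<bar>q - q'\<bar>" by simp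
  have "Psi p u q - Psi p' u' q' = kap * (A - B) - (kap - 1) * (max 0 (A - (n - 1) * max 0 q) - max 0 (B - (n - 1) * max 0 q'))"
    by (simp add: Psi_def A_def B_def algebra_simps)
  then have "\<bar>Psi p u q - Psi p' u' q'\<bar> \<le> \<bar>kap * (A - B)\<bar> + \<bar>(kap - 1) * (max 0 (A - (n - 1) * max 0 q) - max 0 (B - (n - 1) * max 0 q'))\<bar>"
    by (simp only: abs_triangle_ineq4)
  also have "\<dots> = kap * \<bar>A - B\<bar> + (kap - 1) * \<bar>max 0 (A - (n - 1) * max 0 q) - max 0 (B - (n - 1) * max 0 q')\<bar>"
    using kap_ge by (simp add: abs_mult)
  also have "\<dots> \<le> kap * \<bar>A - B\<bar> + (kap - 1) * (\<bar>A - B\<bar> + (n - 1) * \<bar>q - q'\<bar>)"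
    using kap_ge 1 by (intro add_left_mono mult_left_mono) auto
  also have "\<dots> = (2 * kap - 1) * \<bar>A - B\<bar> + (N - n) * \<bar>q - q'\<bar>" unfolding N_eq by (simp add: algebra_simps)
  finally show ?thesis by (simp add: A_def B_def)
qed

lemma nl_cont: "p > 0 \<Longrightarrow> continuous_on S f \<Longrightarrow> continuous_on S (\<lambda>t. nl p (f t))"
  unfolding nl_def by (intro continuous_on_powr' continuous_intros) auto

lemma Psi_cont: "p > 0 \<Longrightarrow> continuous_on S f \<Longrightarrow> continuous_on S g \<Longrightarrow> continuous_on S (\<lambda>t. Psi p (f t) (g t))"
  unfolding Psi_def by (intro continuous_intros nl_cont)

lemma height_deriv_within:
  assumes q: "continuous_on {0..R} q" and r: "0 \<le> r" "r \<le> R"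
  shows "(height q has_real_derivative - (r * q r)) (at r within {0..R})"
proof -
  have "((\<lambda>u. integral {0..u} (\<lambda>t. t * q t)) has_real_derivative (r * q r)) (at r within {0..R})"
    using r by (intro integral_has_real_derivative continuous_intros q) auto
  then show ?thesis unfolding height_def[abs_def] by (auto intro!: derivative_eq_intros)
qed

lemma height_cont_Icc: "continuous_on {0..R} q \<Longrightarrow> continuous_on {0..R} (height q)"
  by (rule DERIV_continuous_on[of _ _ "\<lambda>r. - (r * q r)"]) (auto intro: height_deriv_within)

lemma continuous_on_atLeast:
  fixes f :: "real \<Rightarrow> real"
  assumes "\<And>R. R \<ge> 0 \<Longrightarrow> continuous_on {0..R} f" shows "continuous_on {0..} f"
  unfolding continuous_on_eq_continuous_within
proof
  fix x :: real assume x: "x \<in> {0..}"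
  have "continuous (at x within {0..x + 1}) f"
    using assms[of "x + 1"] x by (simp add: continuous_on_eq_continuous_within)
  moreover have "at x within {0..x + 1} = at x within {0..}"
  proof (rule at_within_nhd[of x "{x - 1<..<x + 1}"])
    show "{0..x + 1} \<inter> {x - 1<..<x + 1} - {x} = {0..} \<inter> {x - 1<..<x + 1} - {x}" by auto
  qed auto
  ultimately show "continuous (at x within {0..}) f" by simp
qed

lemma height_cont: "continuous_on {0..} q \<Longrightarrow> continuous_on {0..} (height q)"
  by (rule continuous_on_atLeast) (auto intro!: height_cont_Icc elim: continuous_on_subset)

text \<open>Differences are measured with the weight \<open>exp (L r^2)\<close>,
  \<open>L = rateL P\<close>. This \<open>L\<close> makes the dependence through \<open>v\<close>
  contribute \<open>n / 2\<close>; the direct dependence on \<open>q\<close> contributes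
  \<open>N - n\<close>, and integrating \<open>s powr (N - 1)\<close> divides by \<open>N\<close>.
  The sum is \<open>thet\<close>.\<close>

definition "rateL P = (2 * kap - 1) * P / n" for P :: real
definition "thet = 1 - n / (2 * N)"

lemma rateL_pos: "P \<ge> 1 \<Longrightarrow> rateL P > 0" using kap_ge n_gt by (simp add: rateL_def)
lemma thet: "0 \<le> thet" "thet < 1" using N_ge n_gt by (auto simp: thet_def)

lemma picard_integrand_cont:
  assumes p: "p > 0" and q: "continuous_on {0..R} q" and r: "0 \<le> r" "r \<le> R"
  shows "continuous_on {0..1} (\<lambda>s. s powr (N - 1) * Psi p (height q (r * s)) (q (r * s)))"
proof -
  have im: "(\<lambda>s. r * s) ` {0..1} \<subseteq> {0..R}"
    using r by (auto intro: order_trans[OF mult_left_le])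
  have "continuous_on {0..1} (\<lambda>s. q (r * s))" "continuous_on {0..1} (\<lambda>s. height q (r * s))"
    by (rule continuous_on_compose2[OF q _ im] continuous_on_compose2[OF height_cont_Icc[OF q] _ im], intro continuous_intros)+
  then show ?thesis using N_ge by (intro continuous_intros continuous_on_powr' Psi_cont p) auto
qed

text \<open>Two exponents are allowed so that one estimate yields contraction, uniqueness and
  Lipschitz dependence on \<open>p\<close>. The square in the weight matches
  \<open>v' = - r q\<close>: integrating \<open>t exp (L t^2)\<close> gains the factor
  \<open>1 / (2 L)\<close>.\<close>

lemma picard_estimate:
  assumes p: "1 \<le> p1" "p1 \<le> P" "1 \<le> p2" "p2 \<le> P"
    and q1: "continuous_on {0..R} q1" and q2: "continuous_on {0..R} q2" and r: "0 \<le> r" "r \<le> R"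
    and D: "D \<ge> 0" "\<And>s. 0 \<le> s \<Longrightarrow> s \<le> R \<Longrightarrow> \<bar>q1 s - q2 s\<bar> \<le> D * exp (rateL P * s\<^sup>2)"
  shows "\<bar>picard p1 q1 r - picard p2 q2 r\<bar> \<le> thet * (D * exp (rateL P * r\<^sup>2)) + (2 * kap - 1) / N * \<bar>p1 - p2\<bar>"
proof -
  define L where "L = rateL P"
  have P: "P \<ge> 1" using p by simp
  have L: "L > 0" using rateL_pos[OF P] by (simp add: L_def)
  have h: "\<bar>height q1 s - height q2 s\<bar> \<le> D * exp (L * s\<^sup>2) / (2 * L)" if s: "0 \<le> s" "s \<le> R" for s
  proof -
    have sub: "{0..s} \<subseteq> {0..R}" using s by auto
    have i1: "(\<lambda>t. t * q1 t) integrable_on {0..s}" and i2: "(\<lambda>t. t * q2 t) integrable_on {0..s}"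
      by (auto intro!: integrable_continuous_interval continuous_intros continuous_on_subset[OF q1 sub] continuous_on_subset[OF q2 sub])
    have "height q1 s - height q2 s = - integral {0..s} (\<lambda>t. t * q1 t - t * q2 t)"
      unfolding height_def integral_diff[OF i1 i2] by simp
    moreover have "norm (integral {0..s} (\<lambda>t. t * q1 t - t * q2 t)) \<le> integral {0..s} (\<lambda>t. D * (t * exp (L * t\<^sup>2)))"
    proof (rule integral_norm_bound_integral)
      show "(\<lambda>t. t * q1 t - t * q2 t) integrable_on {0..s}" using i1 i2 by (rule integrable_diff)
      show "(\<lambda>t. D * (t * exp (L * t\<^sup>2))) integrable_on {0..s}"
        by (intro integrable_continuous_interval continuous_intros)
      fix t assume t: "t \<in> {0..s}"
      have "norm (t * q1 t - t * q2 t) = t * \<bar>q1 t - q2 t\<bar>" using t by (simp add: right_diff_distrib[symmetric] abs_mult)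
      also have "\<dots> \<le> t * (D * exp (L * t\<^sup>2))" using D(2)[of t] t s by (intro mult_left_mono) (auto simp: L_def)
      finally show "norm (t * q1 t - t * q2 t) \<le> D * (t * exp (L * t\<^sup>2))" by (simp add: mult.left_commute)
    qed
    moreover have "integral {0..s} (\<lambda>t. D * (t * exp (L * t\<^sup>2))) = D * ((exp (L * s\<^sup>2) - 1) / (2 * L))"
      using integral_gauss[OF L s(1)] by (simp add: integral_unique)
    moreover have "D * ((exp (L * s\<^sup>2) - 1) / (2 * L)) \<le> D * (exp (L * s\<^sup>2) / (2 * L))"
      using D L by (intro mult_left_mono divide_right_mono) auto
    ultimately show ?thesis by simp
  qed
  define B where "B = (2 * kap - 1) * (P * (D * exp (L * r\<^sup>2) / (2 * L)) + \<bar>p1 - p2\<bar>) + (N - n) * (D * exp (L * r\<^sup>2))"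
  have B0: "B \<ge> 0" unfolding B_def using kap_ge N_ge D L P by (intro add_nonneg_nonneg mult_nonneg_nonneg) auto
  have diff: "\<bar>Psi p1 (height q1 (r * s)) (q1 (r * s)) - Psi p2 (height q2 (r * s)) (q2 (r * s))\<bar> \<le> B"
    if s: "0 \<le> s" "s \<le> 1" for s
  proof -
    have rs: "0 \<le> r * s" "r * s \<le> r" using s r by (auto intro: mult_left_le)
    then have ee: "exp (L * (r * s)\<^sup>2) \<le> exp (L * r\<^sup>2)" using L r by (simp add: power_mono)
    have "\<bar>nl p1 (height q1 (r * s)) - nl p2 (height q2 (r * s))\<bar> \<le>
      \<bar>nl p1 (height q1 (r * s)) - nl p1 (height q2 (r * s))\<bar> + \<bar>nl p1 (height q2 (r * s)) - nl p2 (height q2 (r * s))\<bar>"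
      by simp
    also have "\<dots> \<le> p1 * \<bar>height q1 (r * s) - height q2 (r * s)\<bar> + \<bar>p1 - p2\<bar>"
      using p by (intro add_mono nl_lipschitz nl_lipschitz_p) auto
    also have "\<dots> \<le> P * (D * exp (L * r\<^sup>2) / (2 * L)) + \<bar>p1 - p2\<bar>"
    proof (intro add_mono mult_mono order_refl)
      have "\<bar>height q1 (r * s) - height q2 (r * s)\<bar> \<le> D * exp (L * (r * s)\<^sup>2) / (2 * L)" using rs r by (intro h) auto
      also have "\<dots> \<le> D * exp (L * r\<^sup>2) / (2 * L)" using ee D L by (intro divide_right_mono mult_left_mono) auto
      finally show "\<bar>height q1 (r * s) - height q2 (r * s)\<bar> \<le> D * exp (L * r\<^sup>2) / (2 * L)" .
    qed (use p in auto)
    finally have 1: "\<bar>nl p1 (height q1 (r * s)) - nl p2 (height q2 (r * s))\<bar> \<le> P * (D * exp (L * r\<^sup>2) / (2 * L)) + \<bar>p1 - p2\<bar>" .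
    have "\<bar>q1 (r * s) - q2 (r * s)\<bar> \<le> D * exp (L * (r * s)\<^sup>2)" unfolding L_def using rs r by (intro D(2)) auto
    also have "\<dots> \<le> D * exp (L * r\<^sup>2)" using ee D by (intro mult_left_mono) auto
    finally have 2: "\<bar>q1 (r * s) - q2 (r * s)\<bar> \<le> D * exp (L * r\<^sup>2)" .
    show ?thesis unfolding B_def using Psi_lipschitz 1 2 kap_ge N_ge
      by (intro order_trans[OF Psi_lipschitz add_mono] mult_left_mono) auto
  qed
  have i1: "(\<lambda>s. s powr (N - 1) * Psi p1 (height q1 (r * s)) (q1 (r * s))) integrable_on {0..1}"
    and i2: "(\<lambda>s. s powr (N - 1) * Psi p2 (height q2 (r * s)) (q2 (r * s))) integrable_on {0..1}"
    using p r q1 q2 by (auto intro!: integrable_continuous_interval picard_integrand_cont)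
  have NN: "((\<lambda>s. s powr (N - 1)) has_integral 1 / N) {0..1}" using N_ge by (intro integral_powr_01) auto
  have "\<bar>picard p1 q1 r - picard p2 q2 r\<bar> = norm (integral {0..1} (\<lambda>s. s powr (N - 1) * Psi p1 (height q1 (r * s)) (q1 (r * s)) -
      s powr (N - 1) * Psi p2 (height q2 (r * s)) (q2 (r * s))))"
    unfolding picard_def integral_diff[OF i1 i2] by simp
  also have "\<dots> \<le> integral {0..1} (\<lambda>s. s powr (N - 1) * B)"
  proof (rule integral_norm_bound_integral[OF integrable_diff[OF i1 i2]])
    show "(\<lambda>s. s powr (N - 1) * B) integrable_on {0..1}"
      using has_integral_mult_left[OF NN, of B] by blast
    show "norm (s powr (N - 1) * Psi p1 (height q1 (r * s)) (q1 (r * s)) - s powr (N - 1) * Psi p2 (height q2 (r * s)) (q2 (r * s)))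
      \<le> s powr (N - 1) * B" if "s \<in> {0..1}" for s
      unfolding right_diff_distrib[symmetric] norm_mult using diff[of s] that by (intro mult_mono) auto
  qed
  also have "\<dots> = B / N" by (subst integral_unique[OF has_integral_mult_left[OF NN, of B]]) simp
  also have "\<dots> = thet * (D * exp (L * r\<^sup>2)) + (2 * kap - 1) / N * \<bar>p1 - p2\<bar>"
  proof -
    have "(2 * kap - 1) * (P * (D * exp (L * r\<^sup>2) / (2 * L))) = n / 2 * (D * exp (L * r\<^sup>2))"
    proof -
      have "(2 * kap - 1) * P = n * L" using n_gt by (simp add: L_def rateL_def)
      then have "(2 * kap - 1) * (P * (D * exp (L * r\<^sup>2) / (2 * L))) = n * L * (D * exp (L * r\<^sup>2) / (2 * L))"
        by (simp only: mult.assoc[symmetric])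
      then show ?thesis using L by simp
    qed
    then have "B = (N - n / 2) * (D * exp (L * r\<^sup>2)) + (2 * kap - 1) * \<bar>p1 - p2\<bar>"
      unfolding B_def by (simp add: algebra_simps)
    moreover have "thet = (N - n / 2) / N" using N_ge n_gt by (simp add: thet_def diff_divide_distrib)
    ultimately show ?thesis by (simp add: add_divide_distrib)
  qed
  finally show ?thesis by (simp add: L_def)
qed

end


context pucci_ode begin

text \<open>Apply the estimate where the weighted difference is largest; since
  \<open>thet < 1\<close>, that maximum can be absorbed.\<close>

lemma picard_stability:
  assumes p: "1 \<le> p1" "p1 \<le> P" "1 \<le> p2" "p2 \<le> P"
    and q1: "continuous_on {0..R} q1" and q2: "continuous_on {0..R} q2"
    and fix1: "\<And>r. 0 \<le> r \<Longrightarrow> r \<le> R \<Longrightarrow> q1 r = picard p1 q1 r"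
    and fix2: "\<And>r. 0 \<le> r \<Longrightarrow> r \<le> R \<Longrightarrow> q2 r = picard p2 q2 r"
    and r: "0 \<le> r" "r \<le> R"
  shows "\<bar>q1 r - q2 r\<bar> \<le> (2 * kap - 1) / N / (1 - thet) * \<bar>p1 - p2\<bar> * exp (rateL P * r\<^sup>2)"
proof -
  define L where "L = rateL P"
  have L: "L > 0" using rateL_pos[of P] p by (simp add: L_def)
  define g where "g s = \<bar>q1 s - q2 s\<bar> * exp (- L * s\<^sup>2)" for s
  have "continuous_on {0..R} g" unfolding g_def by (intro continuous_intros q1 q2)
  then obtain r0 where r0: "r0 \<in> {0..R}" "\<And>s. s \<in> {0..R} \<Longrightarrow> g s \<le> g r0"
    using continuous_attains_sup[of "{0..R}" g] r by auto
  have eq: "\<bar>q1 s - q2 s\<bar> = g s * exp (L * s\<^sup>2)" for s by (simp add: g_def mult.assoc exp_add[symmetric])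
  have bd: "\<bar>q1 s - q2 s\<bar> \<le> g r0 * exp (L * s\<^sup>2)" if "0 \<le> s" "s \<le> R" for s
    unfolding eq using r0(2)[of s] that by (intro mult_right_mono) auto
  have g0: "g r0 \<ge> 0" by (simp add: g_def)
  define c where "c = (2 * kap - 1) / N * \<bar>p1 - p2\<bar>"
  have c0: "c \<ge> 0" unfolding c_def using kap_ge N_ge by (intro mult_nonneg_nonneg divide_nonneg_nonneg) auto
  have "\<bar>q1 r0 - q2 r0\<bar> \<le> thet * (g r0 * exp (L * r0\<^sup>2)) + c"
    using picard_estimate[OF p q1 q2 _ _ g0, of r0] bd r0 fix1[of r0] fix2[of r0] unfolding L_def c_def by auto
  then have "g r0 * exp (L * r0\<^sup>2) \<le> thet * (g r0 * exp (L * r0\<^sup>2)) + c" unfolding eq .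
  moreover have "c \<le> c * exp (L * r0\<^sup>2)" using c0 L by (simp add: mult_le_cancel_left1)
  ultimately have "g r0 * exp (L * r0\<^sup>2) \<le> (thet * g r0 + c) * exp (L * r0\<^sup>2)" by (simp add: algebra_simps)
  then have "g r0 \<le> thet * g r0 + c" by simp
  then have "g r0 * (1 - thet) \<le> c" by (simp add: algebra_simps)
  then have "g r0 \<le> c / (1 - thet)" using thet by (simp add: pos_le_divide_eq)
  then have "\<bar>q1 r - q2 r\<bar> \<le> c / (1 - thet) * exp (L * r\<^sup>2)"
    using bd[OF r] mult_right_mono[of "g r0" "c / (1 - thet)" "exp (L * r\<^sup>2)"] by simp
  then show ?thesis by (simp add: c_def L_def)
qed

lemma picard_cont:
  assumes p: "p > 0" and q: "continuous_on {0..} q"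
  shows "continuous_on {0..} (picard p q)"
proof (rule continuous_on_atLeast)
  fix R :: real assume R: "R \<ge> 0"
  have h: "continuous_on {0..} (height q)" by (rule height_cont[OF q])
  have im: "(\<lambda>x. fst x * snd x) ` ({0..R} \<times> {0..1::real}) \<subseteq> {0..}" by auto
  have c: "continuous_on ({0..R} \<times> {0..1::real}) (\<lambda>x. fst x * snd x)" by (intro continuous_intros)
  have "continuous_on ({0..R} \<times> {0..1}) (\<lambda>x. snd x powr (N - 1) * Psi p (height q (fst x * snd x)) (q (fst x * snd x)))"
    using N_ge by (intro continuous_intros continuous_on_powr' Psi_cont p continuous_on_compose2[OF q c im] continuous_on_compose2[OF h c im]) auto
  then have "continuous_on ({0..R} \<times> cbox 0 1) (\<lambda>(r, s). s powr (N - 1) * Psi p (height q (r * s)) (q (r * s)))"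
    by (simp add: case_prod_unfold)
  then have "continuous_on {0..R} (\<lambda>r. integral (cbox 0 1) (\<lambda>s. s powr (N - 1) * Psi p (height q (r * s)) (q (r * s))))"
    by (rule integral_continuous_on_param)
  then show "continuous_on {0..R} (picard p q)" by (simp add: picard_def[abs_def])
qed

lemma picard_bounds:
  assumes p: "p > 0" and q: "continuous_on {0..} q" and r: "0 \<le> r"
  shows "0 \<le> picard p q r" "picard p q r \<le> kap"
proof -
  have i: "(\<lambda>s. s powr (N - 1) * Psi p (height q (r * s)) (q (r * s))) integrable_on {0..1}"
    by (intro integrable_continuous_interval picard_integrand_cont[where R = r] p continuous_on_subset[OF q]) (use r in auto)
  show "0 \<le> picard p q r" unfolding picard_def
    using Psi_bounds(1) p by (intro integral_nonneg i) auto
  have "picard p q r \<le> integral {0..1} (\<lambda>s::real. kap)" unfolding picard_def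
  proof (rule integral_le[OF i])
    fix s :: real assume "s \<in> {0..1}"
    then have "s powr (N - 1) \<le> 1" using N_ge by (intro powr_le1) auto
    then show "s powr (N - 1) * Psi p (height q (r * s)) (q (r * s)) \<le> kap"
      using Psi_bounds[of p] p mult_mono[of "s powr (N - 1)" 1 "Psi p (height q (r * s)) (q (r * s))" kap] by simp
  qed auto
  then show "picard p q r \<le> kap" by simp
qed

lemma picard_fixpoint_exists:
  assumes p: "p \<ge> 1"
  shows "\<exists>q. continuous_on {0..} q \<and> (\<forall>r\<ge>0. q r = picard p q r)"
proof -
  define L where "L = rateL p"
  have L: "L > 0" using rateL_pos[OF p] by (simp add: L_def)
  \<comment> \<open>Writing the unknown as \<open>exp (L s^2)\<close> times a bounded function turns
    the weighted norm into the sup norm. The truncation \<open>max 0 r\<close> in \<open>F\<close>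
    extends everything to the whole line.\<close>
  define unw where "unw Q s = exp (L * s\<^sup>2) * apply_bcontfun Q s" for Q :: "real \<Rightarrow>\<^sub>C real" and s
  define F where "F Q r = exp (- L * (max 0 r)\<^sup>2) * picard p (unw Q) (max 0 r)" for Q r
  have unw_cont: "continuous_on S (unw Q)" for S Q
    unfolding unw_def by (intro continuous_intros continuous_on_subset[OF continuous_on_apply_bcontfun]) auto
  have FB: "F Q \<in> bcontfun" for Q
  proof (rule bcontfun_normI)
    have "continuous_on UNIV (\<lambda>r. picard p (unw Q) (max 0 r))"
      by (rule continuous_on_compose2[OF picard_cont[OF _ unw_cont]]) (use p in \<open>auto intro!: continuous_intros simp: le_max_iff_disj\<close>)
    then show "continuous_on UNIV (F Q)" unfolding F_def by (intro continuous_intros)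
    fix r
    have "exp (- L * (max 0 r)\<^sup>2) \<le> 1" using L by simp
    moreover have "0 \<le> picard p (unw Q) (max 0 r)" "picard p (unw Q) (max 0 r) \<le> kap"
      using picard_bounds[OF _ unw_cont, of p "max 0 r"] p by (auto simp: le_max_iff_disj)
    ultimately show "norm (F Q r) \<le> kap"
      using mult_mono[of "exp (- L * (max 0 r)\<^sup>2)" 1 "picard p (unw Q) (max 0 r)" kap] by (simp add: F_def abs_mult)
  qed
  define \<Phi> where "\<Phi> Q = Bcontfun (F Q)" for Q
  have \<Phi>: "apply_bcontfun (\<Phi> Q) = F Q" for Q using FB by (simp add: \<Phi>_def Bcontfun_inverse)
  have contr: "dist (\<Phi> Q1) (\<Phi> Q2) \<le> thet * dist Q1 Q2" for Q1 Q2
  proof (rule dist_bound)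
    fix r :: real
    define r' where "r' = max 0 r"
    define D where "D = dist Q1 Q2"
    have r': "0 \<le> r'" by (simp add: r'_def)
    have "\<bar>unw Q1 s - unw Q2 s\<bar> \<le> D * exp (rateL p * s\<^sup>2)" for s
    proof -
      have "\<bar>unw Q1 s - unw Q2 s\<bar> = exp (L * s\<^sup>2) * dist (Q1 s) (Q2 s)"
        by (simp add: unw_def dist_real_def right_diff_distrib[symmetric] abs_mult)
      also have "\<dots> \<le> exp (L * s\<^sup>2) * D" unfolding D_def by (intro mult_left_mono dist_bounded) auto
      finally show ?thesis by (simp add: L_def mult.commute)
    qed
    then have "\<bar>picard p (unw Q1) r' - picard p (unw Q2) r'\<bar> \<le> thet * (D * exp (rateL p * r'\<^sup>2)) + (2 * kap - 1) / N * \<bar>p - p\<bar>"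
      using p r' by (intro picard_estimate[where R = r'] unw_cont) (auto simp: D_def)
    then have est: "\<bar>picard p (unw Q1) r' - picard p (unw Q2) r'\<bar> \<le> thet * D * exp (L * r'\<^sup>2)" by (simp add: L_def)
    have "dist (F Q1 r) (F Q2 r) = exp (- L * r'\<^sup>2) * \<bar>picard p (unw Q1) r' - picard p (unw Q2) r'\<bar>"
      by (simp add: F_def dist_real_def r'_def right_diff_distrib[symmetric] abs_mult)
    also have "\<dots> \<le> exp (- L * r'\<^sup>2) * (thet * D * exp (L * r'\<^sup>2))" using est by (intro mult_left_mono) auto
    also have "\<dots> = thet * D * (exp (- L * r'\<^sup>2) * exp (L * r'\<^sup>2))" by (simp only: mult.assoc mult.commute mult.left_commute)
    also have "\<dots> = thet * D" by (simp add: exp_add[symmetric])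
    finally show "dist (\<Phi> Q1 r) (\<Phi> Q2 r) \<le> thet * dist Q1 Q2" by (simp add: \<Phi> D_def)
  qed
  obtain Q where Q: "\<Phi> Q = Q"
    using banach_fix_type[OF thet, of \<Phi>] contr by blast
  have "unw Q r = picard p (unw Q) r" if "r \<ge> 0" for r
  proof -
    have "apply_bcontfun Q r = F Q r" using \<Phi>[of Q] Q by simp
    then show ?thesis using that by (simp add: unw_def[of Q r] F_def mult.assoc[symmetric] exp_add[symmetric])
  qed
  then show ?thesis using unw_cont by blast
qed

section \<open>The normalised profile and its uniqueness\<close>

definition "qs p = (SOME q. continuous_on {0..} q \<and> (\<forall>r\<ge>0. q r = picard p q r))"
definition "vs p = height (qs p)"

lemma qs: assumes "p \<ge> 1" shows qs_cont: "continuous_on {0..} (qs p)" and qs_fix: "r \<ge> 0 \<Longrightarrow> qs p r = picard p (qs p) r"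
  using someI_ex[OF picard_fixpoint_exists[OF assms]] unfolding qs_def[symmetric] by auto

lemma qs_unique:
  assumes p: "p \<ge> 1" and q: "continuous_on {0..} q" "\<And>r. r \<ge> 0 \<Longrightarrow> q r = picard p q r" and r: "r \<ge> 0"
  shows "q r = qs p r"
proof -
  have "\<bar>q r - qs p r\<bar> \<le> (2 * kap - 1) / N / (1 - thet) * \<bar>p - p\<bar> * exp (rateL p * r\<^sup>2)"
    using p r q qs_fix[OF p] by (intro picard_stability[where R = r]) (auto intro: continuous_on_subset[OF q(1)] continuous_on_subset[OF qs_cont[OF p]])
  then show ?thesis by simp
qed

lemma qs_nonneg: "p \<ge> 1 \<Longrightarrow> r \<ge> 0 \<Longrightarrow> qs p r \<ge> 0"
  using picard_bounds(1)[of p "qs p" r] qs_cont[of p] qs_fix[of p r] by simp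

lemma vs_0: "vs p 0 = 1" by (simp add: vs_def height_def)

lemma vs_cont: "p \<ge> 1 \<Longrightarrow> continuous_on {0..} (vs p)"
  unfolding vs_def by (intro height_cont qs_cont)

lemma height_deriv:
  assumes q: "continuous_on {0..} q" and r: "r > 0"
  shows "(height q has_real_derivative - (r * q r)) (at r)"
proof -
  have "(height q has_real_derivative - (r * q r)) (at r within {0..r + 1})"
    using r by (intro height_deriv_within continuous_on_subset[OF q]) auto
  moreover have "at r within {0..r + 1} = at r"
    by (rule at_within_interior) (use r in auto)
  ultimately show ?thesis by simp
qed

lemma vs_deriv: "p \<ge> 1 \<Longrightarrow> r > 0 \<Longrightarrow> (vs p has_real_derivative - (r * qs p r)) (at r)"
  unfolding vs_def by (intro height_deriv qs_cont)

definition "primitive p q r = integral {0..r} (\<lambda>t. t powr (N - 1) * Psi p (height q t) (q t))"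

lemma primitive_deriv:
  assumes p: "p > 0" and q: "continuous_on {0..} q" and r: "r \<ge> 0" "r \<le> R"
  shows "(primitive p q has_real_derivative r powr (N - 1) * Psi p (height q r) (q r)) (at r within {0..R})"
  unfolding primitive_def[abs_def]
  using r N_ge by (intro integral_has_real_derivative continuous_intros continuous_on_powr' Psi_cont p
      continuous_on_subset[OF q] continuous_on_subset[OF height_cont[OF q]]) auto

lemma picard_primitive:
  assumes p: "p > 0" and q: "continuous_on {0..} q" and r: "r > 0"
  shows "r powr N * picard p q r = primitive p q r"
proof -
  have "((\<lambda>s. (r * s) powr (N - 1) * Psi p (height q (r * s)) (q (r * s))) has_integral
    primitive p q (r * 1) / r - primitive p q (r * 0) / r) {0..1}"
  proof (rule fundamental_theorem_of_calculus)
    fix s :: real assume s: "s \<in> {0..1}"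
    have "(primitive p q has_real_derivative (r * s) powr (N - 1) * Psi p (height q (r * s)) (q (r * s))) (at (r * s) within {0..r})"
      using s r by (intro primitive_deriv p q) (auto intro: mult_left_le)
    then have "(primitive p q has_real_derivative (r * s) powr (N - 1) * Psi p (height q (r * s)) (q (r * s))) (at (r * s) within (\<lambda>s. r * s) ` {0..1})"
      by (rule has_field_derivative_subset) (use r in \<open>auto intro: mult_left_le\<close>)
    then have "((\<lambda>s. primitive p q (r * s)) has_real_derivative (r * s) powr (N - 1) * Psi p (height q (r * s)) (q (r * s)) * r) (at s within {0..1})"
      using DERIV_image_chain[of "primitive p q" _ "\<lambda>s. r * s" s "{0..1}" r] DERIV_cmult_Id[of r s "{0..1}"] by (simp add: o_def)
    from DERIV_cdivide[OF this, of r] show "((\<lambda>s. primitive p q (r * s) / r) has_vector_derivative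
      (r * s) powr (N - 1) * Psi p (height q (r * s)) (q (r * s))) (at s within {0..1})"
      unfolding has_real_derivative_iff_has_vector_derivative[symmetric] using r by simp
  qed simp
  then have "integral {0..1} (\<lambda>s. (r * s) powr (N - 1) * Psi p (height q (r * s)) (q (r * s))) = primitive p q r / r"
    by (simp add: integral_unique primitive_def)
  moreover have "integral {0..1} (\<lambda>s. (r * s) powr (N - 1) * Psi p (height q (r * s)) (q (r * s)))
    = integral {0..1} (\<lambda>s. r powr (N - 1) * (s powr (N - 1) * Psi p (height q (r * s)) (q (r * s))))"
    using r by (intro integral_cong) (auto simp: powr_mult)
  ultimately have "r powr (N - 1) * picard p q r = primitive p q r / r" by (simp add: picard_def)
  moreover have "r powr N = r powr (N - 1) * r" using r by (simp add: powr_diff)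
  ultimately show ?thesis using r by (simp add: field_simps)
qed

text \<open>\<open>r^N q - primitive\<close> is constant for \<open>r > 0\<close> and vanishes at 0
  because \<open>q\<close> is continuous there. So continuity at the singular point takes the place
  of an initial value for \<open>q\<close>.\<close>

lemma fixpoint_of_ode:
  assumes p: "p \<ge> 1" and q: "continuous_on {0..} q"
    and ode: "\<And>r. r > 0 \<Longrightarrow> (q has_real_derivative (Psi p (height q r) (q r) - N * q r) / r) (at r)" and r: "r \<ge> 0"
  shows "q r = qs p r"
proof (rule qs_unique[OF p q _ r])
  have pos: "q r = picard p q r" if r: "r > 0" for r
  proof -
    have "r powr N * q r - primitive p q r = 0 powr N * q 0 - primitive p q 0"
    proof (rule DERIV_isconst_end[OF r, where f = "\<lambda>r. r powr N * q r - primitive p q r"])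
      show "continuous_on {0..r} (\<lambda>r. r powr N * q r - primitive p q r)"
      proof (intro continuous_on_diff continuous_on_mult)
        show "continuous_on {0..r} (\<lambda>r. r powr N)" using N_ge by (intro continuous_on_powr' continuous_intros) auto
        show "continuous_on {0..r} q" by (rule continuous_on_subset[OF q]) auto
        show "continuous_on {0..r} (primitive p q)"
          by (rule DERIV_continuous_on, rule primitive_deriv[OF _ q]) (use p in auto)
      qed
      fix x assume x: "0 < x" "x < r"
      have "(primitive p q has_real_derivative x powr (N - 1) * Psi p (height q x) (q x)) (at x within {0..r})"
        using x p by (intro primitive_deriv q) auto
      moreover have "at x within {0..r} = at x" by (rule at_within_interior) (use x in auto)
      ultimately have pd: "(primitive p q has_real_derivative x powr (N - 1) * Psi p (height q x) (q x)) (at x)" by simp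
      have xN: "x powr N = x powr (N - 1) * x" using x by (simp add: powr_diff)
      have dp: "((\<lambda>r. r powr N) has_real_derivative N * x powr (N - 1)) (at x)"
        using x by (auto intro!: derivative_eq_intros)
      define A where "A = Psi p (height q x) (q x)"
      have "(A - N * q x) / x * (x powr (N - 1) * x) = (A - N * q x) * x powr (N - 1)" using x by simp
      then have "N * x powr (N - 1) * q x + (A - N * q x) / x * x powr N - x powr (N - 1) * A = 0"
        unfolding xN by (simp add: algebra_simps)
      moreover have "((\<lambda>r. r powr N * q r - primitive p q r) has_real_derivative
        N * x powr (N - 1) * q x + (A - N * q x) / x * x powr N - x powr (N - 1) * A) (at x)"
        using DERIV_diff[OF DERIV_mult[OF dp ode[OF x(1)]] pd] by (simp only: A_def)
      ultimately show "((\<lambda>r. r powr N * q r - primitive p q r) has_real_derivative 0) (at x)" by simp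
    qed
    then have "r powr N * q r = r powr N * picard p q r"
      using picard_primitive[OF _ q r, of p] p N_ge by (simp add: primitive_def)
    then show ?thesis using r by simp
  qed
  show "q r = picard p q r" if r: "r \<ge> 0" for r
  proof (cases "r = 0")
    case True
    have lim: "(f \<longlongrightarrow> f 0) (at_right 0)" if "continuous_on {0..} f" for f :: "real \<Rightarrow> real"
      using continuous_on_subset[OF that, of "{0..1}"] by (intro continuous_on_Icc_at_rightD[of 0 1]) auto
    have "((\<lambda>r. picard p q r - q r) \<longlongrightarrow> picard p q 0 - q 0) (at_right 0)"
      using p by (intro tendsto_diff lim picard_cont q) auto
    moreover have "\<forall>\<^sub>F r in at_right 0. picard p q r - q r = 0"
      using pos by (auto simp: eventually_at_filter)
    ultimately have "((\<lambda>r. 0) \<longlongrightarrow> picard p q 0 - q 0) (at_right (0::real))"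
      by (subst (asm) tendsto_cong)
    then have "picard p q 0 - q 0 = 0" by (simp add: tendsto_const_iff)
    then show ?thesis using True by simp
  qed (use pos r in auto)
qed

end


section \<open>Profiles as orbits of the autonomous system\<close>


lemma at_right_0_of_continuous:
  fixes f :: "real \<Rightarrow> real" assumes "continuous_on {0..} f" shows "(f \<longlongrightarrow> f 0) (at_right 0)"
  using continuous_on_subset[OF assms, of "{0..1}"] by (intro continuous_on_Icc_at_rightD[of 0 1]) auto

lemma filterlim_exp_at_right_0: "filterlim exp (at_right (0::real)) at_bot"
  by (auto simp: filterlim_at intro: exp_at_bot)

context pucci_ode begin

lemma k_alt: "k z = kap * z - (kap - 1) * max 0 (z - (n - 1))"
proof (cases "z \<le> n - 1")
  case True
  then show ?thesis by (simp add: k_lower)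
next
  case False
  then show ?thesis using N_eq by (simp add: k_upper algebra_simps)
qed

text \<open>The origin of \<open>k\<close>: it is \<open>Psi\<close> divided by \<open>q\<close>,
  written as a function of \<open>z = v^p / q\<close>.\<close>

lemma Psi_k: assumes "q > 0" shows "Psi p v q = q * k (nl p v / q)"
proof -
  have "max 0 (nl p v - (n - 1) * q) = max (q * 0) (q * (nl p v / q - (n - 1)))"
    using assms by (simp add: algebra_simps)
  also have "\<dots> = q * max 0 (nl p v / q - (n - 1))"
    using assms by (simp add: max_mult_distrib_left)
  finally show ?thesis using assms by (simp add: Psi_def k_alt algebra_simps)
qed

lemma qs_deriv:
  assumes p: "p \<ge> 1" and r: "r > 0"
  shows "(qs p has_real_derivative (Psi p (vs p r) (qs p r) - N * qs p r) / r) (at r)"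
proof -
  have eq: "qs p s = s powr (- N) * primitive p (qs p) s" if s: "s > 0" for s
    using picard_primitive[OF _ qs_cont[OF p] s, of p] p qs_fix[OF p, of s] s by (simp add: powr_minus field_simps)
  have "(primitive p (qs p) has_real_derivative r powr (N - 1) * Psi p (vs p r) (qs p r)) (at r within {0..r + 1})"
    unfolding vs_def using r p by (intro primitive_deriv qs_cont) auto
  moreover have "at r within {0..r + 1} = at r" by (rule at_within_interior) (use r in auto)
  ultimately have pd: "(primitive p (qs p) has_real_derivative r powr (N - 1) * Psi p (vs p r) (qs p r)) (at r)" by simp
  have dp: "((\<lambda>r. r powr (- N)) has_real_derivative (- N) * r powr (- N - 1)) (at r)"
    using r by (auto intro!: derivative_eq_intros)
  have "((\<lambda>s. s powr (- N) * primitive p (qs p) s) has_real_derivative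
    (- N) * r powr (- N - 1) * primitive p (qs p) r + r powr (N - 1) * Psi p (vs p r) (qs p r) * r powr (- N)) (at r)"
    by (rule DERIV_mult[OF dp pd])
  moreover have "(- N) * r powr (- N - 1) * primitive p (qs p) r + r powr (N - 1) * Psi p (vs p r) (qs p r) * r powr (- N)
    = (Psi p (vs p r) (qs p r) - N * qs p r) / r"
  proof -
    have h1: "r powr (N - 1) * r powr (- N) = 1 / r" and h2: "r powr (- N - 1) = r powr (- N) / r"
      using r by (simp_all add: powr_add[symmetric] powr_diff powr_minus_divide)
    have "(- N) * r powr (- N - 1) * primitive p (qs p) r + r powr (N - 1) * Psi p (vs p r) (qs p r) * r powr (- N)
      = Psi p (vs p r) (qs p r) * (r powr (N - 1) * r powr (- N)) - N * (r powr (- N) * primitive p (qs p) r) / r"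
      unfolding h2 by (simp add: algebra_simps)
    also have "\<dots> = Psi p (vs p r) (qs p r) * (1 / r) - N * qs p r / r" by (simp only: h1 eq[OF r, symmetric])
    finally show ?thesis by (simp add: diff_divide_distrib)
  qed
  ultimately have "((\<lambda>s. s powr (- N) * primitive p (qs p) s) has_real_derivative (Psi p (vs p r) (qs p r) - N * qs p r) / r) (at r)" by simp
  then show ?thesis
    by (rule has_field_derivative_transform_within_open[of _ _ _ "{0<..}"]) (use r eq in auto)
qed

text \<open>At \<open>r = 0\<close> the equation reduces to \<open>N q = Psi\<close>, and only the
  branch \<open>(n - 1) q \<le> 1\<close> of the piecewise linear \<open>Psi\<close> admits a
  solution.\<close>

lemma qs_0: assumes p: "p \<ge> 1" shows "qs p 0 = 1 / n"
proof -
  define q where "q = qs p 0"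
  have q: "q \<ge> 0" using qs_nonneg[OF p] by (simp add: q_def)
  have NN: "((\<lambda>s. s powr (N - 1)) has_integral 1 / N) {0..1}" using N_ge by (intro integral_powr_01) auto
  have "q = picard p (qs p) 0" using qs_fix[OF p, of 0] by (simp add: q_def)
  also have "\<dots> = integral {0..1} (\<lambda>s. s powr (N - 1) * Psi p 1 q)" by (simp add: picard_def q_def height_def)
  also have "\<dots> = 1 / N * Psi p 1 q" by (rule integral_unique[OF has_integral_mult_left[OF NN]])
  finally have "N * q = Psi p 1 q" using N_ge by (simp add: field_simps)
  moreover have "nl p 1 = 1" by (simp add: nl_def)
  ultimately have e: "N * q = kap - (kap - 1) * max 0 (1 - (n - 1) * q)" using q by (simp add: Psi_def)
  show ?thesis
  proof (cases "(n - 1) * q \<le> 1")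
    case True
    then have "N * q = kap - (kap - 1) * (1 - (n - 1) * q)" using e by simp
    then have "n * q = 1" by (simp add: N_def algebra_simps)
    then show ?thesis using n_gt by (simp add: q_def field_simps)
  next
    case False
    then have "N * q = kap" using e by simp
    then have "kap * ((n - 1) * q - 1) = - q" by (simp add: N_def algebra_simps)
    moreover have "kap * ((n - 1) * q - 1) > 0" using False kap_ge by (intro mult_pos_pos) auto
    ultimately show ?thesis using q by simp
  qed
qed

text \<open>\<open>r powr N * q\<close> does not decrease because \<open>Psi \<ge> 0\<close>, and
  \<open>q\<close> is positive near 0.\<close>

lemma qs_pos: assumes p: "p \<ge> 1" and r: "r \<ge> 0" shows "qs p r > 0"
proof (cases "r = 0")
  case False
  then have r: "r > 0" using r by simp
  have "\<forall>\<^sub>F s in at_right 0. qs p s > 0"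
    using at_right_0_of_continuous[OF qs_cont[OF p]] by (rule order_tendstoD) (use qs_0[OF p] n_gt in simp)
  then obtain b where b: "b > 0" "\<And>s. 0 < s \<Longrightarrow> s < b \<Longrightarrow> qs p s > 0" by (auto simp: eventually_at_right_field)
  define s where "s = min (b / 2) r"
  have s: "0 < s" "s \<le> r" "qs p s > 0" using b r by (auto simp: s_def)
  have "s powr N * qs p s \<le> r powr N * qs p r"
  proof (rule DERIV_nonneg_imp_nondecreasing[OF s(2)])
    fix u assume u: "s \<le> u" "u \<le> r"
    then have u0: "u > 0" using s by simp
    have dp: "((\<lambda>r. r powr N) has_real_derivative N * u powr (N - 1)) (at u)"
      using u0 by (auto intro!: derivative_eq_intros)
    have "N * u powr (N - 1) * qs p u + (Psi p (vs p u) (qs p u) - N * qs p u) / u * u powr N = u powr (N - 1) * Psi p (vs p u) (qs p u)"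
    proof -
      have "u powr N = u powr (N - 1) * u" using u0 by (simp add: powr_diff)
      then show ?thesis using u0 by (simp add: field_simps)
    qed
    moreover have "0 \<le> u powr (N - 1) * Psi p (vs p u) (qs p u)" using Psi_bounds(1)[of p] p by simp
    ultimately show "\<exists>y. ((\<lambda>r. r powr N * qs p r) has_real_derivative y) (at u) \<and> 0 \<le> y"
      using DERIV_mult[OF dp qs_deriv[OF p u0]] by metis
  qed
  moreover have "0 < s powr N * qs p s" using s by simp
  ultimately have "0 < r powr N * qs p r" by linarith
  then show ?thesis using r by (simp add: zero_less_mult_iff)
qed (use qs_0[OF p] n_gt in simp)

lemma vs_less: assumes p: "p \<ge> 1" and r: "0 \<le> r" "r < s" shows "vs p s < vs p r"
proof (rule DERIV_neg_imp_decreasing_open[OF r(2)])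
  show "continuous_on {r..s} (vs p)" by (rule continuous_on_subset[OF vs_cont[OF p]]) (use r in auto)
  fix u assume u: "r < u" "u < s"
  then show "\<exists>y. (vs p has_real_derivative y) (at u) \<and> y < 0"
    using vs_deriv[OF p, of u] qs_pos[OF p, of u] r by (intro exI[of _ "- (u * qs p u)"]) auto
qed

lemma vs_le_1: "p \<ge> 1 \<Longrightarrow> r \<ge> 0 \<Longrightarrow> vs p r \<le> 1"
  using vs_less[of p 0 r] vs_0[of p] by (cases "r = 0") auto

lemma nl_eq: "0 < v \<Longrightarrow> v \<le> 1 \<Longrightarrow> nl p v = v powr p" by (simp add: nl_def)

definition "Is p = {t. vs p (exp t) > 0}"
definition "xs p t = (exp t)\<^sup>2 * qs p (exp t) / vs p (exp t)"
definition "zs p t = nl p (vs p (exp t)) / qs p (exp t)"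

lemma vs_exp_deriv:
  assumes p: "p \<ge> 1" shows "((\<lambda>t. vs p (exp t)) has_real_derivative - ((exp t)\<^sup>2 * qs p (exp t))) (at t)"
proof -
  have eq: "- (exp t * qs p (exp t)) * exp t = - ((exp t)\<^sup>2 * qs p (exp t))" by (simp add: power2_eq_square)
  show ?thesis using DERIV_chain2[OF vs_deriv[OF p exp_gt_zero] DERIV_exp, of t] unfolding eq .
qed

lemma qs_exp_deriv:
  assumes p: "p \<ge> 1"
  shows "((\<lambda>t. qs p (exp t)) has_real_derivative qs p (exp t) * (k (zs p t) - N)) (at t)"
proof -
  have "(Psi p (vs p (exp t)) (qs p (exp t)) - N * qs p (exp t)) / exp t * exp t = qs p (exp t) * (k (zs p t) - N)"
  proof -
    have P: "Psi p (vs p (exp t)) (qs p (exp t)) = qs p (exp t) * k (zs p t)"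
      using qs_pos[OF p, of "exp t"] by (simp add: Psi_k zs_def)
    have "A / exp t * exp t = A" for A by simp
    then show ?thesis unfolding P by (simp only: right_diff_distrib mult.commute)
  qed
  from DERIV_chain2[OF qs_deriv[OF p exp_gt_zero] DERIV_exp, of t, unfolded this] show ?thesis .
qed

lemma Is_open: assumes p: "p \<ge> 1" shows "open (Is p)"
proof -
  have "continuous_on UNIV (\<lambda>t. vs p (exp t))"
    using DERIV_isCont[OF vs_exp_deriv[OF p]] by (intro continuous_at_imp_continuous_on) auto
  then show ?thesis unfolding Is_def by (intro open_Collect_less continuous_intros)
qed

lemma xs_deriv:
  assumes p: "p \<ge> 1" and t: "t \<in> Is p"
  shows "(xs p has_real_derivative xs p t * m (xs p t) (zs p t)) (at t)"
proof -
  define v where "v = vs p (exp t)" define q where "q = qs p (exp t)"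
  have v: "v > 0" using t by (simp add: Is_def v_def)
  have e: "((\<lambda>t. (exp t)\<^sup>2) has_real_derivative 2 * (exp t)\<^sup>2) (at t)"
    by (auto intro!: derivative_eq_intros simp: power2_eq_square)
  have "(xs p has_real_derivative
    ((2 * (exp t)\<^sup>2 * q + q * (k (zs p t) - N) * (exp t)\<^sup>2) * v - (exp t)\<^sup>2 * q * (- ((exp t)\<^sup>2 * q))) / (v * v)) (at t)"
    unfolding xs_def[abs_def] using DERIV_divide[OF DERIV_mult[OF e qs_exp_deriv[OF p]] vs_exp_deriv[OF p]] v
    by (simp add: v_def q_def)
  moreover have "((2 * (exp t)\<^sup>2 * q + q * (k (zs p t) - N) * (exp t)\<^sup>2) * v - (exp t)\<^sup>2 * q * (- ((exp t)\<^sup>2 * q))) / (v * v)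
    = xs p t * m (xs p t) (zs p t)"
    unfolding xs_def m_def v_def[symmetric] q_def[symmetric] using v by (simp add: field_simps)
  ultimately show ?thesis by simp
qed

lemma zs_deriv:
  assumes p: "p \<ge> 1" and t: "t \<in> Is p"
  shows "(zs p has_real_derivative zs p t * (N - p * xs p t - k (zs p t))) (at t)"
proof -
  define v where "v = vs p (exp t)" define q where "q = qs p (exp t)"
  have v: "v > 0" using t by (simp add: Is_def v_def)
  have v1: "v \<le> 1" unfolding v_def by (rule vs_le_1[OF p]) simp
  have q: "q > 0" unfolding q_def using qs_pos[OF p, of "exp t"] by simp
  have vd: "((\<lambda>t. vs p (exp t) powr p) has_real_derivative p * v powr (p - 1) * (- ((exp t)\<^sup>2 * q))) (at t)"
    using DERIV_fun_powr[OF vs_exp_deriv[OF p], of t p] v by (simp add: v_def q_def)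
  have "((\<lambda>t. vs p (exp t) powr p / qs p (exp t)) has_real_derivative
    (p * v powr (p - 1) * (- ((exp t)\<^sup>2 * q)) * q - v powr p * (q * (k (zs p t) - N))) / (q * q)) (at t)"
    using DERIV_divide[OF vd qs_exp_deriv[OF p]] q by (simp add: v_def q_def)
  moreover have "(p * v powr (p - 1) * (- ((exp t)\<^sup>2 * q)) * q - v powr p * (q * (k (zs p t) - N))) / (q * q)
    = zs p t * (N - p * xs p t - k (zs p t))"
  proof -
    have z: "zs p t = v powr p / q" using nl_eq[OF v v1] by (simp add: zs_def v_def q_def)
    have x: "xs p t = (exp t)\<^sup>2 * q / v" by (simp add: xs_def v_def q_def)
    have "v powr (p - 1) = v powr p / v" using v by (simp add: powr_diff)
    moreover define K where "K = k (zs p t)"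
    ultimately show ?thesis unfolding K_def[symmetric] unfolding z x using v q by (simp add: field_simps)
  qed
  ultimately have "((\<lambda>t. vs p (exp t) powr p / qs p (exp t)) has_real_derivative zs p t * (N - p * xs p t - k (zs p t))) (at t)" by simp
  then show ?thesis
  proof (rule has_field_derivative_transform_within_open[OF _ Is_open[OF p] t])
    show "vs p (exp s) powr p / qs p (exp s) = zs p s" if "s \<in> Is p" for s
      using that nl_eq[of "vs p (exp s)" p] vs_le_1[OF p, of "exp s"] by (simp add: zs_def Is_def)
  qed
qed

text \<open>Two applications of l'Hospital's rule give \<open>1 - v^p\<close> and
  \<open>1 / n - q\<close> to order \<open>r^2\<close>, with coefficients \<open>p / (2 n)\<close>
  and \<open>p / (2 n (n + 2))\<close>. Both \<open>n - z\<close> and \<open>x\<close> are of that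
  order.\<close>

lemma xs_zs_limits:
  assumes p: "p \<ge> 1"
  shows "(xs p \<longlongrightarrow> 0) at_bot" "((\<lambda>t. (n - zs p t) / xs p t) \<longlongrightarrow> n * p / (n + 2)) at_bot" "\<forall>\<^sub>F t in at_bot. t \<in> Is p"
proof -
  have q: "(qs p \<longlongrightarrow> 1 / n) (at_right 0)" using at_right_0_of_continuous[OF qs_cont[OF p]] qs_0[OF p] by simp
  have v: "(vs p \<longlongrightarrow> 1) (at_right 0)" using at_right_0_of_continuous[OF vs_cont[OF p]] vs_0 by simp
  have id: "((\<lambda>r. r) \<longlongrightarrow> 0) (at_right (0::real))" by (rule tendsto_ident_at)
  have vpos: "\<forall>\<^sub>F r in at_right 0. vs p r > 0" using v by (rule order_tendstoD) simp
  have pos: "\<forall>\<^sub>F r in at_right 0. r > (0::real)" by (simp add: eventually_at_filter)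
  define f where "f r = nl p (vs p r)" for r
  have fc: "continuous_on {0..} f" unfolding f_def using p by (intro nl_cont vs_cont) auto
  have f: "(f \<longlongrightarrow> 1) (at_right 0)" using at_right_0_of_continuous[OF fc] by (simp add: f_def vs_0 nl_def)
  have "((\<lambda>r. f r - (n - 1) * qs p r) \<longlongrightarrow> 1 - (n - 1) * (1 / n)) (at_right 0)" by (intro tendsto_intros f q)
  \<comment> \<open>Near \<open>r = 0\<close> the inner maximum in \<open>Psi\<close> is positive,
    so the equation is the one of dimension \<open>n\<close>:
    \<open>(r^n q)' = r^(n-1) f\<close>.\<close>
  then have inner: "\<forall>\<^sub>F r in at_right 0. f r - (n - 1) * qs p r > 0"
    by (rule order_tendstoD) (use n_gt in \<open>simp add: field_simps\<close>)
  have A: "((\<lambda>r. (1 - vs p r powr p) / r\<^sup>2) \<longlongrightarrow> p / (2 * n)) (at_right 0)"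
  proof (rule lhopital_right_0[where f' = "\<lambda>r. p * vs p r powr (p - 1) * (r * qs p r)" and g' = "\<lambda>r. 2 * r"])
    have "((\<lambda>r. 1 - vs p r powr p) \<longlongrightarrow> 1 - 1 powr p) (at_right 0)" by (intro tendsto_intros v) auto
    then show "((\<lambda>r. 1 - vs p r powr p) \<longlongrightarrow> 0) (at_right 0)" by simp
    have "((\<lambda>r::real. r\<^sup>2) \<longlongrightarrow> 0\<^sup>2) (at_right 0)" by (intro tendsto_intros)
    then show "((\<lambda>r::real. r\<^sup>2) \<longlongrightarrow> 0) (at_right 0)" by simp
    show "\<forall>\<^sub>F r in at_right 0. r\<^sup>2 \<noteq> (0::real)" using pos by eventually_elim simp
    show "\<forall>\<^sub>F r in at_right 0. 2 * r \<noteq> (0::real)" using pos by eventually_elim simp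
    show "\<forall>\<^sub>F r in at_right 0. ((\<lambda>r. 1 - vs p r powr p) has_real_derivative p * vs p r powr (p - 1) * (r * qs p r)) (at r)"
      using pos vpos
    proof eventually_elim
      case (elim r)
      have "((\<lambda>r. vs p r powr p) has_real_derivative p * vs p r powr (p - 1) * (- (r * qs p r))) (at r)"
        using DERIV_fun_powr[OF vs_deriv[OF p elim(1)] elim(2), of p] by simp
      from DERIV_diff[OF DERIV_const this, of 1] show ?case by simp
    qed
    show "\<forall>\<^sub>F r in at_right 0. ((\<lambda>r. r\<^sup>2) has_real_derivative 2 * r) (at (r::real))"
      by (auto intro!: always_eventually derivative_eq_intros)
    have "((\<lambda>r. p * vs p r powr (p - 1) * qs p r / 2) \<longlongrightarrow> p * 1 powr (p - 1) * (1 / n) / 2) (at_right 0)"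
      by (intro tendsto_intros v q) auto
    then have "((\<lambda>r. p * vs p r powr (p - 1) * qs p r / 2) \<longlongrightarrow> p / (2 * n)) (at_right 0)" by (simp add: mult.commute)
    then show "((\<lambda>r. p * vs p r powr (p - 1) * (r * qs p r) / (2 * r)) \<longlongrightarrow> p / (2 * n)) (at_right 0)"
      by (rule Lim_transform_eventually) (use pos in \<open>eventually_elim, simp\<close>)
  qed
  have fv: "\<forall>\<^sub>F r in at_right 0. f r = vs p r powr p"
    using pos vpos by eventually_elim (use vs_le_1[OF p] in \<open>simp add: f_def nl_eq\<close>)
  have A': "((\<lambda>r. (1 - f r) / r\<^sup>2) \<longlongrightarrow> p / (2 * n)) (at_right 0)"
    by (rule Lim_transform_eventually[OF A]) (use fv in \<open>eventually_elim, simp\<close>)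
  have B: "((\<lambda>r. (r powr n / n - r powr n * qs p r) / r powr (n + 2)) \<longlongrightarrow> p / (2 * n) / (n + 2)) (at_right 0)"
  proof (rule lhopital_right_0[where f' = "\<lambda>r. r powr (n - 1) * (1 - f r)" and g' = "\<lambda>r. (n + 2) * r powr (n + 1)"])
    have z: "((\<lambda>r. r powr c) \<longlongrightarrow> 0) (at_right (0::real))" if "c > 0" for c :: real
      by (rule tendsto_zero_powrI[OF id tendsto_const]) (use that pos in \<open>auto elim: eventually_mono\<close>)
    have "((\<lambda>r. r powr n / n - r powr n * qs p r) \<longlongrightarrow> 0 / n - 0 * (1 / n)) (at_right 0)"
      using n_gt by (intro tendsto_intros z q) auto
    then show "((\<lambda>r. r powr n / n - r powr n * qs p r) \<longlongrightarrow> 0) (at_right 0)" by simp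
    show "((\<lambda>r. r powr (n + 2)) \<longlongrightarrow> 0) (at_right (0::real))" using n_gt by (intro z) auto
    show "\<forall>\<^sub>F r in at_right 0. r powr (n + 2) \<noteq> (0::real)" using pos by eventually_elim simp
    show "\<forall>\<^sub>F r in at_right 0. (n + 2) * r powr (n + 1) \<noteq> (0::real)" using pos by eventually_elim (use n_gt in simp)
    show "\<forall>\<^sub>F r in at_right 0. ((\<lambda>r. r powr n / n - r powr n * qs p r) has_real_derivative r powr (n - 1) * (1 - f r)) (at r)"
      using pos inner
    proof eventually_elim
      case (elim r)
      have Psi: "Psi p (vs p r) (qs p r) = f r + (N - n) * qs p r"
        using elim qs_nonneg[OF p, of r] unfolding N_eq by (simp add: Psi_def f_def algebra_simps)
      have dp: "((\<lambda>r. r powr n) has_real_derivative n * r powr (n - 1)) (at r)"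
        using elim by (auto intro!: derivative_eq_intros)
      have rn: "r powr n = r powr (n - 1) * r" using elim by (simp add: powr_diff)
      have "((\<lambda>r. r powr n / n - r powr n * qs p r) has_real_derivative
        n * r powr (n - 1) / n - (n * r powr (n - 1) * qs p r + (Psi p (vs p r) (qs p r) - N * qs p r) / r * r powr n)) (at r)"
        by (intro DERIV_diff DERIV_cdivide DERIV_mult dp qs_deriv p elim)
      moreover have "n * r powr (n - 1) / n - (n * r powr (n - 1) * qs p r + (Psi p (vs p r) (qs p r) - N * qs p r) / r * r powr n)
        = r powr (n - 1) * (1 - f r)"
        unfolding Psi rn using elim n_gt by (simp add: field_simps)
      ultimately show ?case by simp
    qed
    show "\<forall>\<^sub>F r in at_right 0. ((\<lambda>r. r powr (n + 2)) has_real_derivative (n + 2) * r powr (n + 1)) (at r)"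
      using pos by eventually_elim (auto intro!: derivative_eq_intros simp: algebra_simps)
    have "((\<lambda>r. (1 - f r) / r\<^sup>2 / (n + 2)) \<longlongrightarrow> p / (2 * n) / (n + 2)) (at_right 0)"
      using n_gt by (intro tendsto_intros A') auto
    then show "((\<lambda>r. r powr (n - 1) * (1 - f r) / ((n + 2) * r powr (n + 1))) \<longlongrightarrow> p / (2 * n) / (n + 2)) (at_right 0)"
    proof (rule Lim_transform_eventually)
      show "\<forall>\<^sub>F r in at_right 0. (1 - f r) / r\<^sup>2 / (n + 2) = r powr (n - 1) * (1 - f r) / ((n + 2) * r powr (n + 1))"
        using pos
      proof eventually_elim
        case (elim r)
        have "r powr (n + 1) = r powr (n - 1) * r powr 2" by (simp add: powr_add[symmetric] add.commute)
        also have "r powr 2 = r\<^sup>2" using elim by simp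
        finally show ?case using elim by simp
      qed
    qed
  qed
  have B': "((\<lambda>r. (1 / n - qs p r) / r\<^sup>2) \<longlongrightarrow> p / (2 * n) / (n + 2)) (at_right 0)"
  proof (rule Lim_transform_eventually[OF B])
    show "\<forall>\<^sub>F r in at_right 0. (r powr n / n - r powr n * qs p r) / r powr (n + 2) = (1 / n - qs p r) / r\<^sup>2"
      using pos
    proof eventually_elim
      case (elim r)
      have "r powr (n + 2) = r powr n * r\<^sup>2" using elim by (simp add: powr_add)
      moreover have "r powr n / n - r powr n * qs p r = r powr n * (1 / n - qs p r)" by (simp add: algebra_simps)
      ultimately show ?case using elim by simp
    qed
  qed
  have C: "((\<lambda>r. ((1 - f r) / r\<^sup>2 - n * ((1 / n - qs p r) / r\<^sup>2)) * vs p r / (qs p r * qs p r)) \<longlongrightarrow>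
    (p / (2 * n) - n * (p / (2 * n) / (n + 2))) * 1 / (1 / n * (1 / n))) (at_right 0)"
    using n_gt by (intro tendsto_intros A' B' v q) auto
  have eC: "(p / (2 * n) - n * (p / (2 * n) / (n + 2))) * 1 / (1 / n * (1 / n)) = n * p / (n + 2)"
  proof -
    have "p / (2 * n) - n * (p / (2 * n) / (n + 2)) = p / (2 * n) * (1 - n / (n + 2))" by (simp add: right_diff_distrib)
    also have "1 - n / (n + 2) = 2 / (n + 2)" using n_gt by (simp add: field_simps)
    finally have *: "p / (2 * n) - n * (p / (2 * n) / (n + 2)) = p / (2 * n) * (2 / (n + 2))" .
    show ?thesis unfolding * using n_gt by simp
  qed
  have D: "((\<lambda>r. (n - f r / qs p r) / (r\<^sup>2 * qs p r / vs p r)) \<longlongrightarrow> n * p / (n + 2)) (at_right 0)"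
  proof (rule Lim_transform_eventually[OF C[unfolded eC]])
    show "\<forall>\<^sub>F r in at_right 0. ((1 - f r) / r\<^sup>2 - n * ((1 / n - qs p r) / r\<^sup>2)) * vs p r / (qs p r * qs p r) =
      (n - f r / qs p r) / (r\<^sup>2 * qs p r / vs p r)"
      using pos vpos
    proof eventually_elim
      case (elim r)
      have "qs p r > 0" using qs_pos[OF p] elim by simp
      moreover have "(1 - f r) / r\<^sup>2 - n * ((1 / n - qs p r) / r\<^sup>2) = (n * qs p r - f r) / r\<^sup>2"
        using n_gt by (simp add: diff_divide_distrib[symmetric] right_diff_distrib)
      ultimately show ?case using elim by (simp add: divide_simps)
    qed
  qed
  show "((\<lambda>t. (n - zs p t) / xs p t) \<longlongrightarrow> n * p / (n + 2)) at_bot"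
    unfolding zs_def xs_def using filterlim_compose[OF D filterlim_exp_at_right_0] by (simp add: f_def)
  have "((\<lambda>r. r\<^sup>2 * qs p r / vs p r) \<longlongrightarrow> 0\<^sup>2 * (1 / n) / 1) (at_right 0)" by (intro tendsto_intros q v id) auto
  then show "(xs p \<longlongrightarrow> 0) at_bot" using filterlim_compose[OF _ filterlim_exp_at_right_0] by (fastforce simp: xs_def[abs_def])
  show "\<forall>\<^sub>F t in at_bot. t \<in> Is p"
    using filterlim_exp_at_right_0 vpos unfolding filterlim_iff Is_def by auto
qed

text \<open>At the zero \<open>R\<close> of \<open>v\<close> the numerator \<open>r^2 q\<close> of
  \<open>x\<close> has a positive limit, so \<open>x\<close> cannot stay bounded.\<close>

lemma xs_maximal:
  assumes p: "p \<ge> 1" shows "Is p = UNIV \<or> (\<forall>B. \<exists>t\<in>Is p. xs p t > B)"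
proof (rule disjCI)
  assume "\<not> (\<forall>B. \<exists>t\<in>Is p. xs p t > B)"
  then obtain B where B: "\<And>t. t \<in> Is p \<Longrightarrow> xs p t \<le> B" by (auto simp: not_less)
  show "Is p = UNIV"
  proof (rule ccontr)
    assume "Is p \<noteq> UNIV"
    then obtain t0 where "t0 \<notin> Is p" by auto
    then have v0: "vs p (exp t0) \<le> 0" by (simp add: Is_def)
    have "\<exists>R. 0 \<le> R \<and> R \<le> exp t0 \<and> vs p R = 0"
      by (rule IVT2') (use v0 vs_0 in \<open>auto intro: continuous_on_subset[OF vs_cont[OF p]]\<close>)
    then obtain R where R: "0 \<le> R" "vs p R = 0" by auto
    have Rp: "R > 0" using R vs_0[of p] by (cases "R = 0") auto
    have vd: "(vs p \<longlongrightarrow> 0) (at_left R)"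
      using DERIV_isCont[OF vs_deriv[OF p Rp]] R by (simp add: isCont_def filterlim_at_split)
    have qd: "(qs p \<longlongrightarrow> qs p R) (at_left R)"
      using DERIV_isCont[OF qs_deriv[OF p Rp]] by (simp add: isCont_def filterlim_at_split)
    have ev: "\<forall>\<^sub>F r in at_left R. r\<^sup>2 * qs p r \<le> B * vs p r"
    proof -
      have "r\<^sup>2 * qs p r \<le> B * vs p r" if r: "0 < r" "r < R" for r
      proof -
        have v: "vs p r > 0" using vs_less[OF p _ r(2)] r R by simp
        then have "xs p (ln r) \<le> B" using r by (intro B) (simp add: Is_def)
        then show ?thesis using r v by (simp add: xs_def field_simps)
      qed
      then show ?thesis using Rp by (auto simp: eventually_at_left intro!: exI[of _ 0])
    qed
    have "R\<^sup>2 * qs p R \<le> B * 0"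
    proof (rule tendsto_le[OF _ _ _ ev])
      show "((\<lambda>r. r\<^sup>2 * qs p r) \<longlongrightarrow> R\<^sup>2 * qs p R) (at_left R)" by (intro tendsto_intros qd)
      show "((\<lambda>r. B * vs p r) \<longlongrightarrow> B * 0) (at_left R)" by (intro tendsto_intros vd)
    qed simp
    then show False using qs_pos[OF p R(1)] Rp by (simp add: mult_le_0_iff)
  qed
qed

lemma orbit_profile: assumes p: "p > 1" shows "orbit n kap p (Is p) (xs p) (zs p)"
proof -
  have p1: "p \<ge> 1" using p by simp
  show ?thesis
  proof (unfold_locales)
    show "open (Is p)" by (rule Is_open[OF p1])
    show "Is p \<noteq> {}" using xs_zs_limits(3)[OF p1] by (auto simp: eventually_at_bot_linorder)
    show "s \<in> Is p" if "t \<in> Is p" "s \<le> t" for s t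
      using that vs_less[OF p1, of "exp s" "exp t"] by (cases "s = t") (auto simp: Is_def)
    show "0 < xs p t" if "t \<in> Is p" for t
      using that qs_pos[OF p1, of "exp t"] by (auto simp: xs_def Is_def)
    show "0 < zs p t" if "t \<in> Is p" for t
      using that qs_pos[OF p1, of "exp t"] vs_le_1[OF p1, of "exp t"] by (auto simp: zs_def Is_def nl_eq)
  qed (use p xs_deriv[OF p1] zs_deriv[OF p1] xs_zs_limits[OF p1] xs_maximal[OF p1] in auto)
qed

end


section \<open>The critical exponent\<close>


text \<open>Joint continuity in exponent and radius, for the compactness argument in
  \<open>cr_open\<close>.\<close>

lemma continuous_on_prod_lipschitz_fst:
  fixes f :: "real \<Rightarrow> real \<Rightarrow> real"
  assumes lip: "\<And>p p' r. p \<in> A \<Longrightarrow> p' \<in> A \<Longrightarrow> r \<in> B \<Longrightarrow> \<bar>f p r - f p' r\<bar> \<le> C * \<bar>p - p'\<bar>"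
    and cont: "\<And>p. p \<in> A \<Longrightarrow> continuous_on B (f p)"
  shows "continuous_on (A \<times> B) (\<lambda>x. f (fst x) (snd x))"
  unfolding continuous_on_def
proof (intro ballI)
  fix x assume x: "x \<in> A \<times> B"
  define p0 where "p0 = fst x" define r0 where "r0 = snd x"
  have pr: "p0 \<in> A" "r0 \<in> B" using x by (auto simp: p0_def r0_def)
  have 1: "((\<lambda>y. f p0 (snd y)) \<longlongrightarrow> f p0 r0) (at x within A \<times> B)"
  proof -
    have "continuous_on (A \<times> B) (\<lambda>y. f p0 (snd y))"
      by (rule continuous_on_compose2[OF cont[OF pr(1)]]) (auto intro!: continuous_intros)
    then show ?thesis using x by (auto simp: continuous_on_def r0_def)
  qed
  have "((\<lambda>y. C * \<bar>fst y - p0\<bar>) \<longlongrightarrow> C * \<bar>fst x - p0\<bar>) (at x within A \<times> B)" by (intro tendsto_intros)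
  then have 2: "((\<lambda>y. C * \<bar>fst y - p0\<bar>) \<longlongrightarrow> 0) (at x within A \<times> B)" by (simp add: p0_def)
  have "((\<lambda>y. f (fst y) (snd y) - f p0 (snd y)) \<longlongrightarrow> 0) (at x within A \<times> B)"
  proof (rule Lim_null_comparison[OF _ 2])
    show "\<forall>\<^sub>F y in at x within A \<times> B. norm (f (fst y) (snd y) - f p0 (snd y)) \<le> C * \<bar>fst y - p0\<bar>"
    proof -
      have "norm (f (fst y) (snd y) - f p0 (snd y)) \<le> C * \<bar>fst y - p0\<bar>" if "y \<in> A \<times> B" for y
        using lip[of "fst y" p0 "snd y"] that pr by auto
      then show ?thesis unfolding eventually_at_filter by (intro always_eventually) auto
    qed
  qed
  from tendsto_add[OF this 1] show "((\<lambda>x. f (fst x) (snd x)) \<longlongrightarrow> f (fst x) (snd x)) (at x within A \<times> B)"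
    by (simp add: p0_def r0_def)
qed

context pucci_ode begin

definition "lipC P R = (2 * kap - 1) / N / (1 - thet) * exp (rateL P * R\<^sup>2)"

lemma lipC_nonneg: "lipC P R \<ge> 0"
  using kap_ge N_ge thet by (simp add: lipC_def)

lemma qs_lipschitz_p:
  assumes "1 \<le> p" "p \<le> P" "1 \<le> p'" "p' \<le> P" "0 \<le> r" "r \<le> R"
  shows "\<bar>qs p r - qs p' r\<bar> \<le> lipC P R * \<bar>p - p'\<bar>"
proof -
  have "\<bar>qs p r - qs p' r\<bar> \<le> (2 * kap - 1) / N / (1 - thet) * \<bar>p - p'\<bar> * exp (rateL P * r\<^sup>2)"
    using assms qs_fix by (intro picard_stability[where R = r]) (auto intro: continuous_on_subset[OF qs_cont])
  also have "\<dots> \<le> (2 * kap - 1) / N / (1 - thet) * \<bar>p - p'\<bar> * exp (rateL P * R\<^sup>2)"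
    using assms kap_ge N_ge thet rateL_pos[of P] by (intro mult_left_mono) (auto intro: power_mono)
  finally show ?thesis by (simp add: lipC_def mult_ac)
qed

lemma vs_lipschitz_p:
  assumes p: "1 \<le> p" "p \<le> P" "1 \<le> p'" "p' \<le> P" and r: "0 \<le> r" "r \<le> R"
  shows "\<bar>vs p r - vs p' r\<bar> \<le> R\<^sup>2 * lipC P R * \<bar>p - p'\<bar>"
proof -
  have c: "continuous_on {0..r} (\<lambda>t. t * qs p t)" if "p \<ge> 1" for p
    by (intro continuous_intros continuous_on_subset[OF qs_cont[OF that]]) auto
  have "vs p r - vs p' r = - integral {0..r} (\<lambda>t. t * qs p t - t * qs p' t)"
    unfolding vs_def height_def using p
    by (subst integral_diff) (auto intro!: integrable_continuous_interval c)
  moreover have "norm (integral {0..r} (\<lambda>t. t * qs p t - t * qs p' t)) \<le> R * lipC P R * \<bar>p - p'\<bar> * (r - 0)"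
  proof (rule integral_bound[OF r(1)])
    show "continuous_on {0..r} (\<lambda>t. t * qs p t - t * qs p' t)" by (intro continuous_on_diff c p)
    fix t assume t: "t \<in> {0..r}"
    have "norm (t * qs p t - t * qs p' t) = t * \<bar>qs p t - qs p' t\<bar>" using t by (simp add: right_diff_distrib[symmetric] abs_mult)
    also have "\<dots> \<le> R * (lipC P R * \<bar>p - p'\<bar>)" using t r p by (intro mult_mono qs_lipschitz_p) auto
    finally show "norm (t * qs p t - t * qs p' t) \<le> R * lipC P R * \<bar>p - p'\<bar>" by simp
  qed
  moreover have "R * lipC P R * \<bar>p - p'\<bar> * (r - 0) \<le> R * lipC P R * \<bar>p - p'\<bar> * R"
    using r lipC_nonneg by (intro mult_left_mono) auto
  ultimately show ?thesis by (simp add: power2_eq_square mult_ac)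
qed

lemma isCont_of_local_lipschitz:
  fixes f :: "real \<Rightarrow> real"
  assumes p: "p0 > 1" and lip: "\<And>p. 1 \<le> p \<Longrightarrow> p \<le> p0 + 1 \<Longrightarrow> \<bar>f p - f p0\<bar> \<le> C * \<bar>p - p0\<bar>"
  shows "(f \<longlongrightarrow> f p0) (at p0)"
proof -
  have "((\<lambda>p. C * \<bar>p - p0\<bar>) \<longlongrightarrow> C * \<bar>p0 - p0\<bar>) (at p0)" by (intro tendsto_intros)
  then have 2: "((\<lambda>p. C * \<bar>p - p0\<bar>) \<longlongrightarrow> 0) (at p0)" by simp
  have "((\<lambda>p. f p - f p0) \<longlongrightarrow> 0) (at p0)"
  proof (rule Lim_null_comparison[OF _ 2])
    have "\<forall>\<^sub>F p in at p0. 1 < p" "\<forall>\<^sub>F p in at p0. p < p0 + 1"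
      using p by (auto intro: order_tendstoD[OF tendsto_ident_at])
    then show "\<forall>\<^sub>F p in at p0. norm (f p - f p0) \<le> C * \<bar>p - p0\<bar>"
      by eventually_elim (use lip in auto)
  qed
  then show ?thesis by (simp add: LIM_zero_iff)
qed

lemma qs_tendsto_p: "p0 > 1 \<Longrightarrow> r \<ge> 0 \<Longrightarrow> ((\<lambda>p. qs p r) \<longlongrightarrow> qs p0 r) (at p0)"
  by (rule isCont_of_local_lipschitz[where C = "lipC (p0 + 1) r"]) (auto intro!: qs_lipschitz_p)

lemma vs_tendsto_p: "p0 > 1 \<Longrightarrow> r \<ge> 0 \<Longrightarrow> ((\<lambda>p. vs p r) \<longlongrightarrow> vs p0 r) (at p0)"
  by (rule isCont_of_local_lipschitz[where C = "r\<^sup>2 * lipC (p0 + 1) r"]) (auto intro!: vs_lipschitz_p)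

lemma profile_tendsto_p:
  assumes p: "p0 > 1" and t: "t \<in> Is p0"
  shows "\<forall>\<^sub>F p in at p0. t \<in> Is p" "((\<lambda>p. xs p t) \<longlongrightarrow> xs p0 t) (at p0)" "((\<lambda>p. zs p t) \<longlongrightarrow> zs p0 t) (at p0)"
proof -
  have v0: "vs p0 (exp t) > 0" using t by (simp add: Is_def)
  have v: "((\<lambda>p. vs p (exp t)) \<longlongrightarrow> vs p0 (exp t)) (at p0)" by (intro vs_tendsto_p p) simp
  have q: "((\<lambda>p. qs p (exp t)) \<longlongrightarrow> qs p0 (exp t)) (at p0)" by (intro qs_tendsto_p p) simp
  have q0: "qs p0 (exp t) > 0" using p by (intro qs_pos) auto
  show "\<forall>\<^sub>F p in at p0. t \<in> Is p" using order_tendstoD(1)[OF v v0] by (simp add: Is_def)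
  show "((\<lambda>p. xs p t) \<longlongrightarrow> xs p0 t) (at p0)" unfolding xs_def using v0 by (intro tendsto_intros v q) auto
  show "((\<lambda>p. zs p t) \<longlongrightarrow> zs p0 t) (at p0)" unfolding zs_def nl_def using v0 q0
    by (intro tendsto_intros v q) auto
qed

definition "cr p \<longleftrightarrow> orbit.mcross n kap (Is p) (xs p) (zs p)"

text \<open>The difficulty is to keep \<open>m > 0\<close> on the unbounded time interval up to
  \<open>T\<close>. In the radius this is the compact interval \<open>[0, R]\<close>, once
  \<open>m\<close> is extended to \<open>r = 0\<close>; the exponents that fail are then the
  projection of a compact set, which is closed.\<close>

lemma cr_open:
  assumes p0: "p0 > 1" and cr: "cr p0"
  shows "\<exists>d>0. \<forall>p. p0 < p \<and> p < p0 + d \<longrightarrow> cr p"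
proof -
  interpret o0: orbit n kap p0 "Is p0" "xs p0" "zs p0" by (rule orbit_profile[OF p0])
  obtain T where T: "T \<in> Is p0" "xs p0 T > N - 2" "\<And>t. t \<le> T \<Longrightarrow> o0.mt t > 0"
    using cr by (auto simp: cr_def o0.mcross_def)
  define R where "R = exp T"
  define P where "P = p0 + 1"
  have R: "R > 0" by (simp add: R_def)
  \<comment> \<open>\<open>m v\<close> written in the radius: it has no division by \<open>v\<close>
    and is continuous up to \<open>r = 0\<close>, where its value is 2.\<close>
  define \<mu> where "\<mu> p r = r\<^sup>2 * qs p r + (2 - N + k (nl p (vs p r) / qs p r)) * vs p r" for p r
  have mu_m: "\<mu> p (exp t) = m (xs p t) (zs p t) * vs p (exp t)" if "t \<in> Is p" for p t
    using that by (simp add: \<mu>_def m_def xs_def zs_def Is_def field_simps)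
  define S where "S = {p0..P} \<times> {0..R}"
  have cq: "continuous_on S (\<lambda>x. qs (fst x) (snd x))" unfolding S_def
    by (rule continuous_on_prod_lipschitz_fst[where C = "lipC P R"])
      (use p0 in \<open>auto intro!: qs_lipschitz_p continuous_on_subset[OF qs_cont]\<close>)
  have cv: "continuous_on S (\<lambda>x. vs (fst x) (snd x))" unfolding S_def
    by (rule continuous_on_prod_lipschitz_fst[where C = "R\<^sup>2 * lipC P R"])
      (use p0 in \<open>auto intro!: vs_lipschitz_p continuous_on_subset[OF vs_cont]\<close>)
  have cn: "continuous_on S (\<lambda>x. nl (fst x) (vs (fst x) (snd x)))"
    unfolding nl_def using p0 by (intro continuous_on_powr' continuous_intros cv) (auto simp: S_def)
  have qne: "\<forall>x\<in>S. qs (fst x) (snd x) \<noteq> 0"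
  proof
    fix x assume "x \<in> S"
    then have "qs (fst x) (snd x) > 0" using p0 by (intro qs_pos) (auto simp: S_def)
    then show "qs (fst x) (snd x) \<noteq> 0" by simp
  qed
  have cmu: "continuous_on S (\<lambda>x. \<mu> (fst x) (snd x))" unfolding \<mu>_def
    by (intro continuous_intros cq cv k_cont cn qne)
  define Bad where "Bad = S \<inter> (\<lambda>x. min (\<mu> (fst x) (snd x)) (vs (fst x) (snd x))) -` {..0}"
  have "compact S" unfolding S_def by (intro compact_Times compact_Icc)
  then have "compact Bad"
    unfolding Bad_def by (rule closedin_compact) (intro continuous_closedin_preimage continuous_intros cmu cv closed_atMost)
  then have "compact (fst ` Bad)" by (intro compact_continuous_image continuous_intros)
  then have "closed (fst ` Bad)" by (rule compact_imp_closed)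
  moreover have "p0 \<notin> fst ` Bad"
  proof
    assume "p0 \<in> fst ` Bad"
    then obtain r where r: "0 \<le> r" "r \<le> R" "\<mu> p0 r \<le> 0 \<or> vs p0 r \<le> 0" by (auto simp: Bad_def S_def min_le_iff_disj)
    have vR: "vs p0 R > 0" using T by (simp add: Is_def R_def)
    have vr: "vs p0 r > 0" using vs_less[of p0 r R] r p0 vR by (cases "r = R") auto
    show False
    proof (cases "r = 0")
      case True
      have "k n = N" using k_upper[of n] by simp
      moreover have "nl p0 1 = 1" by (simp add: nl_def)
      ultimately have "\<mu> p0 0 = 2" using p0 by (simp add: \<mu>_def vs_0 qs_0)
      then show False using r True vr by simp
    next
      case False
      then have r0: "r > 0" using r by simp
      have "ln r \<le> ln R" using r(2) r0 R by (simp only: ln_le_cancel_iff)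
      then have "ln r \<le> T" by (simp add: R_def)
      then have "o0.mt (ln r) > 0" by (rule T)
      moreover have "ln r \<in> Is p0" using vr r0 by (simp add: Is_def)
      ultimately have "\<mu> p0 r > 0" using mu_m[of "ln r" p0] vr r0 by simp
      then show False using r vr by simp
    qed
  qed
  ultimately obtain d1 where "d1 > 0" "ball p0 d1 \<subseteq> - fst ` Bad"
    by (meson ComplI open_Compl open_contains_ball)
  then have d1: "d1 > 0" "\<And>p. \<bar>p - p0\<bar> < d1 \<Longrightarrow> p \<notin> fst ` Bad"
    by (auto simp: subset_iff dist_real_def abs_minus_commute)
  have "\<forall>\<^sub>F p in at p0. xs p T > N - 2"
    by (rule order_tendstoD(1)[OF profile_tendsto_p(2)[OF p0 T(1)] T(2)])
  then obtain d2 where d2: "d2 > 0" "\<And>p. p \<noteq> p0 \<Longrightarrow> \<bar>p - p0\<bar> < d2 \<Longrightarrow> xs p T > N - 2"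
    by (auto simp: eventually_at dist_real_def)
  have "cr p" if p: "p0 < p" "p < p0 + min 1 (min d1 d2)" for p
  proof -
    have p1: "p > 1" using p p0 by simp
    interpret o: orbit n kap p "Is p" "xs p" "zs p" by (rule orbit_profile[OF p1])
    have nb: "p \<notin> fst ` Bad" using p by (intro d1) auto
    have good: "\<mu> p r > 0 \<and> vs p r > 0" if "0 \<le> r" "r \<le> R" for r
    proof (rule ccontr)
      assume "\<not> ?thesis"
      then have "(p, r) \<in> Bad" using that p by (auto simp: Bad_def S_def P_def min_le_iff_disj not_less)
      then show False using nb by force
    qed
    have tI: "t \<in> Is p" if "t \<le> T" for t using good[of "exp t"] that by (simp add: Is_def R_def)
    have "o.mt t > 0" if "t \<le> T" for t
    proof -
      have "\<mu> p (exp t) > 0" "vs p (exp t) > 0" using good[of "exp t"] that by (auto simp: R_def)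
      then show ?thesis using mu_m[OF tI[OF that]] by (simp add: zero_less_mult_iff)
    qed
    moreover have "xs p T > N - 2" using p by (intro d2) auto
    ultimately show ?thesis using tI[of T] by (auto simp: cr_def o.mcross_def)
  qed
  then show ?thesis using d1 d2 by (intro exI[of _ "min 1 (min d1 d2)"]) auto
qed

section \<open>The supremum of the crossing exponents and its fast orbit\<close>

definition "pst = Sup {p. p > 1 \<and> cr p}"

lemma cr_mono: "1 < p \<Longrightarrow> p < p' \<Longrightarrow> cr p' \<Longrightarrow> cr p"
  unfolding cr_def using mcross_mono[OF orbit_profile orbit_profile, of p' p] by auto

lemma pp_gt: "pp > 1" using po_le_pp po_gt by simp

lemma not_cr_pp: "\<not> cr pp"
  unfolding cr_def using orbit.not_mcross_pp[OF orbit_profile[OF pp_gt]] by simp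

lemma cr_less_pp: "1 < p \<Longrightarrow> cr p \<Longrightarrow> p < pp"
  using cr_mono[of pp p] not_cr_pp pp_gt by (cases p pp rule: linorder_cases) auto

lemma cr_po: "kap > 1 \<Longrightarrow> cr po"
  unfolding cr_def using orbit.mcross_po[OF orbit_profile[OF po_gt]] by simp

lemma cr_classical: "kap = 1 \<Longrightarrow> 1 < p \<Longrightarrow> p < po \<Longrightarrow> cr p"
  unfolding cr_def using orbit.mcross_classical[OF orbit_profile[of p]] by simp

lemma cr_ex: "\<exists>p>1. cr p"
proof (cases "kap = 1")
  case True
  then show ?thesis using cr_classical[of "(1 + po) / 2"] po_gt by (intro exI[of _ "(1 + po) / 2"]) auto
next
  case False
  then show ?thesis using cr_po kap_ge po_gt by auto
qed

lemma cr_bdd: "bdd_above {p. p > 1 \<and> cr p}"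
  using cr_less_pp by (intro bdd_aboveI[of _ pp]) (auto intro: less_imp_le)

lemma pst_upper: "1 < p \<Longrightarrow> cr p \<Longrightarrow> p \<le> pst"
  unfolding pst_def by (intro cSup_upper cr_bdd) auto

lemma pst_le_pp: "pst \<le> pp"
  unfolding pst_def using cr_ex cr_less_pp by (intro cSup_least) (auto intro: less_imp_le)

lemma not_cr_pst: "\<not> cr pst" and pst_gt: "pst > 1"
proof -
  show g: "pst > 1" using cr_ex pst_upper by force
  show "\<not> cr pst"
  proof
    assume "cr pst"
    then obtain d where d: "d > 0" "\<And>p. pst < p \<Longrightarrow> p < pst + d \<Longrightarrow> cr p" using cr_open[OF g] by auto
    have "cr (pst + d / 2)" using d(1) by (intro d(2)) auto
    then show False using pst_upper[of "pst + d / 2"] g d(1) by simp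
  qed
qed

lemma cr_below: "1 < p \<Longrightarrow> p < pst \<Longrightarrow> cr p"
proof -
  assume p: "1 < p" "p < pst"
  then obtain p' where "p' > 1" "cr p'" "p < p'"
    using less_cSup_iff[OF _ cr_bdd, of p] cr_ex unfolding pst_def[symmetric] by auto
  then show "cr p" using cr_mono p by blast
qed

lemma po_le_pst: "po \<le> pst"
proof (cases "kap = 1")
  case True
  show ?thesis
  proof (rule dense_le_bounded[OF po_gt])
    fix w assume "1 < w" "w < po"
    then show "w \<le> pst" using cr_classical[OF True] pst_upper by blast
  qed
next
  case False
  then show ?thesis using cr_po kap_ge pst_upper[OF po_gt] by auto
qed

lemma po_less_pst: "kap > 1 \<Longrightarrow> po < pst"
  using po_le_pst cr_po not_cr_pst by (cases "po = pst") auto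

lemma al_less_of_po: "p \<ge> po \<Longrightarrow> 2 < (p - 1) * (N - 2)"
proof -
  assume "p \<ge> po"
  then have "(po - 1) * (N - 2) \<le> (p - 1) * (N - 2)" using N_ge by (intro mult_right_mono) auto
  moreover have "(po - 1) * (N - 2) = 4" using N_ge by (simp add: po_def field_simps)
  ultimately show ?thesis by simp
qed

text \<open>\<open>E \<ge> 0\<close> passes to the limit from the crossing exponents below
  \<open>pst\<close>. Those close to \<open>pst\<close> exceed \<open>po\<close>, as
  \<open>E_nonneg_of_mcross\<close> requires.\<close>

lemma E_nonneg_pst:
  assumes kap: "kap > 1" and t: "t \<in> Is pst" and z: "zs pst t < n - 1" and x: "xs pst t > 1 / pst"
  shows "orbit.E n kap pst (xs pst) (zs pst) t \<ge> 0"
proof -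
  interpret o: orbit n kap pst "Is pst" "xs pst" "zs pst" by (rule orbit_profile[OF pst_gt])
  have at: "at_left pst \<le> at pst" by (simp add: at_le)
  note lims = profile_tendsto_p[OF pst_gt t]
  have xl: "((\<lambda>p. xs p t) \<longlongrightarrow> xs pst t) (at_left pst)" by (rule tendsto_mono[OF at lims(2)])
  have zl: "((\<lambda>p. zs p t) \<longlongrightarrow> zs pst t) (at_left pst)" by (rule tendsto_mono[OF at lims(3)])
  have pl: "((\<lambda>p. p) \<longlongrightarrow> pst) (at_left pst)" by (rule tendsto_ident_at)
  define al where "al p = 2 / (p - 1)" for p :: real
  have all: "(al \<longlongrightarrow> al pst) (at_left pst)" unfolding al_def using pst_gt by (intro tendsto_intros) auto
  \<comment> \<open>\<open>E\<close> with the exponent as a variable; for each \<open>p\<close> the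
    constant \<open>E\<close> belongs to a different instance of the locale.\<close>
  define F where "F p = (xs p t * zs p t) powr al p * ((xs p t - al p)\<^sup>2 - al p * (N - 2 - al p) + 2 * kap * (xs p t * zs p t) / (p + 1))" for p
  have xz: "xs pst t * zs pst t > 0" using o.x_pos[OF t] o.z_pos[OF t] by simp
  have Fl: "(F \<longlongrightarrow> F pst) (at_left pst)" unfolding F_def
    using xz pst_gt by (intro tendsto_intros xl zl all pl) auto
  have "\<forall>\<^sub>F p in at_left pst. F p \<ge> 0"
  proof -
    have ip: "((\<lambda>p. xs p t - 1 / p) \<longlongrightarrow> xs pst t - 1 / pst) (at_left pst)" using pst_gt by (intro tendsto_intros xl) auto
    have "\<forall>\<^sub>F p in at_left pst. t \<in> Is p" by (rule filter_leD[OF at lims(1)])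
    moreover have "\<forall>\<^sub>F p in at_left pst. zs p t < n - 1" by (rule order_tendstoD(2)[OF zl z])
    moreover have "\<forall>\<^sub>F p in at_left pst. xs p t - 1 / p > 0" by (rule order_tendstoD(1)[OF ip]) (use x in simp)
    moreover have "\<forall>\<^sub>F p in at_left pst. p > po" by (rule order_tendstoD(1)[OF pl po_less_pst[OF kap]])
    moreover have "\<forall>\<^sub>F p in at_left pst. p < pst" by (simp add: eventually_at_filter)
    ultimately show ?thesis
    proof eventually_elim
      case (elim p)
      have p1: "p > 1" using elim po_gt by simp
      interpret op: orbit n kap p "Is p" "xs p" "zs p" by (rule orbit_profile[OF p1])
      have "op.mcross" using cr_below[OF p1] elim by (simp add: cr_def)
      then have "op.E t \<ge> 0" using elim op.al_le(1) by (intro op.E_nonneg_of_mcross) auto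
      then show ?case unfolding F_def op.E_def op.Y_def op.al_def al_def .
    qed
  qed
  then have "0 \<le> F pst" by (intro tendsto_lowerbound[OF Fl]) auto
  then show ?thesis unfolding F_def o.E_def o.Y_def o.al_def al_def .
qed

text \<open>As a limit of crossing orbits this one has \<open>m \<ge> 0\<close>; the inherited bound
  \<open>E \<ge> 0\<close> makes this strict and then rules out every limit of \<open>x\<close>
  except \<open>N - 2\<close>.\<close>

lemma fast_pst: "orbit.fast n kap (Is pst) (xs pst) (zs pst)"
proof -
  interpret o: orbit n kap pst "Is pst" "xs pst" "zs pst" by (rule orbit_profile[OF pst_gt])
  show ?thesis
  proof (cases "kap = 1")
    case True
    then have "N = n" using N_eq by simp
    then have "po = pp" by (simp add: po_def pp_def)
    then have "pst = pp" using po_le_pst pst_le_pp by simp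
    then show ?thesis using o.fast_classical[OF True] by simp
  next
    case False
    then have kap: "kap > 1" using kap_ge by simp
    have alN: "o.al < N - 2" using al_less_of_po[OF po_le_pst] o.al_less_iff by simp
    note E = E_nonneg_pst[OF kap]
    have m0: "o.mt t \<ge> 0" if t: "t \<in> Is pst" for t
    proof -
      have at: "at_left pst \<le> at pst" by (simp add: at_le)
      note lims = profile_tendsto_p[OF pst_gt t]
      have "((\<lambda>p. m (xs p t) (zs p t)) \<longlongrightarrow> o.mt t) (at_left pst)"
        unfolding m_def by (intro tendsto_intros k_tendsto tendsto_mono[OF at lims(2)] tendsto_mono[OF at lims(3)])
      moreover have "\<forall>\<^sub>F p in at_left pst. m (xs p t) (zs p t) \<ge> 0"
      proof -
        have "\<forall>\<^sub>F p in at_left pst. t \<in> Is p" by (rule filter_leD[OF at lims(1)])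
        moreover have "\<forall>\<^sub>F p in at_left pst. p > 1" by (rule order_tendstoD(1)[OF tendsto_ident_at pst_gt])
        moreover have "\<forall>\<^sub>F p in at_left pst. p < pst" by (simp add: eventually_at_filter)
        ultimately show ?thesis
        proof eventually_elim
          case (elim p)
          interpret op: orbit n kap p "Is p" "xs p" "zs p" by (rule orbit_profile) (use elim in auto)
          have "op.mcross" using cr_below[of p] elim by (simp add: cr_def)
          then show ?case using op.mcross_m_pos[of t] elim by (simp add: less_imp_le)
        qed
      qed
      ultimately show ?thesis by (intro tendsto_lowerbound) auto
    qed
    have mp: "o.mt t > 0" if "t \<in> Is pst" for t by (rule o.m_pos_of_nonneg[OF m0 alN E that])
    have nm: "\<not> o.mcross" using not_cr_pst by (simp add: cr_def)
    note nc = o.not_mcross[OF nm mp]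
    have UN: "Is pst = UNIV" using nc(1) by blast
    have xlt: "xs pst t < N - 2" and mpos: "o.mt t > 0" for t using nc(2,3) by blast+
    show ?thesis using UN by (intro o.fast_of_E_nonneg mpos alN E) (auto intro: less_imp_le xlt)
  qed
qed

text \<open>If \<open>pst\<close> were \<open>pp\<close>, the energy would become negative and never
  increase again, against \<open>E \<ge> 0\<close> at late times on the fast orbit.\<close>

lemma pst_less_pp: assumes kap: "kap > 1" shows "pst < pp"
proof (rule ccontr)
  assume "\<not> pst < pp"
  then have eq: "pst = pp" using pst_le_pp by simp
  interpret o: orbit n kap pst "Is pst" "xs pst" "zs pst" by (rule orbit_profile[OF pst_gt])
  obtain t0 where t0: "t0 \<in> Is pst" "o.E t0 < 0" using o.E_neg_eventually[OF _ kap] eq by auto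
  have f: o.fast by (rule fast_pst)
  have alN: "o.al < N - 2" using al_less_of_po[OF po_le_pst] o.al_less_iff by simp
  have UN: "Is pst = UNIV" and xl: "(xs pst \<longlongrightarrow> N - 2) at_top" using f by (auto simp: o.fast_def)
  have "\<forall>\<^sub>F t in at_top. zs pst t < n - 1" by (rule order_tendstoD(2)[OF o.fast_z[OF f alN]]) (use n_gt in simp)
  moreover have "\<forall>\<^sub>F t in at_top. xs pst t > 1 / pst" by (rule order_tendstoD(1)[OF xl]) (use o.al_gt alN in simp)
  moreover have "\<forall>\<^sub>F t in at_top. t \<ge> t0" by (rule eventually_ge_at_top)
  ultimately have "\<forall>\<^sub>F t in at_top. zs pst t < n - 1 \<and> xs pst t > 1 / pst \<and> t \<ge> t0" by eventually_elim auto
  then obtain t where t: "zs pst t < n - 1" "xs pst t > 1 / pst" "t \<ge> t0" by (auto simp: eventually_at_top_linorder)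
  have "o.E t \<ge> 0" by (rule E_nonneg_pst[OF kap _ t(1,2)]) (simp add: UN)
  moreover have "o.E t \<le> o.E t0" using o.E_decr[of t t0] t eq UN by simp
  ultimately show False using t0 by simp
qed

section \<open>Vanishing and decay of the profiles\<close>

lemma crossing_profile:
  assumes p: "1 < p" "p < pst" shows "\<exists>r>0. vs p r \<le> 0"
proof -
  interpret o: orbit n kap p "Is p" "xs p" "zs p" by (rule orbit_profile[OF p(1)])
  have "o.mcross" using cr_below[OF p] by (simp add: cr_def)
  then have "Is p \<noteq> UNIV" using o.blowup by (auto simp: o.mcross_def)
  then obtain t where "t \<notin> Is p" by auto
  then show ?thesis by (intro exI[of _ "exp t"]) (simp add: Is_def)
qed

lemma vs_pos_of_UNIV: assumes "Is p = UNIV" "r \<ge> 0" shows "vs p r > 0"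
proof (cases "r = 0")
  case False
  then have "ln r \<in> Is p" using assms by simp
  then show ?thesis using False assms by (simp add: Is_def)
qed (simp add: vs_0)

lemma vs_pos_pst: "r \<ge> 0 \<Longrightarrow> vs pst r > 0"
  using fast_pst orbit.fast_def[OF orbit_profile[OF pst_gt]] vs_pos_of_UNIV by blast

lemma fast_profile: "\<exists>C>0. ((\<lambda>r. r powr (N - 2) * vs pst r) \<longlongrightarrow> C) at_top"
proof -
  interpret o: orbit n kap pst "Is pst" "xs pst" "zs pst" by (rule orbit_profile[OF pst_gt])
  have f: o.fast by (rule fast_pst)
  have alN: "o.al < N - 2" using al_less_of_po[OF po_le_pst] o.al_less_iff by simp
  have vp: "vs pst (exp t) > 0" for t by (rule vs_pos_pst) simp
  define L where "L t = (N - 2) * t + ln (vs pst (exp t))" for t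
  have "(L has_real_derivative N - 2 - xs pst t) (at t)" for t
  proof -
    have "((\<lambda>t. ln (vs pst (exp t))) has_real_derivative - xs pst t) (at t)"
      using DERIV_chain2[OF DERIV_ln[OF vp] vs_exp_deriv] pst_gt by (simp add: xs_def divide_inverse mult_ac)
    from DERIV_add[OF DERIV_cmult_Id[of "N - 2"] this] show ?thesis unfolding L_def[abs_def] by simp
  qed
  then obtain l where l: "(L \<longlongrightarrow> l) at_top" using o.fast_converges[OF f alN] by blast
  have "((\<lambda>r. exp (L (ln r))) \<longlongrightarrow> exp l) at_top"
    by (intro tendsto_exp filterlim_compose[OF l ln_at_top])
  then have "((\<lambda>r. r powr (N - 2) * vs pst r) \<longlongrightarrow> exp l) at_top"
  proof (rule Lim_transform_eventually)
    show "\<forall>\<^sub>F r in at_top. exp (L (ln r)) = r powr (N - 2) * vs pst r"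
      using eventually_gt_at_top[of 0]
      by eventually_elim (use vs_pos_pst in \<open>simp add: L_def exp_add powr_def less_imp_le\<close>)
  qed
  then show ?thesis by (intro exI[of _ "exp l"]) auto
qed

lemma bounded_above_pst:
  assumes p: "p > pst" shows "Is p = UNIV \<and> (\<exists>X<N - 2. \<forall>t. xs p t \<le> X)"
proof -
  have p1: "p > 1" using p pst_gt by simp
  show ?thesis
    by (rule above_fast_bounded[OF orbit_profile[OF pst_gt] orbit_profile[OF p1] p fast_pst al_less_of_po[OF po_le_pst]])
qed

lemma vs_pos_above: "p > pst \<Longrightarrow> r \<ge> 0 \<Longrightarrow> vs p r > 0"
  using bounded_above_pst vs_pos_of_UNIV by blast

lemma scaled_profile_Y:
  assumes p: "p > 1" and v: "vs p r > 0" and r: "r > 0"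
  shows "r powr (2 / (p - 1)) * vs p r = (xs p (ln r) * zs p (ln r)) powr (1 / (p - 1))"
proof -
  have q: "qs p r > 0" using qs_pos[of p r] p r by simp
  have v1: "vs p r \<le> 1" using vs_le_1[of p r] p r by simp
  have "xs p (ln r) * zs p (ln r) = r\<^sup>2 * vs p r powr (p - 1)"
    using r v q by (simp add: xs_def zs_def nl_eq[OF v v1] powr_diff)
  also have "\<dots> powr (1 / (p - 1)) = r\<^sup>2 powr (1 / (p - 1)) * (vs p r powr (p - 1)) powr (1 / (p - 1))"
    using r v by (simp add: powr_mult)
  also have "r\<^sup>2 = r powr 2" using r by simp
  also have "(r powr 2) powr (1 / (p - 1)) = r powr (2 / (p - 1))" by (simp add: powr_powr)
  also have "(vs p r powr (p - 1)) powr (1 / (p - 1)) = vs p r" using p v by (simp add: powr_powr)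
  finally show ?thesis by simp
qed

text \<open>\<open>r^al v\<close> is a power of \<open>Y\<close>. The upper bound comes from
  \<open>x < N - 2\<close> and \<open>z < n\<close>; the lower bound needs \<open>x\<close> to stay
  away from \<open>N - 2\<close>.\<close>

lemma slow_bounds:
  assumes p: "p > pst"
  shows "\<exists>c1>0. \<exists>c2. \<forall>\<^sub>F r in at_top. c1 \<le> r powr (2 / (p - 1)) * vs p r \<and> r powr (2 / (p - 1)) * vs p r \<le> c2"
proof -
  have p1: "p > 1" using p pst_gt by simp
  interpret o: orbit n kap p "Is p" "xs p" "zs p" by (rule orbit_profile[OF p1])
  obtain X where X: "Is p = UNIV" "X < N - 2" "\<And>t. xs p t \<le> X" using bounded_above_pst[OF p] by blast
  obtain c T where c: "c > 0" "\<forall>t\<ge>T. o.Y t \<ge> c" using o.Y_lower_bound[OF X(1) X(3) X(2)] by blast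
  have up: "o.Y t \<le> (N - 2) * n" for t unfolding o.Y_def
    using X(1) X(3)[of t] X(2) o.z_lt[of t] o.z_pos[of t] o.x_pos[of t] N_ge by (intro mult_mono) auto
  have "\<forall>\<^sub>F r in at_top. ln r \<ge> T" using ln_at_top filterlim_at_top by blast
  then have "\<forall>\<^sub>F r in at_top. c powr (1 / (p - 1)) \<le> r powr (2 / (p - 1)) * vs p r \<and>
      r powr (2 / (p - 1)) * vs p r \<le> ((N - 2) * n) powr (1 / (p - 1))"
    using eventually_gt_at_top[of 0]
  proof eventually_elim
    case (elim r)
    have v: "vs p r > 0" using vs_pos_above[OF p] elim by simp
    have e: "r powr (2 / (p - 1)) * vs p r = o.Y (ln r) powr (1 / (p - 1))"
      using scaled_profile_Y[OF p1 v elim(2)] by (simp add: o.Y_def)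
    have "c \<le> o.Y (ln r)" using c elim by auto
    then show ?case unfolding e using c up[of "ln r"] p1 by (auto intro!: powr_mono2)
  qed
  then show ?thesis using c by (intro exI[of _ "c powr (1 / (p - 1))"]) auto
qed

lemma slow_limit:
  assumes p: "p > pp"
  shows "\<exists>C>0. ((\<lambda>r. r powr (2 / (p - 1)) * vs p r) \<longlongrightarrow> C) at_top"
proof -
  have pst: "p > pst" using p pst_le_pp by simp
  have p1: "p > 1" using pst pst_gt by simp
  interpret o: orbit n kap p "Is p" "xs p" "zs p" by (rule orbit_profile[OF p1])
  obtain X where X: "Is p = UNIV" "X < N - 2" "\<And>t. xs p t \<le> X" using bounded_above_pst[OF pst] by blast
  obtain c T where c: "c > 0" "\<forall>t\<ge>T. o.Y t \<ge> c" using o.Y_lower_bound[OF X(1) X(3) X(2)] by blast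
  have xle: "xs p t \<le> N - 2" for t using X(2) X(3)[of t] by simp
  obtain L where L: "L > 0" "(o.Y \<longlongrightarrow> L) at_top" using o.Y_converges[OF p X(1) xle c(1), of T] c(2) by blast
  have "((\<lambda>r. o.Y (ln r) powr (1 / (p - 1))) \<longlongrightarrow> L powr (1 / (p - 1))) at_top"
    using L(1) by (intro tendsto_intros filterlim_compose[OF L(2) ln_at_top]) auto
  then have "((\<lambda>r. r powr (2 / (p - 1)) * vs p r) \<longlongrightarrow> L powr (1 / (p - 1))) at_top"
  proof (rule Lim_transform_eventually)
    show "\<forall>\<^sub>F r in at_top. o.Y (ln r) powr (1 / (p - 1)) = r powr (2 / (p - 1)) * vs p r"
      using eventually_gt_at_top[of 0]
      by eventually_elim (use scaled_profile_Y[OF p1] vs_pos_above[OF pst] in \<open>simp add: o.Y_def\<close>)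
  qed
  then show ?thesis using L(1) by (intro exI[of _ "L powr (1 / (p - 1))"]) auto
qed

end


section \<open>The Pucci operator on radial functions\<close>


text \<open>The contribution of one eigenvalue to the Pucci operator.\<close>

definition theta :: "real \<Rightarrow> real \<Rightarrow> real \<Rightarrow> real" where
  "theta lam Lam e = lam * max e 0 + Lam * min e 0"

lemma tensor_square_mult: "tensor_square x *v w = (x \<bullet> w) *\<^sub>R x"
  by (simp add: vec_eq_iff tensor_square_def matrix_vector_mult_def inner_vec_def sum_distrib_right sum_distrib_left mult_ac)

lemma scaled_mat_mult: "(mat c :: real^'n^'n) *v w = c *\<^sub>R w"
  by (simp add: vec_eq_iff mat_def matrix_vector_mult_def if_distrib[where f = "\<lambda>x. x * _"] cong: if_cong)

text \<open>Rotating \<open>x\<close> onto a coordinate axis makes the matrix diagonal.\<close>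

lemma det_mat_plus_tensor_square:
  fixes x :: "real^'n"
  shows "det (mat c + b *\<^sub>R tensor_square x) = c ^ (CARD('n) - 1) * (c + b * (norm x)\<^sup>2)"
proof -
  fix k :: 'n
  define y :: "real^'n" where "y = norm x *\<^sub>R axis k 1"
  have "norm y = norm x" by (simp add: y_def)
  then obtain f where f: "orthogonal_transformation f" "f y = x" using orthogonal_transformation_exists by blast
  define Q where "Q = matrix f"
  have Q: "orthogonal_matrix Q" using f(1) by (simp add: orthogonal_transformation_matrix Q_def)
  have Qy: "Q *v y = x" using fun_cong[OF matrix_vector_mul(2)[OF orthogonal_transformation_linear[OF f(1)]], of y] f(2) by (simp add: Q_def)
  have QQ: "Q ** transpose Q = mat 1" using Q by (simp add: orthogonal_matrix_def)
  have inner: "x \<bullet> w = y \<bullet> (transpose Q *v w)" for w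
    by (metis Qy dot_lmul_matrix inner_commute transpose_matrix_vector)
  have "mat c + b *\<^sub>R tensor_square x = Q ** (mat c + b *\<^sub>R tensor_square y) ** transpose Q"
    unfolding matrix_eq
  proof
    fix w
    have "(Q ** (mat c + b *\<^sub>R tensor_square y) ** transpose Q) *v w
      = Q *v ((mat c + b *\<^sub>R tensor_square y) *v (transpose Q *v w))"
      by (simp only: matrix_vector_mul_assoc matrix_mul_assoc)
    also have "\<dots> = Q *v (c *\<^sub>R (transpose Q *v w) + (b * (x \<bullet> w)) *\<^sub>R y)"
      by (simp add: matrix_vector_mult_add_rdistrib scaled_mat_mult scaleR_matrix_vector_assoc[symmetric] tensor_square_mult inner)
    also have "\<dots> = c *\<^sub>R ((Q ** transpose Q) *v w) + (b * (x \<bullet> w)) *\<^sub>R x"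
      by (simp add: matrix_vector_right_distrib matrix_vector_mult_scaleR matrix_vector_mul_assoc Qy del: transpose_matrix_vector)
    also have "\<dots> = (mat c + b *\<^sub>R tensor_square x) *v w"
      unfolding QQ by (simp add: matrix_vector_mult_add_rdistrib scaled_mat_mult scaleR_matrix_vector_assoc[symmetric] tensor_square_mult)
    finally show "(mat c + b *\<^sub>R tensor_square x) *v w = (Q ** (mat c + b *\<^sub>R tensor_square y) ** transpose Q) *v w" by simp
  qed
  moreover have "det Q * det Q = 1"
    using det_orthogonal_matrix[OF Q] by auto
  ultimately have "det (mat c + b *\<^sub>R tensor_square x) = det (mat c + b *\<^sub>R tensor_square y)"
    by (simp add: det_mul det_transpose)
  also have "\<dots> = (\<Prod>i\<in>UNIV. (mat c + b *\<^sub>R tensor_square y) $ i $ i)"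
    by (rule det_diagonal) (auto simp: mat_def tensor_square_def y_def axis_def)
  also have "\<dots> = (\<Prod>i\<in>UNIV. if i = k then c + b * (norm x)\<^sup>2 else c)"
    by (intro prod.cong) (auto simp: mat_def tensor_square_def y_def axis_def power2_eq_square)
  also have "\<dots> = c ^ (CARD('n) - 1) * (c + b * (norm x)\<^sup>2)"
    by (subst prod.remove[of _ k]) (auto simp: card_Diff_singleton)
  finally show ?thesis .
qed

lemma poly_det: "poly (det P) t = det (map_matrix (\<lambda>p. poly p t) P)"
  by (simp add: det_def poly_sum poly_prod)

text \<open>For a radial function the argument of the Pucci operator has this form: \<open>a\<close>
  is the tangential eigenvalue, and the remaining one is radial.\<close>

lemma pucci_minus_rank_one:
  fixes x :: "real^'n"
  shows "pucci_minus lam Lam (mat a + b *\<^sub>R tensor_square x) =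
    (real CARD('n) - 1) * theta lam Lam a + theta lam Lam (a + b * (norm x)\<^sup>2)"
proof -
  define M where "M = mat a + b *\<^sub>R tensor_square x"
  define d where "d = a + b * (norm x)\<^sup>2"
  have "poly (charpoly M) t = poly ([:- a, 1:] ^ (CARD('n) - 1) * [:- d, 1:]) t" for t
  proof -
    have "map_matrix (\<lambda>p. poly p t) (mat [:0, 1:] - map_matrix (\<lambda>a. [:a:]) M) = mat (t - a) + (- b) *\<^sub>R tensor_square x"
      by (auto simp: vec_eq_iff mat_def M_def)
    then have "poly (charpoly M) t = det (mat (t - a) + (- b) *\<^sub>R tensor_square x)" by (simp only: charpoly_def poly_det)
    also have "\<dots> = (t - a) ^ (CARD('n) - 1) * (t - d)" unfolding det_mat_plus_tensor_square by (simp add: d_def)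
    finally show ?thesis by (simp add: poly_power algebra_simps)
  qed
  then have "poly (charpoly M) = poly ([:- a, 1:] ^ (CARD('n) - 1) * [:- d, 1:])" by (rule ext)
  then have "charpoly M = [:- a, 1:] ^ (CARD('n) - 1) * [:- d, 1:]" by (simp only: poly_eq_poly_eq_iff)
  then have "eigenvalues M = proots ([:- a, 1:] ^ (CARD('n) - 1) * [:- d, 1:])" by (simp only: eigenvalues_def)
  also have "\<dots> = proots ([:- a, 1:] ^ (CARD('n) - 1)) + proots [:- d, 1:]" by (rule proots_mult) auto
  also have "\<dots> = repeat_mset (CARD('n) - 1) {#a#} + {#d#}" by (simp add: proots_power)
  finally have "eigenvalues M = repeat_mset (CARD('n) - 1) {#a#} + {#d#}" .
  then have ev: "eigenvalues M = replicate_mset (CARD('n) - 1) a + {#d#}" by (simp add: repeat_mset_replicate_mset)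
  have "CARD('n) \<ge> 1" by (simp add: Suc_leI)
  then have c: "real (CARD('n) - 1) = real CARD('n) - 1" by simp
  have "sum_mset (filter_mset P (replicate_mset j a)) = (if P a then real j * a else 0)" for P j
    by (induction j) (auto simp: algebra_simps)
  then have f: "sum_mset (filter_mset P (replicate_mset j a + {#d#})) = (if P a then real j * a else 0) + (if P d then d else 0)" for P j
    by simp
  show ?thesis unfolding M_def[symmetric] d_def[symmetric] pucci_minus_def ev f theta_def c
    by (auto simp: max_def min_def algebra_simps)
qed

text \<open>Writing \<open>U' = - r b\<close> builds in \<open>U'(0) = 0\<close> and avoids dividing
  by \<open>|x|\<close> in the gradient. The only singular part of the Hessian is
  \<open>b' / r\<close> times \<open>x \<otimes> x\<close>, which has size \<open>r b'\<close>;
  hence the hypothesis at 0.\<close>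

lemma C2_radial:
  fixes U b b' :: "real \<Rightarrow> real"
  assumes U: "\<And>r. r \<ge> 0 \<Longrightarrow> (U has_real_derivative - (r * b r)) (at r within {0..})"
    and b: "continuous_on {0..} b" and b': "\<And>r. r > 0 \<Longrightarrow> (b has_real_derivative b' r) (at r)"
    and b'_cont: "continuous_on {0<..} b'" and b'_0: "((\<lambda>r. r * b' r) \<longlongrightarrow> 0) (at_right 0)"
  shows "C2 (\<lambda>x::real^'n. U (norm x))"
    and "gradient (\<lambda>x::real^'n. U (norm x)) x = - b (norm x) *\<^sub>R x"
    and "hessian (\<lambda>x::real^'n. U (norm x)) x = mat (- b (norm x)) + (- (b' (norm x) / norm x)) *\<^sub>R tensor_square x"
proof -
  define u where "u = (\<lambda>x::real^'n. U (norm x))"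
  have norm_lim: "filterlim norm (at_right 0) (at (0::real^'n))"
    unfolding filterlim_at by (auto simp: eventually_at_filter intro!: tendsto_norm_zero tendsto_ident_at)
  have Ud: "(U has_real_derivative - (r * b r)) (at r)" if "r > 0" for r
  proof -
    have "at r within {0..} = at r" by (rule at_within_interior) (use that in auto)
    then show ?thesis using U[of r] that by simp
  qed
  have ud: "(u has_derivative (\<lambda>h. - b (norm x) * (x \<bullet> h))) (at x)" for x
  proof (cases "x = 0")
    case False
    have "(norm has_derivative (\<lambda>h. h \<bullet> sgn x)) (at x)" using has_derivative_norm[OF False] by (simp add: inner_commute)
    then have "(u has_derivative (\<lambda>h. - (norm x * b (norm x)) * (h \<bullet> sgn x))) (at x)"
      unfolding u_def using Ud[of "norm x"] False
      by (intro has_derivative_compose[of norm "\<lambda>h. h \<bullet> sgn x" x UNIV U "(*) (- (norm x * b (norm x)))"])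
        (auto simp: has_field_derivative_def)
    also have "(\<lambda>h. - (norm x * b (norm x)) * (h \<bullet> sgn x)) = (\<lambda>h. - b (norm x) * (x \<bullet> h))"
      using False by (simp add: sgn_div_norm inner_commute fun_eq_iff)
    finally show ?thesis .
  next
    case True
    have "(U has_real_derivative 0) (at_right 0)" using U[of 0]
      by (auto intro: has_field_derivative_subset)
    then have "((\<lambda>r. (U r - U 0) / r) \<longlongrightarrow> 0) (at_right 0)" by (simp add: has_field_derivative_iff)
    then have "((\<lambda>y::real^'n. (U (norm y) - U 0) / norm y) \<longlongrightarrow> 0) (at 0)" by (rule filterlim_compose[OF _ norm_lim])
    then have "((\<lambda>y::real^'n. norm (U (norm y) - U 0) / norm y) \<longlongrightarrow> 0) (at 0)"
      using tendsto_norm_zero by fastforce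
    then have "(u has_derivative (\<lambda>h. 0)) (at 0)" by (simp add: has_derivative_iff_norm u_def)
    then show ?thesis using True by simp
  qed
  have fd: "frechet_derivative u (at x) = (\<lambda>h. - b (norm x) * (x \<bullet> h))" for x
    using frechet_derivative_at[OF ud] by metis
  have grad: "gradient u x = - b (norm x) *\<^sub>R x" for x
    by (simp add: vec_eq_iff gradient_def fd inner_axis)
  then show "gradient (\<lambda>x::real^'n. U (norm x)) x = - b (norm x) *\<^sub>R x" unfolding u_def .
  have grad': "gradient u = (\<lambda>x. - b (norm x) *\<^sub>R x)" using grad by auto
  have gd: "(gradient u has_derivative (\<lambda>h. - b (norm x) *\<^sub>R h - (b' (norm x) / norm x * (x \<bullet> h)) *\<^sub>R x)) (at x)" for x
  proof (cases "x = 0")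
    case False
    have "(norm has_derivative (\<lambda>h. h \<bullet> sgn x)) (at x)" using has_derivative_norm[OF False] by (simp add: inner_commute)
    then have "((\<lambda>x. b (norm x)) has_derivative (\<lambda>h. b' (norm x) * (h \<bullet> sgn x))) (at x)"
      using b'[of "norm x"] False
      by (intro has_derivative_compose[of norm "\<lambda>h. h \<bullet> sgn x" x UNIV b "(*) (b' (norm x))"])
        (auto simp: has_field_derivative_def)
    from has_derivative_minus[OF has_derivative_scaleR[OF this has_derivative_ident]]
    have "(gradient u has_derivative (\<lambda>h. - (b (norm x) *\<^sub>R h + (b' (norm x) * (h \<bullet> sgn x)) *\<^sub>R x))) (at x)"
      unfolding grad' by simp
    also have "(\<lambda>h. - (b (norm x) *\<^sub>R h + (b' (norm x) * (h \<bullet> sgn x)) *\<^sub>R x)) = (\<lambda>h. - b (norm x) *\<^sub>R h - (b' (norm x) / norm x * (x \<bullet> h)) *\<^sub>R x)"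
      by (simp add: sgn_div_norm inner_commute divide_inverse fun_eq_iff mult_ac)
    finally show ?thesis .
  next
    case True
    have "(b \<longlongrightarrow> b 0) (at_right 0)"
      using continuous_on_subset[OF b, of "{0..1}"] by (intro continuous_on_Icc_at_rightD[of 0 1]) auto
    then have "((\<lambda>r. b r - b 0) \<longlongrightarrow> 0) (at_right 0)" by (simp add: LIM_zero)
    then have "((\<lambda>y::real^'n. b (norm y) - b 0) \<longlongrightarrow> 0) (at 0)" by (rule filterlim_compose[OF _ norm_lim])
    then have l: "((\<lambda>y::real^'n. \<bar>b (norm y) - b 0\<bar>) \<longlongrightarrow> 0) (at 0)" by (rule tendsto_rabs_zero)
    have "((\<lambda>y::real^'n. norm (- b (norm y) *\<^sub>R y - - b (norm (0::real^'n)) *\<^sub>R 0 - - b 0 *\<^sub>R (y - 0)) / norm (y - 0)) \<longlongrightarrow> 0) (at 0)"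
    proof (rule Lim_transform_eventually[OF l])
      show "\<forall>\<^sub>F y::real^'n in at 0. \<bar>b (norm y) - b 0\<bar> = norm (- b (norm y) *\<^sub>R y - - b (norm (0::real^'n)) *\<^sub>R 0 - - b 0 *\<^sub>R (y - 0)) / norm (y - 0)"
        unfolding eventually_at_filter
      proof (intro always_eventually allI impI)
        fix y :: "real^'n" assume y: "y \<noteq> 0"
        have "- b (norm y) *\<^sub>R y - - b (norm (0::real^'n)) *\<^sub>R 0 - - b 0 *\<^sub>R (y - 0) = (b 0 - b (norm y)) *\<^sub>R y"
          by (simp add: scaleR_left_diff_distrib)
        then show "\<bar>b (norm y) - b 0\<bar> = norm (- b (norm y) *\<^sub>R y - - b (norm (0::real^'n)) *\<^sub>R 0 - - b 0 *\<^sub>R (y - 0)) / norm (y - 0)"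
          using y by (simp add: abs_minus_commute)
      qed
    qed
    moreover have "bounded_linear (\<lambda>h::real^'n. - b 0 *\<^sub>R h)" by (rule bounded_linear_scaleR_right)
    ultimately have "(gradient u has_derivative (\<lambda>h. - b 0 *\<^sub>R h)) (at 0)"
      unfolding has_derivative_iff_norm grad' by blast
    then show ?thesis using True by simp
  qed
  have hess: "hessian u x = mat (- b (norm x)) + (- (b' (norm x) / norm x)) *\<^sub>R tensor_square x" for x
  proof -
    have "frechet_derivative (gradient u) (at x) = (\<lambda>h. - b (norm x) *\<^sub>R h - (b' (norm x) / norm x * (x \<bullet> h)) *\<^sub>R x)"
      using frechet_derivative_at[OF gd] by metis
    moreover have "axis j 1 $ i = (if i = j then 1 else (0::real))" for i j :: 'n by (simp add: axis_def)
    ultimately show ?thesis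
      by (auto simp: vec_eq_iff hessian_def jacobian_def matrix_def mat_def tensor_square_def inner_axis)
  qed
  then show "hessian (\<lambda>x::real^'n. U (norm x)) x = mat (- b (norm x)) + (- (b' (norm x) / norm x)) *\<^sub>R tensor_square x"
    unfolding u_def .
  have bn: "continuous_on UNIV (\<lambda>x::real^'n. b (norm x))"
    by (rule continuous_on_compose2[OF b]) (auto intro!: continuous_intros)
  have "continuous_on UNIV (\<lambda>x. hessian u x $ i $ j)" for i j
  proof -
    have eq: "hessian u x $ i $ j = (if i = j then - b (norm x) else 0) + - (b' (norm x) / norm x * (x $ i * x $ j))" for x
      by (simp add: hess mat_def tensor_square_def)
    have c1: "continuous_on UNIV (\<lambda>x::real^'n. if i = j then - b (norm x) else 0)"
      by (cases "i = j") (auto intro!: continuous_intros bn)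
    have c2: "isCont (\<lambda>x::real^'n. b' (norm x) / norm x * (x $ i * x $ j)) x" for x
    proof (cases "x = 0")
      case False
      have "isCont b' (norm x)" using b'_cont False by (simp add: continuous_on_eq_continuous_at)
      moreover have nc: "isCont (\<lambda>x::real^'n. norm x) x" by (rule isCont_norm[OF continuous_ident])
      ultimately have "isCont (\<lambda>x. b' (norm x)) x" using isCont_o2[OF nc, of b'] by blast
      moreover have ci: "isCont (\<lambda>x::real^'n. x $ i) x" for i by (intro linear_continuous_at bounded_linear_vec_nth)
      ultimately show ?thesis using False by (intro isCont_mult isCont_divide nc ci) auto
    next
      case True
      have "((\<lambda>x::real^'n. \<bar>norm x * b' (norm x)\<bar>) \<longlongrightarrow> 0) (at 0)"
        by (rule tendsto_rabs_zero[OF filterlim_compose[OF b'_0 norm_lim]])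
      then have "((\<lambda>x::real^'n. b' (norm x) / norm x * (x $ i * x $ j)) \<longlongrightarrow> 0) (at 0)"
      proof (rule Lim_null_comparison[rotated])
        show "\<forall>\<^sub>F x::real^'n in at 0. norm (b' (norm x) / norm x * (x $ i * x $ j)) \<le> \<bar>norm x * b' (norm x)\<bar>"
          unfolding eventually_at_filter
        proof (intro always_eventually allI impI)
          fix x :: "real^'n" assume x: "x \<noteq> 0"
          have "\<bar>x $ i\<bar> * \<bar>x $ j\<bar> \<le> norm x * norm x" by (intro mult_mono component_le_norm_cart) auto
          then have "\<bar>b' (norm x)\<bar> / norm x * (\<bar>x $ i\<bar> * \<bar>x $ j\<bar>) \<le> \<bar>b' (norm x)\<bar> / norm x * (norm x * norm x)"
            by (intro mult_left_mono) auto
          then show "norm (b' (norm x) / norm x * (x $ i * x $ j)) \<le> \<bar>norm x * b' (norm x)\<bar>"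
            using x by (simp add: abs_mult mult.commute)
        qed
      qed
      then show ?thesis using True by (simp add: isCont_def)
    qed
    show ?thesis unfolding eq using c2 by (intro continuous_on_add c1 continuous_on_minus continuous_at_imp_continuous_on) auto
  qed
  then have "continuous_on UNIV (\<lambda>x. \<chi> i j. hessian u x $ i $ j)" by (intro continuous_on_vec_lambda)
  then have hc: "continuous_on UNIV (hessian u)" by simp
  show "C2 (\<lambda>x::real^'n. U (norm x))"
    unfolding C2_def u_def[symmetric] using hc differentiableI[OF ud] differentiableI[OF gd] by blast
qed


section \<open>The change of unknown\<close>


lemma at_within_Icc_atLeast: "0 \<le> s \<Longrightarrow> s < R \<Longrightarrow> at s within {0..R} = at s within {0..}" for s :: real
proof (rule at_within_nhd[of s "{s - 1<..<R}"])
  assume "0 \<le> s" "s < R"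
  then show "{0..R} \<inter> {s - 1<..<R} - {s} = {0..} \<inter> {s - 1<..<R} - {s}" by auto
qed auto

lemma at_within_atLeast: "0 < s \<Longrightarrow> at s within {0..} = at s" for s :: real
  by (rule at_within_interior) auto

lemma theta_alt: "theta lam Lam e = (if e \<ge> 0 then lam * e else Lam * e)"
  by (simp add: theta_def)

lemma theta_mult: "t > 0 \<Longrightarrow> theta lam Lam (t * e) = t * theta lam Lam e"
  by (simp add: theta_alt zero_le_mult_iff)

lemma theta_uminus: "0 \<le> q \<Longrightarrow> theta lam Lam (- q) = - Lam * q"
  by (simp add: theta_alt)

text \<open>\<open>theta\<close> is an increasing bijection, linear on each half-line, so the
  equation can be solved for the radial eigenvalue. This inverse is the origin of the form of
  \<open>Psi\<close>.\<close>

lemma theta_eq_iff: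
  assumes lam: "0 < lam" "lam \<le> Lam"
  shows "theta lam Lam (- B) = - Lam * A \<longleftrightarrow> B = Lam / lam * A - (Lam / lam - 1) * max 0 A"
proof (cases "A \<le> 0")
  case True
  then have r: "Lam / lam * A - (Lam / lam - 1) * max 0 A = Lam / lam * A" by simp
  have s: "Lam * A \<le> 0" using True lam by (simp add: mult_nonneg_nonpos)
  show ?thesis unfolding r
  proof (cases "B \<le> 0")
    case True
    then have "theta lam Lam (- B) = - lam * B" by (simp add: theta_def)
    then show "theta lam Lam (- B) = - Lam * A \<longleftrightarrow> B = Lam / lam * A" using lam by (auto simp: field_simps)
  next
    case False
    then have "theta lam Lam (- B) = - Lam * B" "Lam * B > 0" using lam by (auto simp: theta_uminus)
    moreover have "Lam / lam * A \<le> 0" using s lam by (simp add: divide_nonpos_pos)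
    ultimately show "theta lam Lam (- B) = - Lam * A \<longleftrightarrow> B = Lam / lam * A" using s False by auto
  qed
next
  case False
  then have r: "Lam / lam * A - (Lam / lam - 1) * max 0 A = A" by (simp add: algebra_simps)
  have s: "Lam * A > 0" using False lam by simp
  show ?thesis unfolding r
  proof (cases "B \<le> 0")
    case True
    then have "theta lam Lam (- B) \<ge> 0" using lam by (simp add: theta_def mult_nonneg_nonpos)
    then show "theta lam Lam (- B) = - Lam * A \<longleftrightarrow> B = A" using s True False by auto
  next
    case B: False
    then have "theta lam Lam (- B) = - Lam * B" by (simp add: theta_uminus)
    then show "theta lam Lam (- B) = - Lam * A \<longleftrightarrow> B = A" using lam by auto
  qed
qed

locale nonlinearity =
  fixes g :: "real \<Rightarrow> real"
  assumes g_cont: "continuous_on {0..} g" and g_nonneg: "\<And>t. t \<ge> 0 \<Longrightarrow> g t \<ge> 0"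
begin

lemma G_deriv: assumes "s \<ge> 0" shows "(G_of g has_real_derivative g s) (at s within {0..})"
proof -
  have "((\<lambda>u. integral {0..u} g) has_real_derivative g s) (at s within {0..s + 1})"
    using assms by (intro integral_has_real_derivative continuous_on_subset[OF g_cont]) auto
  then show ?thesis using at_within_Icc_atLeast[of s "s + 1"] assms by (simp add: G_of_def[abs_def])
qed

lemma G_cont: "continuous_on {0..} (G_of g)"
  by (rule DERIV_continuous_on[of _ _ g]) (use G_deriv in auto)

lemma phi_deriv: assumes "s \<ge> 0" shows "(phi g has_real_derivative exp (G_of g s)) (at s within {0..})"
proof -
  have "((\<lambda>u. integral {0..u} (\<lambda>t. exp (G_of g t))) has_real_derivative exp (G_of g s)) (at s within {0..s + 1})"
    using assms by (intro integral_has_real_derivative continuous_on_exp continuous_on_subset[OF G_cont]) auto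
  then show ?thesis using at_within_Icc_atLeast[of s "s + 1"] assms by (simp add: phi_def[abs_def])
qed

lemma phi_cont: "continuous_on {0..} (phi g)"
  by (rule DERIV_continuous_on[of _ _ "\<lambda>s. exp (G_of g s)"]) (use phi_deriv in auto)

lemma phi_0: "phi g 0 = 0" by (simp add: phi_def)

lemma G_nonneg: "s \<ge> 0 \<Longrightarrow> G_of g s \<ge> 0"
  unfolding G_of_def
  by (intro integral_nonneg integrable_continuous_interval continuous_on_subset[OF g_cont]) (auto intro: g_nonneg)

lemma phi_less: assumes "0 \<le> s" "s < t" shows "phi g s < phi g t"
proof (rule DERIV_pos_imp_increasing_open[OF assms(2)])
  show "continuous_on {s..t} (phi g)" by (rule continuous_on_subset[OF phi_cont]) (use assms in auto)
  fix x assume "s < x" "x < t"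
  then show "\<exists>y. (phi g has_real_derivative y) (at x) \<and> 0 < y"
    using phi_deriv[of x] at_within_atLeast[of x] assms by (intro exI[of _ "exp (G_of g x)"]) auto
qed

text \<open>Supplies the upper end in the intermediate value argument that makes
  \<open>phi g\<close> map onto \<open>[0, \<infinity>)\<close>.\<close>

lemma phi_ge: assumes "s \<ge> 0" shows "phi g s \<ge> s"
proof -
  have "phi g 0 - 0 \<le> phi g s - s"
  proof (rule DERIV_nonneg_imp_increasing_open[OF assms])
    show "continuous_on {0..s} (\<lambda>s. phi g s - s)"
      by (intro continuous_intros continuous_on_subset[OF phi_cont]) auto
    fix x assume x: "0 < x" "x < s"
    have "(phi g has_real_derivative exp (G_of g x)) (at x)"
      using phi_deriv[of x] at_within_atLeast[of x] x by simp
    then show "\<exists>y. ((\<lambda>s. phi g s - s) has_real_derivative y) (at x) \<and> 0 \<le> y"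
      using G_nonneg[of x] x by (intro exI[of _ "exp (G_of g x) - 1"]) (auto intro!: derivative_eq_intros)
  qed
  then show ?thesis by (simp add: phi_0)
qed

lemma phi_inj: "inj_on (phi g) {0..}"
proof (rule linorder_inj_onI')
  fix s t :: real assume "s \<in> {0..}" "s < t"
  then show "phi g s \<noteq> phi g t" using phi_less[of s t] by simp
qed

lemma phi_eq_0: "s \<ge> 0 \<Longrightarrow> phi g s = 0 \<longleftrightarrow> s = 0"
  using phi_ge[of s] phi_0 by auto

lemma phi_image: "phi g ` {0..} = {0..}"
proof (intro subset_antisym subsetI)
  fix y :: real assume y: "y \<in> {0..}"
  have "\<exists>s. 0 \<le> s \<and> s \<le> y \<and> phi g s = y"
    by (rule IVT') (use y phi_ge[of y] phi_0 in \<open>auto intro: continuous_on_subset[OF phi_cont]\<close>)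
  then show "y \<in> phi g ` {0..}" by force
next
  fix y assume "y \<in> phi g ` {0..}"
  then obtain s where "s \<ge> 0" "y = phi g s" by auto
  then show "y \<in> {0..}" using phi_ge[of s] by simp
qed

abbreviation "psi \<equiv> inv_into {0..} (phi g)"

lemma psi: assumes "y \<ge> 0" shows phi_psi: "phi g (psi y) = y" and psi_nonneg: "psi y \<ge> 0"
  using f_inv_into_f[of y "phi g" "{0..}"] inv_into_into[of y "phi g" "{0..}"] assms phi_image by auto

lemma psi_phi: "s \<ge> 0 \<Longrightarrow> psi (phi g s) = s"
  by (rule inv_into_f_f[OF phi_inj]) simp

lemma psi_pos: "y > 0 \<Longrightarrow> psi y > 0"
  using phi_psi[of y] psi_nonneg[of y] phi_0 by (cases "psi y = 0") auto

lemma psi_deriv: assumes y: "y > 0" shows "(psi has_real_derivative exp (- G_of g (psi y))) (at y)"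
proof -
  have pd: "(phi g has_real_derivative exp (G_of g s)) (at s)" if "s > 0" for s
    using phi_deriv[of s] at_within_atLeast[of s] that by simp
  have p: "psi y > 0" by (rule psi_pos[OF y])
  have "isCont psi (phi g (psi y))"
  proof (rule isCont_inverse_function[where d = "psi y / 2" and f = "phi g" and g = psi and x = "psi y"])
    fix z assume "\<bar>z - psi y\<bar> \<le> psi y / 2"
    then have "z > 0" using p by linarith
    then show "psi (phi g z) = z" "isCont (phi g) z" using psi_phi[of z] DERIV_isCont[OF pd] by auto
  qed (use p in simp)
  then have c: "isCont psi y" using phi_psi[of y] y by simp
  have "(psi has_real_derivative inverse (exp (G_of g (psi y)))) (at y)"
    by (rule DERIV_inverse_function[OF pd[OF p] _ _ _ _ c, of 0 "y + 1"]) (use y phi_psi in auto)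
  then show ?thesis by (simp add: exp_minus)
qed

lemma phi_comp_deriv:
  assumes U: "(U has_real_derivative D) (at r within {0..})" and nn: "\<And>r. r \<ge> 0 \<Longrightarrow> U r \<ge> 0" and r: "r \<ge> 0"
  shows "((\<lambda>r. phi g (U r)) has_real_derivative exp (G_of g (U r)) * D) (at r within {0..})"
    and "((\<lambda>r. G_of g (U r)) has_real_derivative g (U r) * D) (at r within {0..})"
proof -
  have sub: "U ` {0..} \<subseteq> {0..}" using nn by auto
  show "((\<lambda>r. phi g (U r)) has_real_derivative exp (G_of g (U r)) * D) (at r within {0..})"
    using DERIV_image_chain[OF has_field_derivative_subset[OF phi_deriv[OF nn[OF r]] sub] U] by (simp add: o_def)
  show "((\<lambda>r. G_of g (U r)) has_real_derivative g (U r) * D) (at r within {0..})"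
    using DERIV_image_chain[OF has_field_derivative_subset[OF G_deriv[OF nn[OF r]] sub] U] by (simp add: o_def)
qed

end

lemma pucci_radial:
  fixes U b b' :: "real \<Rightarrow> real" and x :: "real^'n"
  assumes U: "\<And>r. r \<ge> 0 \<Longrightarrow> (U has_real_derivative - (r * b r)) (at r within {0..})"
    and b: "continuous_on {0..} b" and b': "\<And>r. r > 0 \<Longrightarrow> (b has_real_derivative b' r) (at r)"
    and b'_cont: "continuous_on {0<..} b'" and b'_0: "((\<lambda>r. r * b' r) \<longlongrightarrow> 0) (at_right 0)"
    and r: "r = norm x"
  shows "pucci_minus lam Lam (hessian (\<lambda>x::real^'n. U (norm x)) x +
      c *\<^sub>R tensor_square (gradient (\<lambda>x::real^'n. U (norm x)) x)) =
    (real CARD('n) - 1) * theta lam Lam (- b r) + theta lam Lam (- b r - r * b' r + c * (r * b r)\<^sup>2)"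
proof -
  have t: "tensor_square (d *\<^sub>R x) = d\<^sup>2 *\<^sub>R tensor_square x" for d
    by (simp add: vec_eq_iff tensor_square_def power2_eq_square)
  have R2: "gradient (\<lambda>x::real^'n. U (norm x)) x = - b (norm x) *\<^sub>R x"
    by (rule C2_radial(2)[OF U b b' b'_cont b'_0])
  have R3: "hessian (\<lambda>x::real^'n. U (norm x)) x = mat (- b (norm x)) + (- (b' (norm x) / norm x)) *\<^sub>R tensor_square x"
    by (rule C2_radial(3)[OF U b b' b'_cont b'_0])
  have "hessian (\<lambda>x::real^'n. U (norm x)) x + c *\<^sub>R tensor_square (gradient (\<lambda>x::real^'n. U (norm x)) x)
    = mat (- b r) + (- (b' r / r) + c * (b r)\<^sup>2) *\<^sub>R tensor_square x"
    unfolding R2 R3 t r scaleR_scaleR by (simp add: scaleR_left_distrib scaleR_left_diff_distrib)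
  moreover have "- b r + (- (b' r / r) + c * (b r)\<^sup>2) * (norm x)\<^sup>2 = - b r - r * b' r + c * (r * b r)\<^sup>2"
    unfolding r[symmetric] by (cases "r = 0") (auto simp: power2_eq_square field_simps)
  ultimately show ?thesis by (simp only: pucci_minus_rank_one)
qed

lemma frechet_derivative_gradient:
  fixes u :: "real^'n \<Rightarrow> real"
  assumes "u differentiable at x" shows "frechet_derivative u (at x) h = gradient u x \<bullet> h"
proof -
  have l: "linear (frechet_derivative u (at x))" using assms linear_frechet_derivative by blast
  have "frechet_derivative u (at x) h = frechet_derivative u (at x) (\<Sum>i\<in>UNIV. h $ i *\<^sub>R axis i 1)"
    using basis_expansion[of h] by (simp add: scalar_mult_eq_scaleR)
  also have "\<dots> = (\<Sum>i\<in>UNIV. h $ i * frechet_derivative u (at x) (axis i 1))"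
    by (simp add: linear_sum[OF l] linear_scale[OF l])
  also have "\<dots> = gradient u x \<bullet> h" by (simp add: gradient_def inner_vec_def mult.commute)
  finally show ?thesis .
qed

text \<open>Restrict the function to a line through the origin.\<close>

lemma radial_profile:
  fixes U :: "real \<Rightarrow> real"
  assumes C2: "C2 (\<lambda>x::real^'n. U (norm x))"
  shows "\<exists>b b'. (\<forall>r\<ge>0. (U has_real_derivative - (r * b r)) (at r within {0..})) \<and>
    continuous_on {0..} b \<and> (\<forall>r>0. (b has_real_derivative b' r) (at r)) \<and>
    continuous_on {0<..} b' \<and> ((\<lambda>r. r * b' r) \<longlongrightarrow> 0) (at_right 0)"
proof -
  define u where "u = (\<lambda>x::real^'n. U (norm x))"
  have ud: "u differentiable at x" and gd: "gradient u differentiable at x" and hc: "continuous_on UNIV (hessian u)" for x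
    using C2 by (auto simp: C2_def u_def)
  fix k :: 'n
  define e :: "real^'n" where "e = axis k 1"
  define D where "D s = gradient u (s *\<^sub>R e) $ k" for s
  define D2 where "D2 s = hessian u (s *\<^sub>R e) $ k $ k" for s
  have le: "((\<lambda>s. s *\<^sub>R e) has_derivative (\<lambda>d. d *\<^sub>R e)) (at s)" for s
    by (intro bounded_linear.has_derivative[OF bounded_linear_scaleR_left] has_derivative_ident)
  have Ut: "((\<lambda>s. u (s *\<^sub>R e)) has_real_derivative D s) (at s)" for s
  proof -
    have "(u has_derivative frechet_derivative u (at (s *\<^sub>R e))) (at (s *\<^sub>R e))" using ud frechet_derivative_works by blast
    from has_derivative_compose[OF le this]
    have "((\<lambda>s. u (s *\<^sub>R e)) has_derivative (\<lambda>d. frechet_derivative u (at (s *\<^sub>R e)) (d *\<^sub>R e))) (at s)" .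
    also have "(\<lambda>d. frechet_derivative u (at (s *\<^sub>R e)) (d *\<^sub>R e)) = (\<lambda>d. D s * d)"
      by (simp add: frechet_derivative_gradient[OF ud] D_def e_def inner_axis fun_eq_iff)
    finally show ?thesis by (simp add: has_field_derivative_def)
  qed
  have Dd: "(D has_real_derivative D2 s) (at s)" for s
  proof -
    have "(gradient u has_derivative (\<lambda>h. hessian u (s *\<^sub>R e) *v h)) (at (s *\<^sub>R e))"
      using gd jacobian_works unfolding hessian_def by blast
    from bounded_linear.has_derivative[OF bounded_linear_vec_nth has_derivative_compose[OF le this], of k]
    have "(D has_derivative (\<lambda>d. (hessian u (s *\<^sub>R e) *v (d *\<^sub>R e)) $ k)) (at s)" by (simp add: D_def[abs_def])
    also have "(\<lambda>d. (hessian u (s *\<^sub>R e) *v (d *\<^sub>R e)) $ k) = (\<lambda>d. D2 s * d)"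
      by (simp add: matrix_vector_mul_component D2_def e_def inner_axis fun_eq_iff)
    finally show ?thesis by (simp add: has_field_derivative_def)
  qed
  have D2c: "continuous_on UNIV D2"
  proof -
    have "continuous_on UNIV (\<lambda>s. hessian u (s *\<^sub>R e))"
      by (rule continuous_on_compose2[OF hc]) (auto intro!: continuous_intros)
    then show ?thesis unfolding D2_def by (intro continuous_intros)
  qed
  have D2l: "(D2 \<longlongrightarrow> D2 s) (at s)" for s using D2c by (simp add: continuous_on_def)
  \<comment> \<open>\<open>u\<close> is even along the line; hence the quotient
    \<open>- D r / r\<close> extends continuously to 0, with the value
    \<open>- D2 0\<close>.\<close>
  have D0: "D 0 = 0"
  proof -
    have "((\<lambda>s. u ((- s) *\<^sub>R e)) has_real_derivative D 0 * (- 1)) (at 0)"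
      using DERIV_chain2[OF Ut[of "- 0"] DERIV_minus[OF DERIV_ident]] by simp
    moreover have "u ((- s) *\<^sub>R e) = u (s *\<^sub>R e)" for s by (simp add: u_def)
    ultimately have "((\<lambda>s. u (s *\<^sub>R e)) has_real_derivative D 0 * (- 1)) (at 0)" by simp
    from DERIV_unique[OF this Ut[of 0]] show ?thesis by simp
  qed
  have quot: "((\<lambda>r. D r / r) \<longlongrightarrow> D2 0) (at 0)" using Dd[of 0] D0 by (simp add: has_field_derivative_iff)
  define b where "b r = (if r = 0 then - D2 0 else - D r / r)" for r
  define b' where "b' r = - D2 r / r + D r / r\<^sup>2" for r
  have bd: "(b has_real_derivative b' r) (at r)" if r: "r > 0" for r
  proof -
    have "((\<lambda>r. - D r / r) has_real_derivative (- D2 r * r - - D r * 1) / (r * r)) (at r)"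
      using r by (intro DERIV_divide DERIV_minus Dd DERIV_ident) auto
    moreover have "(- D2 r * r - - D r * 1) / (r * r) = b' r"
      using r by (simp add: b'_def power2_eq_square field_simps)
    ultimately have "((\<lambda>r. - D r / r) has_real_derivative b' r) (at r)" by simp
    then show ?thesis
      by (rule has_field_derivative_transform_within_open[of _ _ _ "{0<..}"]) (use r in \<open>auto simp: b_def\<close>)
  qed
  have bc: "continuous_on {0..} b"
    unfolding continuous_on_def
  proof
    fix r :: real assume r: "r \<in> {0..}"
    show "(b \<longlongrightarrow> b r) (at r within {0..})"
    proof (cases "r = 0")
      case True
      have "((\<lambda>r. - (D r / r)) \<longlongrightarrow> - D2 0) (at 0 within {0..})"
        by (intro tendsto_minus tendsto_within_subset[OF quot]) auto
      then have "(b \<longlongrightarrow> - D2 0) (at 0 within {0..})"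
        by (rule Lim_transform_eventually) (auto simp: eventually_at_filter b_def)
      then show ?thesis using True by (simp add: b_def)
    next
      case False
      then show ?thesis using r DERIV_isCont[OF bd[of r]] by (auto simp: isCont_def intro: tendsto_within_subset)
    qed
  qed
  have Dc: "continuous_on S D" for S using DERIV_isCont[OF Dd] by (intro continuous_at_imp_continuous_on) auto
  have b'c: "continuous_on {0<..} b'" unfolding b'_def
    by (intro continuous_intros Dc continuous_on_subset[OF D2c]) auto
  have b'0: "((\<lambda>r. r * b' r) \<longlongrightarrow> 0) (at_right 0)"
  proof -
    have "((\<lambda>r. - D2 r + D r / r) \<longlongrightarrow> - D2 0 + D2 0) (at_right 0)"
      by (intro tendsto_intros tendsto_within_subset[OF D2l] tendsto_within_subset[OF quot]) auto
    then have "((\<lambda>r. - D2 r + D r / r) \<longlongrightarrow> 0) (at_right 0)" by simp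
    then show ?thesis
      by (rule Lim_transform_eventually) (auto simp: eventually_at_filter b'_def power2_eq_square field_simps)
  qed
  have Ud: "(U has_real_derivative - (r * b r)) (at r within {0..})" if r: "r \<ge> 0" for r
  proof -
    have "((\<lambda>s. u (s *\<^sub>R e)) has_real_derivative - (r * b r)) (at r within {0..})"
    proof -
      have "- (r * b r) = D r" using D0 by (cases "r = 0") (auto simp: b_def)
      then show ?thesis using has_field_derivative_at_within[OF Ut[of r]] by simp
    qed
    then show ?thesis
      by (rule has_field_derivative_transform_within[OF _ zero_less_one]) (use r in \<open>auto simp: u_def e_def\<close>)
  qed
  show ?thesis using Ud bc bd b'c b'0 by blast
qed


section \<open>Radial solutions and profiles\<close>


context nonlinearity begin

text \<open>With \<open>v = phi g (U)\<close> the gradient term disappears: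
  \<open>exp (G_of g (U r))\<close> multiplies both eigenvalues, and \<open>theta\<close> is
  positively homogeneous. Normalising \<Lambda> and the value at 0 leaves the initial value problem
  that has only one solution.\<close>

lemma solution_profile:
  fixes U :: "real \<Rightarrow> real" and lam Lam p :: real
  assumes sol: "nontrivial_radial_solution TYPE('n::finite) lam Lam g p U"
    and p: "p > 1" and lam: "0 < lam" "lam \<le> Lam" and n3: "CARD('n) \<ge> 3"
    and n_def: "n = real CARD('n)" and kap_def: "kap = Lam / lam"
  shows "(\<forall>r\<ge>0. U r \<ge> 0 \<and> pucci_ode.vs n kap p r > 0) \<and>
    (\<exists>c>0. \<forall>r\<ge>0. phi g (U r) = c * pucci_ode.vs n kap p (r / sqrt (Lam * c powr (1 - p))))"
proof -
  interpret pucci_ode n kap by unfold_locales (use n3 lam in \<open>auto simp: n_def kap_def\<close>)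
  have Lam: "Lam > 0" using lam by simp
  have C2: "C2 (\<lambda>x::real^'n. U (norm x))" and Unn: "\<And>x::real^'n. U (norm x) \<ge> 0"
    and eq: "\<And>x::real^'n. pucci_minus lam Lam (hessian (\<lambda>x::real^'n. U (norm x)) x +
        g (U (norm x)) *\<^sub>R tensor_square (gradient (\<lambda>x::real^'n. U (norm x)) x)) +
        phi g (U (norm x)) powr p * exp (- G_of g (U (norm x))) = 0"
    and nontriv: "\<exists>x::real^'n. U (norm x) \<noteq> 0"
    using sol by (auto simp: nontrivial_radial_solution_def classical_solution_def)
  have radius: "\<exists>x::real^'n. norm x = r" if "r \<ge> 0" for r :: real
    using that by (intro exI[of _ "r *\<^sub>R axis undefined 1"]) simp
  have U0: "U r \<ge> 0" if "r \<ge> 0" for r using radius[OF that] Unn by metis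
  obtain b b' where b: "\<And>r. r \<ge> 0 \<Longrightarrow> (U has_real_derivative - (r * b r)) (at r within {0..})"
    "continuous_on {0..} b" "\<And>r. r > 0 \<Longrightarrow> (b has_real_derivative b' r) (at r)"
    "continuous_on {0<..} b'" "((\<lambda>r. r * b' r) \<longlongrightarrow> 0) (at_right 0)"
    using radial_profile[OF C2] by blast
  have E: "(n - 1) * theta lam Lam (- b r) + theta lam Lam (- b r - r * b' r + g (U r) * (r * b r)\<^sup>2) +
      phi g (U r) powr p * exp (- G_of g (U r)) = 0" if r: "r \<ge> 0" for r
  proof -
    obtain x :: "real^'n" where x: "r = norm x" using radius[OF r] by metis
    have "pucci_minus lam Lam (hessian (\<lambda>x::real^'n. U (norm x)) x +
        g (U r) *\<^sub>R tensor_square (gradient (\<lambda>x::real^'n. U (norm x)) x)) =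
      (real CARD('n) - 1) * theta lam Lam (- b r) + theta lam Lam (- b r - r * b' r + g (U r) * (r * b r)\<^sup>2)"
      by (rule pucci_radial[OF b x])
    then show ?thesis using eq[of x] by (simp only: x[symmetric] n_def)
  qed
  define v where "v r = phi g (U r)" for r
  define q where "q r = exp (G_of g (U r)) * b r" for r
  define q' where "q' r = exp (G_of g (U r)) * (b' r - g (U r) * r * (b r)\<^sup>2)" for r
  have vd: "(v has_real_derivative - (r * q r)) (at r within {0..})" if r: "r \<ge> 0" for r
    using phi_comp_deriv(1)[OF b(1)[OF r] U0 r] by (simp add: v_def[abs_def] q_def mult_ac)
  have Gd: "((\<lambda>r. G_of g (U r)) has_real_derivative g (U r) * (- (r * b r))) (at r within {0..})" if r: "r \<ge> 0" for r
    by (rule phi_comp_deriv(2)[OF b(1)[OF r] U0 r])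
  have qd: "(q has_real_derivative q' r) (at r)" if r: "r > 0" for r
  proof -
    have G: "((\<lambda>r. G_of g (U r)) has_real_derivative g (U r) * (- (r * b r))) (at r)"
      using Gd[of r] at_within_atLeast[OF r] r by simp
    have "(q has_real_derivative (exp (G_of g (U r)) * (g (U r) * (- (r * b r)))) * b r + b' r * exp (G_of g (U r))) (at r)"
      unfolding q_def[abs_def] by (rule DERIV_mult[OF DERIV_chain2[OF DERIV_exp G] b(3)[OF r]])
    moreover have "(exp (G_of g (U r)) * (g (U r) * (- (r * b r)))) * b r + b' r * exp (G_of g (U r)) = q' r"
      by (simp add: q'_def power2_eq_square algebra_simps)
    ultimately show ?thesis by simp
  qed
  have qc: "continuous_on {0..} q" unfolding q_def
    by (intro continuous_intros b(2) DERIV_continuous_on[of _ _ "\<lambda>r. g (U r) * (- (r * b r))"]) (use Gd in auto)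
  have v0: "v r \<ge> 0" if "r \<ge> 0" for r using phi_ge[OF U0[OF that]] U0[OF that] by (simp add: v_def)
  have ode: "(n - 1) * theta lam Lam (- q r) + theta lam Lam (- (q r + r * q' r)) + v r powr p = 0" if r: "r \<ge> 0" for r
  proof -
    define e where "e = exp (G_of g (U r))"
    have e: "e > 0" "exp (- G_of g (U r)) = 1 / e" by (simp_all add: e_def exp_minus divide_inverse)
    have "- (q r + r * q' r) = e * (- b r - r * b' r + g (U r) * (r * b r)\<^sup>2)"
      by (simp add: q_def q'_def e_def power2_eq_square algebra_simps)
    moreover have "- q r = e * (- b r)" by (simp add: q_def e_def)
    ultimately have "(n - 1) * theta lam Lam (- q r) + theta lam Lam (- (q r + r * q' r)) + v r powr p
      = e * ((n - 1) * theta lam Lam (- b r) + theta lam Lam (- b r - r * b' r + g (U r) * (r * b r)\<^sup>2) + v r powr p * (1 / e))"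
      using e(1) by (simp only: theta_mult) (simp add: algebra_simps)
    then show ?thesis using E[OF r] by (simp add: e(2) v_def)
  qed
  \<comment> \<open>Where \<open>q < 0\<close> the tangential terms are positive, so the radial term
    is negative, which means \<open>(r q)' > 0\<close>. Hence \<open>r q\<close> cannot become
    negative after starting from 0.\<close>
  have qnn: "q r \<ge> 0" if r: "r > 0" for r
  proof -
    have "r * q r \<ge> 0"
    proof (rule comparison_nonneg[where a = 0 and c = "\<lambda>_. 0" and q = "\<lambda>r. r * q r"])
      show "continuous_on {0..r} (\<lambda>r. r * q r)" by (intro continuous_intros continuous_on_subset[OF qc]) auto
      fix t assume t: "0 < t" "t < r" "t * q t < 0"
      then have qt: "q t < 0" by (simp add: mult_less_0_iff)
      then have "theta lam Lam (- q t) > 0" using lam by (simp add: theta_alt mult_pos_neg)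
      then have "(n - 1) * theta lam Lam (- q t) > 0" using n_gt by simp
      then have "theta lam Lam (- (q t + t * q' t)) < 0" using ode[of t] t powr_ge_zero[of "v t" p] by linarith
      then have "q t + t * q' t \<ge> 0" using lam Lam by (auto simp: theta_alt mult_less_0_iff split: if_splits)
      moreover have "((\<lambda>r. r * q r) has_real_derivative 1 * q t + q' t * t) (at t)"
        using t by (intro DERIV_mult DERIV_ident qd) auto
      ultimately show "\<exists>D. ((\<lambda>r. r * q r) has_real_derivative D) (at t) \<and> 0 * (t * q t) \<le> D"
        by (intro exI[of _ "1 * q t + q' t * t"]) (auto simp: mult.commute)
    qed (use r in \<open>auto intro!: continuous_intros\<close>)
    then show ?thesis using r by (simp add: zero_le_mult_iff)
  qed
  have vdec: "v r \<le> v 0" if r: "r \<ge> 0" for r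
  proof (rule DERIV_nonpos_imp_decreasing_open[OF r])
    show "continuous_on {0..r} v"
      by (rule continuous_on_subset[OF DERIV_continuous_on[of "{0..}" v "\<lambda>r. - (r * q r)"]]) (use vd in auto)
    fix t assume t: "0 < t" "t < r"
    then show "\<exists>y. (v has_real_derivative y) (at t) \<and> y \<le> 0"
      using vd[of t] at_within_atLeast[of t] qnn[of t] by (intro exI[of _ "- (t * q t)"]) auto
  qed
  define c where "c = v 0"
  have c: "c > 0"
  proof -
    obtain x :: "real^'n" where x: "U (norm x) \<noteq> 0" using nontriv by blast
    then have "v (norm x) \<noteq> 0" using phi_eq_0[OF Unn[of x]] by (simp add: v_def)
    then show ?thesis using v0[of "norm x"] vdec[of "norm x"] by (simp add: c_def)
  qed
  \<comment> \<open>With \<open>d^2 = \<Lambda> c^(1-p)\<close> the function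
    \<open>v (d r) / c\<close> has the value 1 at 0 and solves the equation with \<Lambda> replaced
    by 1.\<close>
  define d where "d = sqrt (Lam * c powr (1 - p))"
  have d: "d > 0" using c Lam by (simp add: d_def)
  have d2: "d\<^sup>2 = Lam * c powr (1 - p)" using c Lam by (simp add: d_def)
  define V where "V r = v (d * r) / c" for r
  define Q where "Q r = d\<^sup>2 / c * q (d * r)" for r
  have Qc: "continuous_on {0..} Q" unfolding Q_def
    by (intro continuous_intros continuous_on_compose2[OF qc]) (use d in auto)
  have Vd: "(V has_real_derivative - (r * Q r)) (at r within {0..})" if r: "r \<ge> 0" for r
  proof -
    have sub: "(\<lambda>r. d * r) ` {0..} \<subseteq> {0..}" using d by auto
    have "((\<lambda>r. v (d * r)) has_real_derivative - (d * r * q (d * r)) * d) (at r within {0..})"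
      using DERIV_image_chain[OF has_field_derivative_subset[OF vd sub] DERIV_cmult_Id[of d]] r d by (simp add: o_def)
    from DERIV_cdivide[OF this, of c] show ?thesis
      by (simp add: V_def[abs_def] Q_def power2_eq_square mult_ac)
  qed
  have V01: "0 \<le> V r" "V r \<le> 1" if "r \<ge> 0" for r
    using v0[of "d * r"] vdec[of "d * r"] that d c by (auto simp: V_def c_def[symmetric])
  have hV: "height Q r = V r" if r: "r \<ge> 0" for r
  proof -
    have "((\<lambda>t. - (t * Q t)) has_integral V r - V 0) {0..r}"
    proof (rule fundamental_theorem_of_calculus[OF r])
      fix t assume "t \<in> {0..r}"
      then show "(V has_vector_derivative - (t * Q t)) (at t within {0..r})"
        unfolding has_real_derivative_iff_has_vector_derivative[symmetric]
        by (intro has_field_derivative_subset[OF Vd]) auto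
    qed
    then have "integral {0..r} (\<lambda>t. t * Q t) = V 0 - V r"
      using has_integral_neg_iff[of "\<lambda>t. t * Q t"] by (auto dest!: integral_unique)
    moreover have "V 0 = 1" using c by (simp add: V_def c_def)
    ultimately show ?thesis by (simp add: height_def)
  qed
  have Qode: "(Q has_real_derivative (Psi p (height Q r) (Q r) - N * Q r) / r) (at r)" if r: "r > 0" for r
  proof -
    define s where "s = d * r"
    have s: "s > 0" using r d by (simp add: s_def)
    have Qd: "(Q has_real_derivative d\<^sup>2 / c * (q' s * d)) (at r)"
      unfolding Q_def[abs_def] s_def using qd[of "d * r"] r d
      by (intro DERIV_cmult DERIV_chain2[OF _ DERIV_cmult_Id]) auto
    define A where "A = v s powr p / Lam - (n - 1) * q s"
    have "theta lam Lam (- (q s + s * q' s)) = - Lam * A"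
      using ode[of s] s theta_uminus[OF qnn[OF s], of lam Lam] Lam by (simp add: A_def algebra_simps)
    then have qs': "q s + s * q' s = kap * A - (kap - 1) * max 0 A"
      unfolding kap_def by (rule iffD1[OF theta_eq_iff[OF lam]])
    define t where "t = d\<^sup>2 / c"
    have t: "t > 0" using d c by (simp add: t_def)
    have Qs: "Q r = t * q s" by (simp add: Q_def t_def s_def)
    have Q0: "Q r \<ge> 0" using Qs t qnn[OF s] by simp
    have tv: "t * (v s powr p / Lam) = V r powr p"
    proof -
      have "V r powr p = v s powr p / c powr p" using v0[of s] s c by (simp add: V_def s_def powr_divide)
      moreover have "c powr (1 - p) / c = 1 / c powr p" using c by (simp add: powr_diff)
      then have "t / Lam = 1 / c powr p" using Lam by (simp add: t_def d2)
      ultimately show ?thesis using Lam by (simp add: field_simps)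
    qed
    have tA: "t * A = V r powr p - (n - 1) * Q r" unfolding A_def Qs right_diff_distrib tv by simp
    have nlV: "nl p (height Q r) = V r powr p" using hV[of r] r V01[of r] by (simp add: nl_def)
    have "Psi p (height Q r) (Q r) - N * Q r = kap * (t * A) - (kap - 1) * max 0 (t * A) - Q r"
      unfolding Psi_def nlV tA using Q0 by (simp add: N_def algebra_simps)
    also have "max 0 (t * A) = t * max 0 A" using t by (simp add: max_mult_distrib_left)
    also have "kap * (t * A) - (kap - 1) * (t * max 0 A) - Q r = t * (kap * A - (kap - 1) * max 0 A - q s)"
      unfolding Qs by (simp add: algebra_simps)
    also have "\<dots> = t * (s * q' s)" using qs' by simp
    finally have "(Psi p (height Q r) (Q r) - N * Q r) / r = t * (q' s * d)" using r by (simp add: s_def)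
    then show ?thesis using Qd by (simp add: t_def)
  qed
  have QQ: "Q r = qs p r" if "r \<ge> 0" for r
    by (rule fixpoint_of_ode[OF _ Qc Qode that]) (use p in simp)
  have VV: "V r = vs p r" if r: "r \<ge> 0" for r
  proof -
    have "integral {0..r} (\<lambda>t. t * Q t) = integral {0..r} (\<lambda>t. t * qs p t)"
      using QQ by (intro integral_cong) auto
    then show ?thesis using hV[OF r] by (simp add: vs_def height_def)
  qed
  have "vs p r > 0" if r: "r \<ge> 0" for r
  proof -
    \<comment> \<open>Nonnegativity one unit further and strict monotonicity exclude a zero at
      \<open>r\<close>.\<close>
    have "vs p (r + 1) < vs p r" using p r by (intro vs_less) auto
    moreover have "vs p (r + 1) \<ge> 0" using VV[of "r + 1"] V01(1)[of "r + 1"] r by simp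
    ultimately show ?thesis by simp
  qed
  moreover have "phi g (U r) = c * vs p (r / d)" if r: "r \<ge> 0" for r
  proof -
    have "V (r / d) = vs p (r / d)" using r d by (intro VV) auto
    then show ?thesis using c d by (simp add: V_def v_def field_simps)
  qed
  ultimately show ?thesis using U0 c unfolding d_def by blast
qed

text \<open>The converse, with the scaling factor 1. Positivity keeps the profile where
  \<open>psi\<close> is differentiable.\<close>

lemma profile_solution:
  fixes lam Lam p :: real
  assumes p: "p > 1" and lam: "0 < lam" "lam \<le> Lam" and n3: "CARD('n::finite) \<ge> 3"
    and n_def: "n = real CARD('n)" and kap_def: "kap = Lam / lam"
    and pos: "\<And>r. r \<ge> 0 \<Longrightarrow> pucci_ode.vs n kap p r > 0"
  shows "nontrivial_radial_solution TYPE('n) lam Lam g p (\<lambda>r. psi (pucci_ode.vs n kap p (r / sqrt Lam)))"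
proof -
  interpret pucci_ode n kap by unfold_locales (use n3 lam in \<open>auto simp: n_def kap_def\<close>)
  have Lam: "Lam > 0" using lam by simp
  have p1: "p \<ge> 1" using p by simp
  define d where "d = sqrt Lam"
  have d: "d > 0" "d * d = Lam" using Lam by (simp_all add: d_def)
  define v where "v r = vs p (r / d)" for r
  define q where "q r = qs p (r / d) / Lam" for r
  define w where "w r = (Psi p (vs p (r / d)) (qs p (r / d)) - N * qs p (r / d)) / Lam" for r
  define U where "U r = psi (v r)" for r
  define b where "b r = exp (- G_of g (U r)) * q r" for r
  define b' where "b' r = exp (- G_of g (U r)) * (w r + g (U r) * r\<^sup>2 * b r * q r) / r" for r
  have v: "v r > 0" if "r \<ge> 0" for r using pos[of "r / d"] that d by (simp add: v_def)
  have Up: "U r > 0" if "r \<ge> 0" for r using psi_pos[OF v[OF that]] by (simp add: U_def)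
  have q0: "q r \<ge> 0" if "r \<ge> 0" for r using qs_nonneg[OF p1, of "r / d"] that d Lam by (simp add: q_def)
  have vd: "(v has_real_derivative - (r * q r)) (at r within {0..})" if r: "r \<ge> 0" for r
  proof -
    have sub: "(\<lambda>r. r / d) ` {0..} \<subseteq> {0..}" using d by auto
    have "(vs p has_real_derivative - (r / d * qs p (r / d))) (at (r / d) within {0..})"
    proof -
      have "(vs p has_real_derivative - (r / d * qs p (r / d))) (at (r / d) within {0..r / d + 1})"
        unfolding vs_def using r d by (intro height_deriv_within continuous_on_subset[OF qs_cont[OF p1]]) auto
      then show ?thesis using at_within_Icc_atLeast[of "r / d" "r / d + 1"] r d by simp
    qed
    from DERIV_image_chain[OF has_field_derivative_subset[OF this sub] DERIV_cdivide[OF DERIV_ident]]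
    have "(v has_real_derivative - (r / d * qs p (r / d)) * (1 / d)) (at r within {0..})" by (simp add: o_def v_def[abs_def])
    moreover have "- (r / d * qs p (r / d)) * (1 / d) = - (r * q r)" using d by (simp add: q_def d(2)[symmetric])
    ultimately show ?thesis by simp
  qed
  have Ud: "(U has_real_derivative - (r * b r)) (at r within {0..})" if r: "r \<ge> 0" for r
  proof -
    have "(U has_real_derivative exp (- G_of g (psi (v r))) * - (r * q r)) (at r within {0..})"
      unfolding U_def[abs_def] by (rule DERIV_chain2[OF psi_deriv[OF v[OF r]] vd[OF r]])
    then show ?thesis by (simp add: b_def U_def mult_ac)
  qed
  have Gd: "((\<lambda>r. G_of g (U r)) has_real_derivative g (U r) * (- (r * b r))) (at r within {0..})" if r: "r \<ge> 0" for r
    by (rule phi_comp_deriv(2)[OF Ud[OF r] _ r]) (use Up in \<open>auto intro: less_imp_le\<close>)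
  have qc: "continuous_on {0..} q" unfolding q_def
    by (intro continuous_intros continuous_on_compose2[OF qs_cont[OF p1]]) (use d Lam in auto)
  have wc: "continuous_on {0..} w" unfolding w_def
    using p by (intro continuous_intros Psi_cont continuous_on_compose2[OF qs_cont[OF p1]] continuous_on_compose2[OF vs_cont[OF p1]])
      (use d Lam in auto)
  have Uc: "continuous_on {0..} U" by (rule DERIV_continuous_on) (use Ud in auto)
  have Gc: "continuous_on {0..} (\<lambda>r. G_of g (U r))" by (rule DERIV_continuous_on) (use Gd in auto)
  have gc: "continuous_on {0..} (\<lambda>r. g (U r))"
    by (rule continuous_on_compose2[OF g_cont Uc]) (use Up in \<open>auto intro: less_imp_le\<close>)
  have bc: "continuous_on {0..} b" unfolding b_def by (intro continuous_intros Gc qc)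
  have nc: "continuous_on {0..} (\<lambda>r. exp (- G_of g (U r)) * (w r + g (U r) * r\<^sup>2 * b r * q r))"
    by (intro continuous_intros Gc wc gc bc qc)
  have qd: "(q has_real_derivative w r / r) (at r)" if r: "r > 0" for r
  proof -
    have "(qs p has_real_derivative (Psi p (vs p (r / d)) (qs p (r / d)) - N * qs p (r / d)) / (r / d)) (at (r / d))"
      using r d by (intro qs_deriv p1) auto
    from DERIV_cdivide[OF DERIV_chain2[OF this DERIV_cdivide[OF DERIV_ident, of d]], of Lam]
    show ?thesis using r d by (simp add: q_def[abs_def] w_def mult.commute)
  qed
  have bd: "(b has_real_derivative b' r) (at r)" if r: "r > 0" for r
  proof -
    have G: "((\<lambda>r. - G_of g (U r)) has_real_derivative - (g (U r) * (- (r * b r)))) (at r)"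
      using DERIV_minus[OF Gd[of r]] at_within_atLeast[OF r] r by simp
    have "(b has_real_derivative (exp (- G_of g (U r)) * - (g (U r) * (- (r * b r)))) * q r + w r / r * exp (- G_of g (U r))) (at r)"
      unfolding b_def[abs_def] using DERIV_mult[OF DERIV_chain2[OF DERIV_exp G] qd[OF r]] by (simp add: b_def)
    moreover have "(exp (- G_of g (U r)) * - (g (U r) * (- (r * b r)))) * q r + w r / r * exp (- G_of g (U r)) = b' r"
      using r by (simp add: b'_def power2_eq_square field_simps)
    ultimately show ?thesis by simp
  qed
  \<comment> \<open>\<open>w\<close> is \<open>r q'\<close>. That it vanishes at the origin gives
    the condition at 0 in \<open>C2_radial\<close>, and it follows from
    \<open>qs p 0 = 1 / n\<close>.\<close>
  have w0: "w 0 = 0"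
  proof -
    have "nl p 1 = 1" by (simp add: nl_def)
    moreover have "kap - (kap - 1) * (1 - (n - 1) / n) - N / n = 0" using n_gt by (simp add: N_def field_simps)
    ultimately show ?thesis using n_gt by (simp add: w_def vs_0 qs_0[OF p1] Psi_def max_def field_simps)
  qed
  have b'c: "continuous_on {0<..} b'" unfolding b'_def
    by (intro continuous_on_divide continuous_on_subset[OF nc] continuous_intros) auto
  have b'0: "((\<lambda>r. r * b' r) \<longlongrightarrow> 0) (at_right 0)"
  proof -
    have "((\<lambda>r. exp (- G_of g (U r)) * (w r + g (U r) * r\<^sup>2 * b r * q r)) \<longlongrightarrow> 0) (at_right 0)"
      using at_right_0_of_continuous[OF nc] by (simp add: w0)
    then show ?thesis by (rule Lim_transform_eventually) (auto simp: eventually_at_filter b'_def)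
  qed
  have rb': "r * b' r = exp (- G_of g (U r)) * (w r + g (U r) * r\<^sup>2 * b r * q r)" if "r \<ge> 0" for r
    using that w0 by (cases "r = 0") (auto simp: b'_def)
  have ode: "(n - 1) * theta lam Lam (- q r) + theta lam Lam (- (q r + w r)) + v r powr p = 0" if r: "r \<ge> 0" for r
  proof -
    define A where "A = v r powr p / Lam - (n - 1) * q r"
    have v1: "v r \<le> 1" unfolding v_def using r d by (intro vs_le_1 p1) auto
    have f: "nl p (vs p (r / d)) = v r powr p" using nl_eq[OF v[OF r] v1] by (simp add: v_def)
    have qL: "qs p (r / d) = Lam * q r" using Lam by (simp add: q_def)
    have LA: "Lam * A = v r powr p - (n - 1) * (Lam * q r)" using Lam by (simp add: A_def algebra_simps)
    have "Psi p (vs p (r / d)) (qs p (r / d)) = kap * (v r powr p) - (kap - 1) * max 0 (Lam * A)"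
      unfolding Psi_def f qL LA using q0[OF r] Lam by simp
    also have "max 0 (Lam * A) = Lam * max 0 A" using Lam by (simp add: max_mult_distrib_left)
    finally have Psi: "Psi p (vs p (r / d)) (qs p (r / d)) = kap * (v r powr p) - (kap - 1) * (Lam * max 0 A)" .
    have "Lam * w r = Psi p (vs p (r / d)) (qs p (r / d)) - N * (Lam * q r)" using Lam by (simp add: w_def qL)
    then have "Lam * (q r + w r) = kap * (v r powr p) - (kap - 1) * (Lam * max 0 A) - N * (Lam * q r) + Lam * q r"
      unfolding Psi by (simp add: distrib_left)
    also have "v r powr p = Lam * A + (n - 1) * (Lam * q r)" using LA by simp
    also have "kap * (Lam * A + (n - 1) * (Lam * q r)) - (kap - 1) * (Lam * max 0 A) - N * (Lam * q r) + Lam * q r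
      = Lam * (kap * A - (kap - 1) * max 0 A)"
      by (simp add: N_def algebra_simps)
    finally have "q r + w r = kap * A - (kap - 1) * max 0 A" using Lam by simp
    from this[unfolded kap_def] have "theta lam Lam (- (q r + w r)) = - Lam * A" by (rule iffD2[OF theta_eq_iff[OF lam]])
    then show ?thesis using theta_uminus[OF q0[OF r], of lam Lam] LA by (simp add: algebra_simps)
  qed
  have E: "(n - 1) * theta lam Lam (- b r) + theta lam Lam (- b r - r * b' r + g (U r) * (r * b r)\<^sup>2) +
      phi g (U r) powr p * exp (- G_of g (U r)) = 0" if r: "r \<ge> 0" for r
  proof -
    define e where "e = exp (- G_of g (U r))"
    have e: "e > 0" by (simp add: e_def)
    have be: "b r = e * q r" by (simp add: b_def e_def)
    have rbe: "r * b' r = e * (w r + g (U r) * r\<^sup>2 * (e * q r) * q r)" using rb'[OF r] by (simp add: be e_def)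
    have 1: "- b r - r * b' r + g (U r) * (r * b r)\<^sup>2 = e * (- (q r + w r))"
      unfolding rbe be by (simp add: power2_eq_square algebra_simps)
    have 2: "- b r = e * (- q r)" by (simp add: be)
    have 3: "phi g (U r) = v r" using phi_psi[of "v r"] v[OF r] by (simp add: U_def)
    have "(n - 1) * theta lam Lam (- b r) + theta lam Lam (- b r - r * b' r + g (U r) * (r * b r)\<^sup>2) + phi g (U r) powr p * e
      = e * ((n - 1) * theta lam Lam (- q r) + theta lam Lam (- (q r + w r)) + v r powr p)"
      unfolding 1 unfolding 2 3 theta_mult[OF e] by (simp add: algebra_simps)
    then show ?thesis using ode[OF r] by (simp add: e_def)
  qed
  have "classical_solution lam Lam g p (\<lambda>x::real^'n. U (norm x))"
    unfolding classical_solution_def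
  proof (intro conjI allI)
    show "C2 (\<lambda>x::real^'n. U (norm x))" by (rule C2_radial(1)[OF Ud bc bd b'c b'0])
    fix x :: "real^'n"
    show "0 \<le> U (norm x)" using Up[of "norm x"] by simp
    have "pucci_minus lam Lam (hessian (\<lambda>x::real^'n. U (norm x)) x +
        g (U (norm x)) *\<^sub>R tensor_square (gradient (\<lambda>x::real^'n. U (norm x)) x)) =
      (real CARD('n) - 1) * theta lam Lam (- b (norm x)) +
      theta lam Lam (- b (norm x) - norm x * b' (norm x) + g (U (norm x)) * (norm x * b (norm x))\<^sup>2)"
      by (rule pucci_radial[OF Ud bc bd b'c b'0 refl])
    then show "pucci_minus lam Lam (hessian (\<lambda>x::real^'n. U (norm x)) x +
        g (U (norm x)) *\<^sub>R tensor_square (gradient (\<lambda>x::real^'n. U (norm x)) x)) +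
        phi g (U (norm x)) powr p * exp (- G_of g (U (norm x))) = 0"
      using E[of "norm x"] by (simp only: n_def norm_ge_zero)
  qed
  moreover have "U (norm (0::real^'n)) \<noteq> 0" using Up[of 0] by simp
  ultimately have "nontrivial_radial_solution TYPE('n) lam Lam g p U"
    unfolding nontrivial_radial_solution_def by blast
  then show ?thesis by (simp add: U_def[abs_def] v_def d_def)
qed

end


section \<open>The main theorem\<close>


lemma eventually_scale_at_top: "d > 0 \<Longrightarrow> eventually P at_top \<Longrightarrow> \<forall>\<^sub>F r in at_top. P (r / d)" for d :: real
  using eventually_compose_filterlim[of P at_top "\<lambda>r. r / d" at_top]
    filterlim_tendsto_pos_mult_at_top[OF tendsto_const _ filterlim_ident, of "1 / d"] by simp

context nonlinearity begin

text \<open>Both solutions come from the same \<open>f\<close>, which leaves \<open>c2 / c1\<close>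
  as the scaling parameter. The radii match because \<open>sqrt (Lam * c powr (1 - p))\<close> is
  proportional to \<open>c powr (- 1 / alpha_of p)\<close>.\<close>

lemma solutions_scaled:
  assumes p: "p > 1" and Lam: "Lam > 0" and c: "c1 > 0" "c2 > 0"
    and U: "\<And>r. r \<ge> 0 \<Longrightarrow> phi g (U r) = c1 * f (r / sqrt (Lam * c1 powr (1 - p)))"
    and V: "\<And>r. r \<ge> 0 \<Longrightarrow> phi g (V r) = c2 * f (r / sqrt (Lam * c2 powr (1 - p)))"
    and V0: "\<And>r. r \<ge> 0 \<Longrightarrow> V r \<ge> 0"
  shows "\<exists>c>0. \<forall>r\<ge>0. V r = scaled g p c U r"
proof (intro exI[of _ "c2 / c1"] conjI allI impI)
  fix r :: real assume r: "r \<ge> 0"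
  define e where "e = (p - 1) / 2"
  have sq: "sqrt (Lam * c powr (1 - p)) = sqrt Lam * c powr (- e)" if "c > 0" for c
  proof -
    have "sqrt (c powr (1 - p)) = c powr ((1 - p) / 2)" using that by (simp add: powr_half_sqrt[symmetric] powr_powr)
    also have "(1 - p) / 2 = - e" unfolding e_def by (simp only: minus_divide_left minus_diff_eq)
    finally show ?thesis by (simp add: real_sqrt_mult)
  qed
  have "(c2 / c1) powr e * r / (sqrt Lam * c1 powr (- e)) = r / (sqrt Lam * c2 powr (- e))"
    using c Lam by (simp add: powr_divide powr_minus field_simps)
  then have "c2 / c1 * phi g (U ((c2 / c1) powr e * r)) = phi g (V r)"
    using U[of "(c2 / c1) powr e * r"] V[OF r] r c by (simp add: sq)
  moreover have "1 / alpha_of p = e" by (simp add: alpha_of_def e_def)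
  ultimately show "V r = scaled g p (c2 / c1) U r" using psi_phi[OF V0[OF r]] by (simp add: scaled_def)
qed (use c in simp)

lemma scaled_decay:
  assumes c: "c > 0" "d > 0" and U: "\<And>r. r \<ge> 0 \<Longrightarrow> phi g (U r) = c * f (r / d)"
    and f: "((\<lambda>r. r powr a * f r) \<longlongrightarrow> C) at_top"
  shows "((\<lambda>r. r powr a * phi g (U r)) \<longlongrightarrow> c * d powr a * C) at_top"
proof -
  have "filterlim (\<lambda>r. r / d) at_top at_top"
    using filterlim_tendsto_pos_mult_at_top[OF tendsto_const _ filterlim_ident, of "1 / d"] c by simp
  from tendsto_mult_left[OF filterlim_compose[OF f this], of "c * d powr a"]
  show ?thesis
  proof (rule Lim_transform_eventually)
    show "\<forall>\<^sub>F r in at_top. c * d powr a * ((r / d) powr a * f (r / d)) = r powr a * phi g (U r)"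
      using eventually_ge_at_top[of 0] by eventually_elim (use c U in \<open>simp add: powr_divide\<close>)
  qed
qed

text \<open>The lower and upper limits are positive and finite, and the two kinds of decay are the
  cases where they agree or differ.\<close>

lemma slow_or_pseudo_slow:
  assumes c1: "c1 > 0" and ev: "\<forall>\<^sub>F r in at_top. c1 \<le> r powr alpha_of p * phi g (U r) \<and> r powr alpha_of p * phi g (U r) \<le> c2"
  shows "slow_decaying g p U \<or> pseudo_slow_decaying g p U"
proof -
  define h where "h r = r powr alpha_of p * phi g (U r)" for r
  define l where "l = Liminf at_top (\<lambda>r. ereal (h r))"
  define L where "L = Limsup at_top (\<lambda>r. ereal (h r))"
  have "ereal c1 \<le> l" unfolding l_def by (rule Liminf_bounded) (use ev in \<open>auto simp: h_def elim: eventually_mono\<close>)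
  moreover have "L \<le> ereal c2" unfolding L_def by (rule Limsup_bounded) (use ev in \<open>auto simp: h_def elim: eventually_mono\<close>)
  moreover have lL: "l \<le> L" unfolding l_def L_def by (rule Liminf_le_Limsup) simp
  ultimately obtain l' L' where l': "l = ereal l'" "L = ereal L'" "c1 \<le> l'"
    by (cases l; cases L) auto
  show ?thesis
  proof (cases "l' = L'")
    case True
    then have "((\<lambda>r. ereal (h r)) \<longlongrightarrow> ereal l') at_top"
      using l' by (subst tendsto_iff_Liminf_eq_Limsup) (auto simp: l_def L_def)
    then have "(h \<longlongrightarrow> l') at_top" by simp
    then show ?thesis using l' c1 unfolding slow_decaying_def h_def by (intro disjI1 exI[of _ l']) auto
  next
    case False
    then have "l' < L'" using lL l' by simp
    then show ?thesis unfolding pseudo_slow_decaying_def h_def[symmetric] l_def[symmetric] L_def[symmetric]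
      using l' c1 by (intro disjI2 exI[of _ l'] exI[of _ L']) auto
  qed
qed

end

text \<open>The strict bounds on \<open>pstar\<close> by \<open>po\<close> and \<open>pp\<close> are
  claimed for \<lambda> < \<Lambda> only: if \<lambda> = \<Lambda>, then \<open>N = n\<close>,
  \<open>po = pp\<close>, and \<open>pstar\<close> is their common value.\<close>

theorem theorem1p9:
  fixes lam Lam :: real and g :: "real \<Rightarrow> real" and n N ps po pp :: real
  assumes n_def: "n = real CARD('n::finite)"
    and n_ge: "CARD('n) \<ge> 3"
    and ell: "0 < lam" "lam \<le> Lam"
    and N_def: "N = Lam / lam * (n - 1) + 1"
    and g_cont: "continuous_on {0..} g"
    and g_nonneg: "\<forall>t\<ge>0. g t \<ge> 0"
    and ps_def: "ps = N / (N - 2)"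
    and po_def: "po = (N + 2) / (N - 2)"
    and pp_def: "pp = (n + 2) / (n - 2)"
  shows "\<exists>pstar::real.
     1 < ps \<and> ps < pstar \<and> po \<le> pstar \<and> pstar \<le> pp \<and>
     (lam < Lam \<longrightarrow> po < pstar \<and> pstar < pp) \<and>
     (\<forall>p. 1 < p \<and> p < pstar \<longrightarrow>
        \<not> (\<exists>U. nontrivial_radial_solution TYPE('n) lam Lam g p U)) \<and>
     unique_up_to_scaling g pstar
       (\<lambda>U. nontrivial_radial_solution TYPE('n) lam Lam g pstar U \<and> fast_decaying N g U) \<and>
     (\<forall>p. pstar < p \<and> p \<le> pp \<longrightarrow>
        unique_up_to_scaling g p (nontrivial_radial_solution TYPE('n) lam Lam g p) \<and>
        (\<forall>U. nontrivial_radial_solution TYPE('n) lam Lam g p U \<longrightarrow>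
           slow_decaying g p U \<or> pseudo_slow_decaying g p U)) \<and>
     (\<forall>p. p > pp \<longrightarrow>
        unique_up_to_scaling g p
          (\<lambda>U. nontrivial_radial_solution TYPE('n) lam Lam g p U \<and> slow_decaying g p U))"
proof -
  interpret nonlinearity g by unfold_locales (use g_cont g_nonneg in auto)
  define kap where "kap = Lam / lam"
  interpret P: pucci_ode n kap by unfold_locales (use n_ge ell in \<open>auto simp: n_def kap_def\<close>)
  have Lam: "Lam > 0" using ell by simp
  have N: "N = P.N" by (simp only: N_def P.N_def) (simp add: kap_def)
  have po: "po = P.po" by (simp add: po_def P.po_def N)
  have pp: "pp = P.pp" by (simp add: pp_def P.pp_def)
  let ?sol = "\<lambda>p. nontrivial_radial_solution TYPE('n) lam Lam g p"
  have fwd: "(\<forall>r\<ge>0. U r \<ge> 0 \<and> P.vs p r > 0) \<and>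
    (\<exists>c>0. \<forall>r\<ge>0. phi g (U r) = c * P.vs p (r / sqrt (Lam * c powr (1 - p))))" if "p > 1" "?sol p U" for p U
    by (rule solution_profile[OF that(2,1) ell n_ge n_def kap_def])
  have ex: "\<exists>U. ?sol p U" if "p > 1" "\<And>r. r \<ge> 0 \<Longrightarrow> P.vs p r > 0" for p
    using profile_solution[OF that(1) ell n_ge n_def kap_def that(2)] by blast
  have scaled: "\<exists>c>0. \<forall>r\<ge>0. V r = scaled g p c U r" if p: "p > 1" and U: "?sol p U" and V: "?sol p V" for p U V
  proof -
    obtain c1 where c1: "c1 > 0" "\<forall>r\<ge>0. phi g (U r) = c1 * P.vs p (r / sqrt (Lam * c1 powr (1 - p)))"
      using fwd[OF p U] by blast
    obtain c2 where c2: "c2 > 0" "\<forall>r\<ge>0. phi g (V r) = c2 * P.vs p (r / sqrt (Lam * c2 powr (1 - p)))"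
      using fwd[OF p V] by blast
    show ?thesis by (rule solutions_scaled[OF p Lam c1(1) c2(1), where f = "P.vs p"]) (use c1 c2 fwd[OF p V] in auto)
  qed
  have decay: "\<exists>C>0. ((\<lambda>r. r powr a * phi g (U r)) \<longlongrightarrow> C) at_top"
    if p: "p > 1" and U: "?sol p U" and C: "\<exists>C>0. ((\<lambda>r. r powr a * P.vs p r) \<longlongrightarrow> C) at_top" for p U a
  proof -
    obtain c where c: "c > 0" "\<forall>r\<ge>0. phi g (U r) = c * P.vs p (r / sqrt (Lam * c powr (1 - p)))"
      using fwd[OF p U] by blast
    obtain C where C: "C > 0" "((\<lambda>r. r powr a * P.vs p r) \<longlongrightarrow> C) at_top" using C by blast
    define d where "d = sqrt (Lam * c powr (1 - p))"
    have d: "d > 0" using c Lam by (simp add: d_def)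
    have "((\<lambda>r. r powr a * phi g (U r)) \<longlongrightarrow> c * d powr a * C) at_top"
      by (rule scaled_decay[OF c(1) d _ C(2)]) (use c d_def in auto)
    moreover have "c * d powr a * C > 0" using c d C by (intro mult_pos_pos) auto
    ultimately show ?thesis by blast
  qed
  have slow_pseudo: "slow_decaying g p U \<or> pseudo_slow_decaying g p U" if p: "p > P.pst" and U: "?sol p U" for p U
  proof -
    have p1: "p > 1" using p P.pst_gt by simp
    obtain c where c: "c > 0" "\<forall>r\<ge>0. phi g (U r) = c * P.vs p (r / sqrt (Lam * c powr (1 - p)))"
      using fwd[OF p1 U] by blast
    define d where "d = sqrt (Lam * c powr (1 - p))"
    have d: "d > 0" using c Lam by (simp add: d_def)
    obtain c1 c2 where b: "c1 > 0" "\<forall>\<^sub>F r in at_top. c1 \<le> r powr (2 / (p - 1)) * P.vs p r \<and> r powr (2 / (p - 1)) * P.vs p r \<le> c2"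
      using P.slow_bounds[OF p] by blast
    define K where "K = c * d powr alpha_of p"
    have K: "K > 0" using c d by (simp add: K_def)
    have "\<forall>\<^sub>F r in at_top. K * c1 \<le> r powr alpha_of p * phi g (U r) \<and> r powr alpha_of p * phi g (U r) \<le> K * c2"
      using eventually_scale_at_top[OF d b(2)] eventually_ge_at_top[of 0]
    proof eventually_elim
      case (elim r)
      have "r powr alpha_of p * phi g (U r) = K * ((r / d) powr (2 / (p - 1)) * P.vs p (r / d))"
        using c(2) elim(2) d by (simp add: K_def d_def[symmetric] powr_divide alpha_of_def)
      then show ?case using elim(1) K by (simp add: mult_left_mono)
    qed
    then show ?thesis using slow_or_pseudo_slow[of "K * c1" p U "K * c2"] K b(1) by simp
  qed
  have pst1: "P.pst > 1" by (rule P.pst_gt)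
  have pp_pst: "p > P.pst" "p > 1" if "p > pp" for p using that P.pst_le_pp pst1 by (auto simp: pp)
  \<comment> \<open>For a fixed exponent all nontrivial radial solutions are rescalings of one
    profile and share its decay. A decay property therefore does not narrow the class, and
    uniqueness holds among all of them.\<close>
  have uniq: "unique_up_to_scaling g p (\<lambda>U. ?sol p U \<and> R U)"
    if p: "p > 1" "\<And>r. r \<ge> 0 \<Longrightarrow> P.vs p r > 0" and R: "\<And>U. ?sol p U \<Longrightarrow> R U" for p R
    unfolding unique_up_to_scaling_def using ex[OF p] R scaled[OF p(1)] by blast
  have "1 < ps" "ps < po" using P.N_ge by (auto simp: ps_def po_def N field_simps)
  moreover have "P.po \<le> P.pst" by (rule P.po_le_pst)
  moreover have "P.pst \<le> P.pp" by (rule P.pst_le_pp)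
  moreover have "P.po < P.pst \<and> P.pst < P.pp" if "lam < Lam"
  proof -
    have "kap > 1" using that ell by (simp add: kap_def)
    then show ?thesis using P.po_less_pst P.pst_less_pp by simp
  qed
  moreover have "\<not> ?sol p U" if p: "1 < p" "p < P.pst" for p U
    using P.crossing_profile[OF p] fwd[OF p(1), of U] by (meson less_imp_le not_le)
  moreover have "unique_up_to_scaling g P.pst (\<lambda>U. ?sol P.pst U \<and> fast_decaying N g U)"
    using decay[OF pst1 _ P.fast_profile] unfolding fast_decaying_def N
    by (intro uniq pst1 P.vs_pos_pst)
  moreover have "unique_up_to_scaling g p (?sol p)" if "p > P.pst" for p
    using uniq[of p "\<lambda>_. True"] P.vs_pos_above[OF that] that pst1 by simp
  moreover have "unique_up_to_scaling g p (\<lambda>U. ?sol p U \<and> slow_decaying g p U)" if p: "p > pp" for p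
    using decay[OF pp_pst(2)[OF p] _ P.slow_limit] p unfolding slow_decaying_def alpha_of_def pp
    by (intro uniq pp_pst P.vs_pos_above) (auto simp: pp)
  ultimately show ?thesis using slow_pseudo unfolding po pp
    by (intro exI[of _ P.pst]) (auto simp: ell)
qed

end
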